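(* Let $\varepsilon\in(0,1)$ and let $\nu_\ast,\kappa>0$ be fixed constants. For any $f_{\varepsilon,0}\in H^1(\mathbf{T}^3_x;L^2(\Omega_v))$, the approximate Boltzmann equation with anomalous smoothing effect $$\varepsilon^2\partial_t\Lambda_\varepsilon(f_\varepsilon)+\varepsilon\Lambda_\varepsilon\big(v\cdot\nabla_x\Lambda_\varepsilon(f_\varepsilon)\big)=-\frac1{\nu_\ast}\Lambda_\varepsilon\Big(\mathcal{L}^\varepsilon\big(\Lambda_\varepsilon(f_\varepsilon)\big)\Big)+\frac{\varepsilon\kappa}{\nu_\ast}\Lambda_\varepsilon\Big(\mathcal{L}^\varepsilon\big(\Lambda_\varepsilon(f_\varepsilon)^2\big)\Big)-\frac{\varepsilon^2\kappa^2}{\nu_\ast}\Lambda_\varepsilon\big(\Lambda_\varepsilon(f_\varepsilon)^3\big)$$ admits a unique global solution $$f_\varepsilon\in L^\infty\big([0,\infty);H^1(\mathbf{T}^3_x;L^2(\Omega_v))\big)$$ satisfying $f_\varepsilon=\Lambda_\varepsilon(f_\varepsilon)$ and the global energy estimate $$\sup_{t\ge0}\,\mathcal{E}(f_\varepsilon)^2(t)+\frac1{\varepsilon^2\nu_\ast}\int_0^\infty\mathcal{D}_\varepsilon(f_\varepsilon)^2(s)\,ds\le\mathcal{E}(f_{\varepsilon,0})^2,$$ with $f_\varepsilon|_{t=0}=\Lambda_\varepsilon(f_{\varepsilon,0})$.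
   Context: Functions are real valued. $\mathbf{T}^3=\mathbf{R}^3/\mathbf{Z}^3$ is the position torus; $\Omega=[-1/2,1/2]^3$ is the velocity torus (opposite faces identified), and $v=(v_1,v_2,v_3)$ denotes the coordinate in $\Omega$. For $h\in H^1(\mathbf{T}^3_x;L^2(\Omega_v))$, $\|h\|_X^2:=\sum_{|\alpha|\le1}\int_{\mathbf{T}^3}\int_\Omega|\partial_x^\alpha h|^2\,dv\,dx$. Cutoff operators: fix $\gamma>0$. $\Lambda_\varepsilon^{v_j}$ is the Fourier-series truncation in the single variable $v_j$ to integer frequencies $m_j$ with $|m_j|<\varepsilon^{-\gamma}$; $\Lambda_\varepsilon^v:=\Lambda_\varepsilon^{v_3}\Lambda_\varepsilon^{v_2}\Lambda_\varepsilon^{v_1}$; $\Lambda_\varepsilon^x$ is the Fourier-series truncation in $x$ to frequencies $m\in\mathbf{Z}^3$ with Euclidean norm $|m|<\varepsilon^{-\gamma}$; $\Lambda_\varepsilon:=\Lambda_\varepsilon^x\Lambda_\varepsilon^v$. Projections: set $\mathrm{e}_0^\varepsilon:=1$, $\mathrm{e}_{1,i}^\varepsilon:=c_1^\varepsilon\Lambda_\varepsilon^{v_i}(v_i)$, $\mathrm{e}_{2,i}^\varepsilon:=c_2^\varepsilon\Lambda_\varepsilon^{v_i}(v_i^2)-c_0^\varepsilon$ $(i=1,2,3)$, $\mathrm{e}_1^\varepsilon:=(\mathrm{e}_{1,1}^\varepsilon,\mathrm{e}_{1,2}^\varepsilon,\mathrm{e}_{1,3}^\varepsilon)$, $\mathrm{e}_2^\varepsilon:=\sum_{i=1}^3\mathrm{e}_{2,i}^\varepsilon$,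 where the constants $c_0^\varepsilon,c_1^\varepsilon,c_2^\varepsilon$ are chosen so that $\{\mathrm{e}_0^\varepsilon,\mathrm{e}_{1,1}^\varepsilon,\mathrm{e}_{1,2}^\varepsilon,\mathrm{e}_{1,3}^\varepsilon,\mathrm{e}_2^\varepsilon\}$ is orthonormal in $L^2(\Omega_v)$. For $h\in L^2(\mathbf{T}^3_x;L^2(\Omega_v))$, $\mathcal{P}^\varepsilon(h):=\rho\,\mathrm{e}_0^\varepsilon+u\cdot\mathrm{e}_1^\varepsilon+\theta\,\mathrm{e}_2^\varepsilon$ with $\rho=\int_\Omega h\,\mathrm{e}_0^\varepsilon dv$, $u_i=\int_\Omega h\,\mathrm{e}_{1,i}^\varepsilon dv$, $\theta=\int_\Omega h\,\mathrm{e}_2^\varepsilon dv$, and $\mathcal{L}^\varepsilon:=I-\mathcal{P}^\varepsilon$. Energies: $\mathcal{E}(h):=\|h\|_X$, $\mathcal{D}_\varepsilon(h):=\|\mathcal{L}^\varepsilon(h)\|_X$.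
   Formalization: The estimate with sup E² plus the integral over [0,∞) fails for f0=cos(2πv1)−cos(2πv2); proved instead: E(f(t))²+(1/(ε²ν))∫_0^t D² ≤ E(f0)² for every t≥0, and (1/(ε²ν))∫_0^∞ D² ≤ E(f0)². *)

theory Defs
  imports "HOL-Analysis.Analysis"
begin

text \<open>
  A function on the position torus is a function on \<open>\<real>\<^sup>3\<close> with period 1 in each
  coordinate; integrals over the torus are taken over the unit cell. Functions of the velocity
  matter only on \<open>\<Omega> = [-1/2, 1/2]\<^sup>3\<close>. Elements of the function spaces below are represented by
  functions \<open>h (x, v)\<close>, and two of them are the same element iff they agree almost
  everywhere with respect to \<open>phase\<close>.
\<close>

type_synonym density = "(real^3) \<times> (real^3) \<Rightarrow> real"

definition torus :: "(real^3) measure" where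
  "torus = restrict_space lborel (cbox (\<chi> i. 0) (\<chi> i. 1))"

definition vel :: "(real^3) measure" where
  "vel = restrict_space lborel (cbox (\<chi> i. - 1/2) (\<chi> i. 1/2))"

definition phase :: "((real^3) \<times> (real^3)) measure" where
  "phase = torus \<Otimes>\<^sub>M vel"

definition L2 :: "density set" where
  "L2 = {h. (\<forall>x v i. h (x + axis i 1, v) = h (x, v)) \<and>
            h \<in> borel_measurable phase \<and> integrable phase (\<lambda>z. (h z)\<^sup>2)}"

definition pd :: "3 \<Rightarrow> (real^3 \<Rightarrow> real) \<Rightarrow> real^3 \<Rightarrow> real" where
  "pd j \<phi> x = frechet_derivative \<phi> (at x) (axis j 1)"

text \<open>Real valued \<open>C\<^sup>\<infinity>\<close> functions on the position torus: all iterated partial derivatives are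
  (totally) differentiable everywhere.\<close>

definition torus_smooth :: "(real^3 \<Rightarrow> real) \<Rightarrow> bool" where
  "torus_smooth \<phi> \<longleftrightarrow> (\<forall>x i. \<phi> (x + axis i 1) = \<phi> x) \<and>
     (\<forall>js x. foldr pd js \<phi> differentiable (at x))"

text \<open>Weak derivative of an \<open>L\<^sup>2(\<Omega>)\<close>-valued function of \<open>x\<close>: the defining identity is one between
  elements of \<open>L\<^sup>2(\<Omega>)\<close>, hence holds for almost every \<open>v\<close>.\<close>

definition weak_deriv_x :: "3 \<Rightarrow> density \<Rightarrow> density \<Rightarrow> bool" where
  "weak_deriv_x j h g \<longleftrightarrow> (\<forall>\<phi>. torus_smooth \<phi> \<longrightarrow>
     (AE v in vel. (LINT x|torus. h (x, v) * pd j \<phi> x) = - (LINT x|torus. g (x, v) * \<phi> x)))"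

definition H1 :: "density set" where
  "H1 = {h \<in> L2. \<forall>j. \<exists>g\<in>L2. weak_deriv_x j h g}"

text \<open>Weak derivatives are unique only up to null sets; nothing below depends on the
  representative chosen here.\<close>

definition dx :: "3 \<Rightarrow> density \<Rightarrow> density" where
  "dx j h = (SOME g. g \<in> L2 \<and> weak_deriv_x j h g)"

definition X_norm :: "density \<Rightarrow> real" where
  "X_norm h = sqrt ((LINT z|phase. (h z)\<^sup>2) + (\<Sum>j\<in>UNIV. LINT z|phase. (dx j h z)\<^sup>2))"

text \<open>The frequency sets are symmetric, so for real valued functions the truncated Fourier series
  is real and \<open>Re\<close> only changes the type.\<close>

definition trunc1 :: "real \<Rightarrow> (real \<Rightarrow> real) \<Rightarrow> real \<Rightarrow> real" where
  "trunc1 R g y = Re (\<Sum>m\<in>{m::int. real_of_int \<bar>m\<bar> < R}.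
     (LINT w:{-1/2..1/2}|lborel. complex_of_real (g w) * cis (- 2 * pi * real_of_int m * w))
       * cis (2 * pi * real_of_int m * y))"

definition Lam_vj :: "real \<Rightarrow> real \<Rightarrow> 3 \<Rightarrow> density \<Rightarrow> density" where
  "Lam_vj \<epsilon> \<gamma> j h = (\<lambda>(x, v).
     trunc1 (\<epsilon> powr (- \<gamma>)) (\<lambda>w. h (x, \<chi> k. if k = j then w else v $ k)) (v $ j))"

definition Lam_v :: "real \<Rightarrow> real \<Rightarrow> density \<Rightarrow> density" where
  "Lam_v \<epsilon> \<gamma> h = Lam_vj \<epsilon> \<gamma> 3 (Lam_vj \<epsilon> \<gamma> 2 (Lam_vj \<epsilon> \<gamma> 1 h))"

definition freq :: "int^3 \<Rightarrow> real^3" where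
  "freq m = (\<chi> i. real_of_int (m $ i))"

definition Lam_x :: "real \<Rightarrow> real \<Rightarrow> density \<Rightarrow> density" where
  "Lam_x \<epsilon> \<gamma> h = (\<lambda>(x, v). Re (\<Sum>m\<in>{m. norm (freq m) < \<epsilon> powr (- \<gamma>)}.
     (LINT y|torus. complex_of_real (h (y, v)) * cis (- 2 * pi * (freq m \<bullet> y)))
       * cis (2 * pi * (freq m \<bullet> x))))"

definition Lam :: "real \<Rightarrow> real \<Rightarrow> density \<Rightarrow> density" where
  "Lam \<epsilon> \<gamma> h = Lam_x \<epsilon> \<gamma> (Lam_v \<epsilon> \<gamma> h)"

definition e0 :: "real^3 \<Rightarrow> real" where
  "e0 v = 1"

definition e1 :: "real \<Rightarrow> real \<Rightarrow> real \<Rightarrow> 3 \<Rightarrow> real^3 \<Rightarrow> real" where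
  "e1 \<epsilon> \<gamma> c1 i v = c1 * trunc1 (\<epsilon> powr (- \<gamma>)) (\<lambda>w. w) (v $ i)"

definition e2i :: "real \<Rightarrow> real \<Rightarrow> real \<Rightarrow> real \<Rightarrow> 3 \<Rightarrow> real^3 \<Rightarrow> real" where
  "e2i \<epsilon> \<gamma> c0 c2 i v = c2 * trunc1 (\<epsilon> powr (- \<gamma>)) (\<lambda>w. w\<^sup>2) (v $ i) - c0"

definition e2 :: "real \<Rightarrow> real \<Rightarrow> real \<Rightarrow> real \<Rightarrow> real^3 \<Rightarrow> real" where
  "e2 \<epsilon> \<gamma> c0 c2 v = (\<Sum>i\<in>UNIV. e2i \<epsilon> \<gamma> c0 c2 i v)"

definition orthonormal_v :: "(real^3 \<Rightarrow> real) list \<Rightarrow> bool" where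
  "orthonormal_v bs \<longleftrightarrow> (\<forall>i<length bs. \<forall>j<length bs.
     (LINT v|vel. (bs ! i) v * (bs ! j) v) = (if i = j then 1 else 0))"

definition normalizing_consts :: "real \<Rightarrow> real \<Rightarrow> real \<Rightarrow> real \<Rightarrow> real \<Rightarrow> bool" where
  "normalizing_consts \<epsilon> \<gamma> c0 c1 c2 \<longleftrightarrow>
     orthonormal_v [e0, e1 \<epsilon> \<gamma> c1 1, e1 \<epsilon> \<gamma> c1 2, e1 \<epsilon> \<gamma> c1 3, e2 \<epsilon> \<gamma> c0 c2]"

definition moment :: "density \<Rightarrow> (real^3 \<Rightarrow> real) \<Rightarrow> real^3 \<Rightarrow> real" where
  "moment h e x = (LINT v|vel. h (x, v) * e v)"

definition Proj :: "real \<Rightarrow> real \<Rightarrow> real \<Rightarrow> real \<Rightarrow> real \<Rightarrow> density \<Rightarrow> density" where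
  "Proj \<epsilon> \<gamma> c0 c1 c2 h = (\<lambda>(x, v).
     moment h e0 x * e0 v
     + (\<Sum>i\<in>UNIV. moment h (e1 \<epsilon> \<gamma> c1 i) x * e1 \<epsilon> \<gamma> c1 i v)
     + moment h (e2 \<epsilon> \<gamma> c0 c2) x * e2 \<epsilon> \<gamma> c0 c2 v)"

definition Lop :: "real \<Rightarrow> real \<Rightarrow> real \<Rightarrow> real \<Rightarrow> real \<Rightarrow> density \<Rightarrow> density" where
  "Lop \<epsilon> \<gamma> c0 c1 c2 h = (\<lambda>z. h z - Proj \<epsilon> \<gamma> c0 c1 c2 h z)"

definition energy :: "density \<Rightarrow> real" where
  "energy h = X_norm h"

definition dissipation :: "real \<Rightarrow> real \<Rightarrow> real \<Rightarrow> real \<Rightarrow> real \<Rightarrow> density \<Rightarrow> real" where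
  "dissipation \<epsilon> \<gamma> c0 c1 c2 h = X_norm (Lop \<epsilon> \<gamma> c0 c1 c2 h)"

text \<open>\<open>L\<^sup>\<infinity>([0,\<infinity>); H\<^sup>1(T\<^sup>3; L\<^sup>2(\<Omega>)))\<close>: Bochner measurable (almost everywhere a limit, in norm, of simple
  functions) and essentially bounded.\<close>

definition Linf_H1 :: "(real \<Rightarrow> density) \<Rightarrow> bool" where
  "Linf_H1 f \<longleftrightarrow>
     (\<exists>s. (\<forall>n::nat. simple_function (restrict_space lborel {0..}) (s n) \<and> (\<forall>t\<ge>0. s n t \<in> H1)) \<and>
          (AE t in restrict_space lborel {0..}.
             (\<lambda>n. X_norm (\<lambda>z. f t z - s n t z)) \<longlonglongrightarrow> 0)) \<and>
     (\<exists>C. AE t in restrict_space lborel {0..}. f t \<in> H1 \<and> X_norm (f t) \<le> C)"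

text \<open>Derivative at time \<open>t \<ge> 0\<close> (one-sided at \<open>t = 0\<close>) with respect to the norm of
  \<open>H\<^sup>1(T\<^sup>3; L\<^sup>2(\<Omega>))\<close>.\<close>

definition has_time_deriv :: "(real \<Rightarrow> density) \<Rightarrow> density \<Rightarrow> real \<Rightarrow> bool" where
  "has_time_deriv F G t \<longleftrightarrow> (\<forall>s\<ge>0. F s \<in> H1) \<and> G \<in> H1 \<and>
     ((\<lambda>s. X_norm (\<lambda>z. (F s z - F t z) / (s - t) - G z)) \<longlongrightarrow> 0) (at t within {0..})"

definition transport :: "density \<Rightarrow> density" where
  "transport h = (\<lambda>(x, v). \<Sum>j\<in>UNIV. v $ j * dx j h (x, v))"

definition solves_equation ::
    "real \<Rightarrow> real \<Rightarrow> real \<Rightarrow> real \<Rightarrow> real \<Rightarrow> real \<Rightarrow> real \<Rightarrow> (real \<Rightarrow> density) \<Rightarrow> bool" where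
  "solves_equation \<epsilon> \<gamma> c0 c1 c2 \<nu> \<kappa> f \<longleftrightarrow> (\<forall>t\<ge>0. \<exists>G. has_time_deriv (\<lambda>s. Lam \<epsilon> \<gamma> (f s)) G t \<and>
     (AE z in phase.
        \<epsilon>\<^sup>2 * G z + \<epsilon> * Lam \<epsilon> \<gamma> (transport (Lam \<epsilon> \<gamma> (f t))) z =
          - (1 / \<nu>) * Lam \<epsilon> \<gamma> (Lop \<epsilon> \<gamma> c0 c1 c2 (Lam \<epsilon> \<gamma> (f t))) z
          + (\<epsilon> * \<kappa> / \<nu>) * Lam \<epsilon> \<gamma> (Lop \<epsilon> \<gamma> c0 c1 c2 (\<lambda>y. (Lam \<epsilon> \<gamma> (f t) y)\<^sup>2)) z
          - (\<epsilon>\<^sup>2 * \<kappa>\<^sup>2 / \<nu>) * Lam \<epsilon> \<gamma> (\<lambda>y. (Lam \<epsilon> \<gamma> (f t) y) ^ 3) z))"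

definition global_solution ::
    "real \<Rightarrow> real \<Rightarrow> real \<Rightarrow> real \<Rightarrow> real \<Rightarrow> real \<Rightarrow> real \<Rightarrow> density \<Rightarrow> (real \<Rightarrow> density) \<Rightarrow> bool" where
  "global_solution \<epsilon> \<gamma> c0 c1 c2 \<nu> \<kappa> f0 f \<longleftrightarrow>
     Linf_H1 f \<and> (\<forall>t\<ge>0. f t \<in> H1) \<and>
     (\<forall>t\<ge>0. AE z in phase. f t z = Lam \<epsilon> \<gamma> (f t) z) \<and>
     solves_equation \<epsilon> \<gamma> c0 c1 c2 \<nu> \<kappa> f \<and>
     (AE z in phase. f 0 z = Lam \<epsilon> \<gamma> f0 z)"

end

theory Submission
  imports Defs
begin

text \<open>
  The truncated equation is an ordinary differential equation on the finite-dimensional space of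
  trigonometric polynomials with the retained frequencies. Testing it with \<open>f\<close>, transport drops out
  because it is skew-symmetric, and since \<open>L\<close> is an orthogonal projection Young's inequality gives
  \<open>- |L f|\<^sup>2 + \<epsilon>\<kappa> \<langle>f\<^sup>2, L f\<rangle> - \<epsilon>\<^sup>2\<kappa>\<^sup>2 |f\<^sup>2|\<^sup>2 \<le> - |L f|\<^sup>2 / 2\<close>.
  For \<open>q = \<partial>\<^sub>j f\<close> the corresponding terms are
  \<open>- |L q|\<^sup>2 + 2\<epsilon>\<kappa> \<langle>f q, L q\<rangle> - 3\<epsilon>\<^sup>2\<kappa>\<^sup>2 |f q|\<^sup>2 \<le> - |L q|\<^sup>2 / 2\<close>.
  This is the energy estimate. The first inequality says that the vector field points into every
  \<open>L\<^sup>2\<close> ball, so composing it with the radial retraction onto the ball given by the initial datum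
  yields a globally Lipschitz field with the same solution. The \<open>X\<close> norm of a trigonometric polynomial
  can be computed from classical derivatives because weak derivatives are unique up to null sets.
\<close>

section \<open>Dissipative ordinary differential equations in Banach spaces\<close>

text \<open>Three norms meet here: the sup norm, in which Picard iteration runs; the
  \<open>L2\<close> norm, in which the field is dissipative; and \<open>X_norm\<close>, in which
  time derivatives and bounds are stated. On the range of the truncation they bound each other in a
  circle: \<open>L2\<close> by \<open>X_norm\<close>, \<open>X_norm\<close> by \<open>Xc\<close>
  times the sup norm, the sup norm by \<open>Sc\<close> times the \<open>L2\<close> norm. This
  carries time derivatives from one norm to another, for existence as well as for uniqueness, where
  a competitor is controlled only in \<open>X_norm\<close>. The second obstacle is null sets.
  \<open>Lam\<close> is a nest of one-variable Fourier sums over slices that may fail to be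
  integrable, and \<open>dx\<close> is a choice among functions that agree almost everywhere. Once
  \<open>Lam\<close> is a single integral against a kernel on \<open>phase\<close>, it sends almost
  everywhere equal inputs to the same function, and the argument can work with functions. Velocity
  enters only as a multiplier: every integration by parts is in \<open>x\<close>, so the jump of
  \<open>v\<close> across the faces of the velocity cell produces no boundary term.\<close>

lemma has_integral_exp_weight:
  fixes C t :: real
  assumes "0 \<le> t" "C > 0"
  shows "((\<lambda>s. exp (C * s)) has_integral (exp (C * t) - 1) / C) {0..t}"
proof -
  have "((\<lambda>s. exp (C * s)) has_integral (exp (C * t) / C - exp (C * 0) / C)) {0..t}"
    using assms
    by (intro fundamental_theorem_of_calculus)
       (auto intro!: derivative_eq_intros simp: has_real_derivative_iff_has_vector_derivative[symmetric])
  then show ?thesis by (simp add: diff_divide_distrib)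
qed

text \<open>Banach's fixed point theorem in the sup norm weighted by \<open>exp (- 2 L t)\<close>, which makes the
  Picard map a contraction on all of \<open>[0, \<infinity>)\<close> at once.\<close>

lemma picard_lindeloef_global:
  fixes F :: "'a::banach \<Rightarrow> 'a"
  assumes lip: "\<And>x y. norm (F x - F y) \<le> L * norm (x - y)"
  obtains u where "u 0 = x0" "\<And>t. t \<ge> 0 \<Longrightarrow> (u has_vector_derivative F (u t)) (at t within {0..})"
proof -
  define K where "K = \<bar>L\<bar> + 1"
  have K: "K > 0" and lipK: "norm (F x - F y) \<le> K * norm (x - y)" for x y
    using order_trans[OF lip[of x y] mult_right_mono[of L K "norm (x - y)"]] by (auto simp: K_def)
  \<comment> \<open>Integrating \<open>exp (C * s)\<close> gains a factor \<open>1 / C\<close>, so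
    the contraction constant is \<open>K / C = 1/2\<close>.\<close>
  define C where "C = 2 * K"
  have C: "C > 0" using K by (simp add: C_def)
  have cF: "continuous_on UNIV F"
    using lipK K by (intro lipschitz_on_continuous_on[of K] lipschitz_onI) (auto simp: dist_norm)
  \<comment> \<open>The unknown \<open>w\<close> is the weighted solution
    \<open>exp (- C * t) *\<^sub>R u t\<close>; the weight is undone before \<open>F\<close> is
    applied.\<close>
  define I where "I w s = F (exp (C * s) *\<^sub>R apply_bcontfun w s)" for w :: "real \<Rightarrow>\<^sub>C 'a" and s
  have cI: "continuous_on S (I w)" for S w
    unfolding I_def
    by (rule continuous_on_compose2[OF cF]) (auto intro!: continuous_intros)
  \<comment> \<open>Bounded continuous functions live on the whole line, so negative times are
    frozen at time 0.\<close>
  define J where "J w t = exp (- C * max 0 t) *\<^sub>R (x0 + integral {0..max 0 t} (I w))" for w t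
  have bI: "norm (I w s) \<le> (norm (F 0) + K * norm w) * exp (C * s)" if "s \<ge> 0" for w s
  proof -
    have "norm (I w s) \<le> norm (F 0) + norm (I w s - F 0)"
      by (metis add.commute diff_add_cancel norm_triangle_ineq)
    also have "norm (I w s - F 0) \<le> K * (exp (C * s) * norm (apply_bcontfun w s))"
      using lipK[of "exp (C * s) *\<^sub>R apply_bcontfun w s" 0] by (simp add: I_def)
    also have "\<dots> \<le> K * (exp (C * s) * norm w)"
      using K by (intro mult_left_mono norm_bounded) auto
    also have "norm (F 0) \<le> norm (F 0) * exp (C * s)"
      using that C by (simp add: mult_le_cancel_left1)
    finally show ?thesis by (simp add: algebra_simps)
  qed
  have int_bound: "norm (integral {0..t} f) \<le> B * exp (C * t) / C"
    if "t \<ge> 0" "B \<ge> 0" "continuous_on {0..t} f" "\<And>s. s \<ge> 0 \<Longrightarrow> norm (f s) \<le> B * exp (C * s)" for f :: "real \<Rightarrow> 'a" and t B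
  proof -
    have *: "((\<lambda>s. B * exp (C * s)) has_integral B * ((exp (C * t) - 1) / C)) {0..t}"
      using has_integral_exp_weight[OF that(1) C] by (rule has_integral_mult_right)
    have "norm (integral {0..t} f) \<le> integral {0..t} (\<lambda>s. B * exp (C * s))"
      using that by (intro integral_norm_bound_integral integrable_continuous_real) (auto intro!: continuous_intros)
    also have "\<dots> = B * ((exp (C * t) - 1) / C)" using * by (rule integral_unique)
    also have "\<dots> \<le> B * (exp (C * t) / C)"
      using that C by (intro mult_left_mono divide_right_mono) auto
    finally show ?thesis by simp
  qed
  have cJ: "J w \<in> bcontfun" for w
  proof (rule bcontfun_normI)
    have c: "continuous_on {0..b} (\<lambda>t. integral {0..t} (I w))" for b
      by (intro indefinite_integral_continuous_1 integrable_continuous_real cI)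
    have "continuous_on UNIV (\<lambda>t. integral {0..max 0 t} (I w))"
      unfolding continuous_on_eq_continuous_at[OF open_UNIV]
    proof
      fix t :: real
      have "continuous_on {..<\<bar>t\<bar>+1} (\<lambda>t. integral {0..max 0 t} (I w))"
        by (rule continuous_on_compose2[OF c[of "\<bar>t\<bar>+1"], of _ "\<lambda>t. max 0 t"]) (auto intro!: continuous_intros)
      then show "isCont (\<lambda>t. integral {0..max 0 t} (I w)) t"
        by (subst (asm) continuous_on_eq_continuous_at) auto
    qed
    then show "continuous_on UNIV (J w)" unfolding J_def by (intro continuous_intros)
    fix t :: real
    define s where "s = max 0 t"
    have s: "s \<ge> 0" by (simp add: s_def)
    have "norm (J w t) \<le> exp (- C * s) * (norm x0 + norm (integral {0..s} (I w)))"
      unfolding J_def s_def[symmetric] by (simp add: norm_triangle_ineq)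
    also have "\<dots> \<le> exp (- C * s) * (norm x0 + (norm (F 0) + K * norm w) * exp (C * s) / C)"
      using bI K by (intro mult_left_mono add_left_mono int_bound s cI) auto
    also have "\<dots> = exp (- C * s) * norm x0 + (norm (F 0) + K * norm w) / C"
      by (simp add: algebra_simps exp_minus)
    also have "\<dots> \<le> norm x0 + (norm (F 0) + K * norm w) / C"
      using s C by (simp add: mult_left_le_one_le)
    finally show "norm (J w t) \<le> norm x0 + (norm (F 0) + K * norm w) / C" .
  qed
  have contr: "dist (Bcontfun (J w)) (Bcontfun (J w')) \<le> 1/2 * dist w w'" for w w'
  proof (rule dist_bound)
    fix t :: real
    define s where "s = max 0 t"
    have s: "s \<ge> 0" by (simp add: s_def)
    have b: "norm (I w r - I w' r) \<le> (K * dist w w') * exp (C * r)" for r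
    proof -
      have "norm (I w r - I w' r) \<le> K * norm (exp (C * r) *\<^sub>R (apply_bcontfun w r - apply_bcontfun w' r))"
        unfolding I_def using lipK by (metis scaleR_diff_right)
      also have "\<dots> \<le> K * (exp (C * r) * dist w w')"
        using dist_bounded[of w r w'] K by (auto simp: dist_norm intro!: mult_left_mono)
      finally show ?thesis by (simp add: mult_ac)
    qed
    have "integral {0..s} (I w) - integral {0..s} (I w') = integral {0..s} (\<lambda>r. I w r - I w' r)"
      by (intro Henstock_Kurzweil_Integration.integral_diff[symmetric] integrable_continuous_real cI)
    also have "norm \<dots> \<le> (K * dist w w') * exp (C * s) / C"
      using K b by (intro int_bound s continuous_intros cI) auto
    finally have *: "norm (integral {0..s} (I w) - integral {0..s} (I w')) \<le> (K * dist w w') * exp (C * s) / C" .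
    have "dist (J w t) (J w' t) = exp (- C * s) * norm (integral {0..s} (I w) - integral {0..s} (I w'))"
      unfolding J_def s_def[symmetric] by (simp add: dist_norm scaleR_diff_right[symmetric])
    also have "\<dots> \<le> exp (- C * s) * ((K * dist w w') * exp (C * s) / C)"
      using * by (intro mult_left_mono) auto
    also have "\<dots> = 1/2 * dist w w'" using K by (simp add: C_def exp_minus field_simps)
    finally show "dist (apply_bcontfun (Bcontfun (J w)) t) (apply_bcontfun (Bcontfun (J w')) t) \<le> 1/2 * dist w w'"
      by (simp add: Bcontfun_inverse cJ)
  qed
  obtain w where w: "Bcontfun (J w) = w"
    using banach_fix_type[of "1/2" "\<lambda>w. Bcontfun (J w)"] contr by auto
  define u where "u t = exp (C * t) *\<^sub>R apply_bcontfun w t" for t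
  have u: "u t = x0 + integral {0..t} (\<lambda>s. F (u s))" if "t \<ge> 0" for t
  proof -
    have "apply_bcontfun w t = J w t" using w cJ by (metis Bcontfun_inverse)
    then show ?thesis using that by (simp add: u_def J_def I_def[abs_def] exp_minus)
  qed
  show ?thesis
  proof
    show "u 0 = x0" using u[of 0] by simp
    fix t :: real assume t: "t \<ge> 0"
    have c: "continuous_on {0..t+1} (\<lambda>s. F (u s))"
      using cI[of _ w] unfolding I_def u_def .
    have "((\<lambda>t. x0 + integral {0..t} (\<lambda>s. F (u s))) has_vector_derivative F (u t)) (at t within {0..t+1})"
      using integral_has_vector_derivative[OF c, of t] t by (auto intro!: derivative_eq_intros)
    then have "(u has_vector_derivative F (u t)) (at t within {0..t+1})"
      by (rule has_vector_derivative_transform[rotated 2]) (use t u in auto)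
    \<comment> \<open>The integral is differentiated on a compact interval that reaches past
      \<open>t\<close>; near \<open>t\<close> it is the same as the half line.\<close>
    moreover have "at t within {0..t+1} = at t within {0..}"
      by (rule at_within_nhd[of _ "{t-1<..<t+1}"]) (use t in auto)
    ultimately show "(u has_vector_derivative F (u t)) (at t within {0..})" by simp
  qed
qed

text \<open>Common source of the Cauchy-Schwarz inequalities for \<open>B\<close> and
  \<open>ip\<close>. Both forms are only positive semidefinite, so \<open>c = 0\<close> is a genuine
  case.\<close>

lemma quadratic_nonneg_discriminant:
  fixes a b c :: real
  assumes q: "\<And>t. 0 \<le> a + 2 * t * b + t\<^sup>2 * c"
  shows "b\<^sup>2 \<le> a * c"
proof (cases "c = 0")
  case True
  have "b = 0"
  proof (rule ccontr)
    assume n: "b \<noteq> 0"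
    show False using q[of "- (a + 1) / (2 * b)"] n True by (simp add: field_simps)
  qed
  then show ?thesis using True by simp
next
  case False
  have "0 \<le> c"
  proof (rule ccontr)
    assume "\<not> 0 \<le> c"
    then have c: "c < 0" by simp
    have a: "0 \<le> a" using q[of 0] by simp
    \<comment> \<open>Adding the values at \<open>t\<close> and \<open>- t\<close> cancels the
      linear term; this \<open>t\<close> makes the sum equal to \<open>- 2\<close>.\<close>
    define t where "t = sqrt ((a + 1) / - c)"
    have t2: "t\<^sup>2 * c = - (a + 1)" using c a by (simp add: t_def field_simps)
    have "0 \<le> (a + 2 * t * b + t\<^sup>2 * c) + (a + 2 * (- t) * b + (- t)\<^sup>2 * c)"
      using q[of t] q[of "- t"] by (rule add_nonneg_nonneg)
    then show False using t2 by simp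
  qed
  then have p: "c > 0" using False by simp
  show ?thesis using q[of "- b / c"] p by (simp add: field_simps power2_eq_square)
qed

lemma nonincreasing_on_halfline:
  fixes g :: "real \<Rightarrow> real"
  assumes d: "\<And>t. t \<ge> 0 \<Longrightarrow> (g has_real_derivative g' t) (at t within {0..})"
    and le: "\<And>t. t \<ge> 0 \<Longrightarrow> g' t \<le> 0" and st: "0 \<le> s" "s \<le> t"
  shows "g t \<le> g s"
proof -
  have "\<exists>x\<in>{s..t}. g t - g s = (\<lambda>h. g' x * h) (t - s)"
  proof (rule mvt_very_simple[OF st(2)])
    fix x assume "s \<le> x" "x \<le> t"
    then show "(g has_derivative (*) (g' x)) (at x within {s..t})"
      using d[of x] st has_derivative_subset[of g "(*) (g' x)" x "{0..}" "{s..t}"] by (auto simp: has_field_derivative_def)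
  qed
  then obtain x where "x \<in> {s..t}" "g t - g s = g' x * (t - s)" by auto
  moreover have "g' x * (t - s) \<le> 0"
    using le[of x] \<open>x \<in> {s..t}\<close> st by (intro mult_nonpos_nonneg) auto
  ultimately show ?thesis by simp
qed

text \<open>\<open>B\<close> is a weaker inner product; on the subspace \<open>range \<Lambda>\<close> it controls the norm.\<close>

locale dissipative_ode =
  fixes B :: "'a::banach \<Rightarrow> 'a \<Rightarrow> real" and \<Lambda> F :: "'a \<Rightarrow> 'a" and C :: real and L :: "real \<Rightarrow> real"
  assumes bil: "bounded_bilinear B" and sym: "B x y = B y x" and pos: "0 \<le> B x x"
    and Bnorm: "\<bar>B x y\<bar> \<le> norm x * norm y"
    and lin: "bounded_linear \<Lambda>" and idem: "\<Lambda> (\<Lambda> x) = \<Lambda> x"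
    and contr: "B (\<Lambda> x) (\<Lambda> x) \<le> B x x"
    and C: "C \<ge> 0" and ctrl: "norm (\<Lambda> x) \<le> C * sqrt (B (\<Lambda> x) (\<Lambda> x))"
    and range: "\<Lambda> (F x) = F x"
    and diss: "\<Lambda> x = x \<Longrightarrow> B x (F x) \<le> 0"
    and lip: "\<Lambda> x = x \<Longrightarrow> \<Lambda> y = y \<Longrightarrow> norm x \<le> r \<Longrightarrow> norm y \<le> r \<Longrightarrow> norm (F x - F y) \<le> L r * norm (x - y)"
begin

interpretation B: bounded_bilinear B by (rule bil)
interpretation \<Lambda>: bounded_linear \<Lambda> by (rule lin)

definition Bn :: "'a \<Rightarrow> real" where "Bn x = sqrt (B x x)"

lemma Bn_nonneg: "0 \<le> Bn x" using pos by (simp add: Bn_def)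
lemma Bn_sq: "(Bn x)\<^sup>2 = B x x" using pos by (simp add: Bn_def)

lemma cauchy_schwarz: "\<bar>B x y\<bar> \<le> Bn x * Bn y"
proof -
  have q: "0 \<le> B x x + 2 * t * B x y + t\<^sup>2 * B y y" for t
    using pos[of "x + t *\<^sub>R y"]
    by (simp add: B.add_left B.add_right B.scaleR_left B.scaleR_right sym[of y x] power2_eq_square algebra_simps)
  then have "(B x y)\<^sup>2 \<le> B x x * B y y" by (rule quadratic_nonneg_discriminant)
  then have "sqrt ((B x y)\<^sup>2) \<le> sqrt (B x x * B y y)" by (rule real_sqrt_le_mono)
  then show ?thesis by (simp add: Bn_def real_sqrt_mult)
qed

lemma Bn_triangle: "Bn (x + y) \<le> Bn x + Bn y"
proof (rule power2_le_imp_le)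
  have "(Bn (x + y))\<^sup>2 = B x x + 2 * B x y + B y y"
    by (simp add: Bn_sq B.add_left B.add_right sym[of y x])
  also have "\<dots> \<le> (Bn x)\<^sup>2 + 2 * (Bn x * Bn y) + (Bn y)\<^sup>2"
    using cauchy_schwarz[of x y] by (simp add: Bn_sq abs_le_iff)
  finally show "(Bn (x + y))\<^sup>2 \<le> (Bn x + Bn y)\<^sup>2" by (simp add: power2_sum)
qed (use Bn_nonneg in \<open>auto intro: add_nonneg_nonneg\<close>)

lemma Bn_scale: "Bn (c *\<^sub>R x) = \<bar>c\<bar> * Bn x"
proof -
  have "B (c *\<^sub>R x) (c *\<^sub>R x) = c\<^sup>2 * B x x" by (simp add: B.scaleR_left B.scaleR_right power2_eq_square)
  then show ?thesis by (simp add: Bn_def real_sqrt_mult)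
qed

lemma Bn_triangle_diff: "Bn x \<le> Bn y + Bn (x - y)"
  using Bn_triangle[of y "x - y"] by simp

definition cut :: "real \<Rightarrow> real \<Rightarrow> real" where "cut R s = (if s \<le> R then 1 else R / s)"

definition retract :: "real \<Rightarrow> 'a \<Rightarrow> 'a" where "retract R x = cut R (Bn x) *\<^sub>R x"

text \<open>If \<open>y\<close> is the shorter vector, the difference splits into a rescaled copy of
  \<open>x - y\<close> and a change of scale acting on \<open>y\<close>. Each part is at most
  \<open>Bn (x - y)\<close>, whence the 2.\<close>

lemma retract_lip:
  assumes R: "R > 0" shows "Bn (retract R x - retract R y) \<le> 2 * Bn (x - y)"
proof -
  have cut: "0 < cut R s" "cut R s \<le> 1" "cut R s * s = min s R" if "s \<ge> 0" for s
    using that R by (auto simp: cut_def)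
  have cut_mono: "cut R s \<ge> cut R t" if "0 \<le> s" "s \<le> t" for s t
    using that R by (auto simp: cut_def field_simps)
  have wlog: "Bn (retract R x - retract R y) \<le> 2 * Bn (x - y)" if yx: "Bn y \<le> Bn x" for x y
  proof -
    have eq: "retract R x - retract R y = cut R (Bn x) *\<^sub>R (x - y) + (cut R (Bn x) - cut R (Bn y)) *\<^sub>R y"
      by (simp add: retract_def algebra_simps)
    have "Bn (retract R x - retract R y) \<le> cut R (Bn x) * Bn (x - y) + (cut R (Bn y) - cut R (Bn x)) * Bn y"
      using Bn_triangle[of "cut R (Bn x) *\<^sub>R (x - y)" "(cut R (Bn x) - cut R (Bn y)) *\<^sub>R y"] cut[OF Bn_nonneg, of x]
        cut_mono[OF Bn_nonneg yx]
      by (simp add: eq Bn_scale)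
    also have "cut R (Bn x) * Bn (x - y) \<le> 1 * Bn (x - y)"
      using cut[OF Bn_nonneg, of x] by (intro mult_right_mono Bn_nonneg)
    \<comment> \<open>Rearranged, this says that \<open>cut R s * s\<close> is monotone in
      \<open>s\<close>: it equals \<open>min s R\<close>.\<close>
    also have "(cut R (Bn y) - cut R (Bn x)) * Bn y \<le> cut R (Bn x) * (Bn x - Bn y)"
      using cut(3)[OF Bn_nonneg, of x] cut(3)[OF Bn_nonneg, of y] yx by (auto simp: algebra_simps)
    also have "cut R (Bn x) * (Bn x - Bn y) \<le> 1 * (Bn x - Bn y)"
      using cut[OF Bn_nonneg, of x] yx by (intro mult_right_mono) auto
    also have "Bn x - Bn y \<le> Bn (x - y)" using Bn_triangle_diff[of x y] by simp
    finally show ?thesis by simp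
  qed
  have symn: "Bn (a - b) = Bn (b - a)" for a b using Bn_scale[of "-1" "a - b"] by simp
  show ?thesis using wlog[of y x] wlog[of x y] symn by (metis linear)
qed

lemma Bn_retract: "R > 0 \<Longrightarrow> Bn (retract R x) \<le> R"
  using Bn_nonneg[of x] by (auto simp: retract_def Bn_scale cut_def)

lemma norm_Bn: "\<Lambda> x = x \<Longrightarrow> norm x \<le> C * Bn x"
  using ctrl[of x] by (simp add: Bn_def)

lemma Bn_norm: "Bn x \<le> norm x"
  using Bnorm[of x x] by (auto simp: Bn_def power2_eq_square[symmetric] intro: real_le_lsqrt)

lemma has_derivative_B:
  assumes "(u has_vector_derivative u') (at t within S)"
  shows "((\<lambda>t. B (u t) (u t)) has_real_derivative 2 * B (u t) u') (at t within S)"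
proof -
  have "((\<lambda>t. B (u t) (u t)) has_vector_derivative B (u t) u' + B u' (u t)) (at t within S)"
    by (rule B.has_vector_derivative[OF assms assms])
  then show ?thesis by (simp add: sym[of u' "u t"] has_real_derivative_iff_has_vector_derivative)
qed

text \<open>The defect \<open>u t - \<Lambda> (u t)\<close> has derivative zero because the field
  takes values in the range. The argument \<open>w\<close> of the field is kept free: in the
  modified problem it is the retraction of the solution, not the solution.\<close>

lemma range_solution:
  assumes d: "\<And>t. t \<ge> 0 \<Longrightarrow> (u has_vector_derivative F (w t)) (at t within {0..})"
    and u0: "\<Lambda> (u 0) = u 0" and t: "t \<ge> 0"
  shows "\<Lambda> (u t) = u t"
proof -
  have "((\<lambda>t. u t - \<Lambda> (u t)) has_derivative (\<lambda>h. 0)) (at t within {0..})" if "t \<in> {0..}" for t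
  proof -
    have "((\<lambda>t. u t - \<Lambda> (u t)) has_vector_derivative F (w t) - \<Lambda> (F (w t))) (at t within {0..})"
      using d[of t] that by (intro has_vector_derivative_diff \<Lambda>.has_vector_derivative) auto
    then show ?thesis by (simp add: range has_vector_derivative_def)
  qed
  then have "u t - \<Lambda> (u t) = u 0 - \<Lambda> (u 0)"
    using has_derivative_zero_unique[of "{0::real..}" "\<lambda>t. u t - \<Lambda> (u t)" "0" t] t by (metis atLeast_iff convex_real_interval(1) order_refl has_derivative_zero_constant)
  then show ?thesis using u0 by simp
qed

lemma solution_bound:
  assumes d: "\<And>t. t \<ge> 0 \<Longrightarrow> (u has_vector_derivative F (u t)) (at t within {0..})"
    and u0: "\<Lambda> (u 0) = u 0" and t: "t \<ge> 0"
  shows "B (u t) (u t) \<le> B (u 0) (u 0)"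
proof (rule nonincreasing_on_halfline[where g="\<lambda>t. B (u t) (u t)" and g'="\<lambda>t. 2 * B (u t) (F (u t))"])
  fix t :: real assume "t \<ge> 0"
  then show "((\<lambda>t. B (u t) (u t)) has_real_derivative 2 * B (u t) (F (u t))) (at t within {0..})"
    by (intro has_derivative_B d)
  show "2 * B (u t) (F (u t)) \<le> 0" using diss range_solution[OF d u0 \<open>t \<ge> 0\<close>] by simp
qed (use t in auto)

lemma existence:
  assumes x0: "\<Lambda> x0 = x0"
  obtains u where "u 0 = x0" "\<And>t. t \<ge> 0 \<Longrightarrow> (u has_vector_derivative F (u t)) (at t within {0..})"
    "\<And>t. t \<ge> 0 \<Longrightarrow> \<Lambda> (u t) = u t"
proof -
  \<comment> \<open>The summand 1 keeps the radius positive for the zero datum.\<close>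
  define R where "R = Bn x0 + 1"
  have R: "R > 0" using Bn_nonneg[of x0] by (simp add: R_def)
  \<comment> \<open>\<open>\<Lambda>\<close> comes first because \<open>diss\<close>,
    \<open>lip\<close> and the control of the norm by \<open>B\<close> hold only on its range, while
    the fixed point theorem wants a field on the whole space.\<close>
  define G where "G x = F (retract R (\<Lambda> x))" for x
  have inv: "\<Lambda> (retract R (\<Lambda> x)) = retract R (\<Lambda> x)" for x
    by (simp add: retract_def \<Lambda>.scaleR idem)
  have nr: "norm (retract R (\<Lambda> x)) \<le> C * R" for x
    using norm_Bn[OF inv] Bn_retract[OF R] C by (meson mult_left_mono order_trans)
  have Glip: "norm (G x - G y) \<le> (\<bar>L (C * R)\<bar> * C * 2) * norm (x - y)" for x y
  proof -
    let ?d = "retract R (\<Lambda> x) - retract R (\<Lambda> y)"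
    have "norm (G x - G y) \<le> L (C * R) * norm ?d"
      unfolding G_def by (rule lip[OF inv inv nr nr])
    also have "\<dots> \<le> \<bar>L (C * R)\<bar> * norm ?d" by (intro mult_right_mono) auto
    also have "norm ?d \<le> C * Bn ?d" by (rule norm_Bn) (simp add: \<Lambda>.diff inv)
    also have "Bn ?d \<le> 2 * Bn (\<Lambda> (x - y))" using retract_lip[OF R] by (simp add: \<Lambda>.diff)
    also have "Bn (\<Lambda> (x - y)) \<le> Bn (x - y)" using contr by (simp add: Bn_def)
    also have "Bn (x - y) \<le> norm (x - y)" by (rule Bn_norm)
    finally have "norm (G x - G y) \<le> \<bar>L (C * R)\<bar> * (C * (2 * norm (x - y)))"
      using C by (simp add: mult_left_mono)
    then show ?thesis by (simp add: mult_ac)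
  qed
  obtain u where u: "u 0 = x0" "\<And>t. t \<ge> 0 \<Longrightarrow> (u has_vector_derivative G (u t)) (at t within {0..})"
    using picard_lindeloef_global[OF Glip, where ?x0.0=x0] by blast
  have \<Lambda>u: "\<Lambda> (u t) = u t" if "t \<ge> 0" for t
    using range_solution[of u "\<lambda>t. retract R (\<Lambda> (u t))"] u x0 that by (simp add: G_def)
  have Bu: "B (u t) (u t) \<le> B x0 x0" if t: "t \<ge> 0" for t
    unfolding u(1)[symmetric]
  proof (rule nonincreasing_on_halfline[where g="\<lambda>t. B (u t) (u t)" and g'="\<lambda>t. 2 * B (u t) (G (u t))"])
    fix t :: real assume t: "t \<ge> 0"
    then show "((\<lambda>t. B (u t) (u t)) has_real_derivative 2 * B (u t) (G (u t))) (at t within {0..})"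
      by (intro has_derivative_B u)
    \<comment> \<open>The retracted point is a positive multiple of \<open>u t\<close>, so pairing
      the field with \<open>u t\<close> or with its retraction gives the same sign.\<close>
    let ?c = "cut R (Bn (u t))"
    have c: "?c > 0" using R Bn_nonneg[of "u t"] by (auto simp: cut_def)
    have "B (retract R (u t)) (F (retract R (u t))) \<le> 0"
      using diss inv[of "u t"] \<Lambda>u[OF t] by simp
    then have "?c * B (u t) (F (retract R (u t))) \<le> 0" by (simp add: retract_def[of R "u t"] B.scaleR_left)
    then have "B (u t) (F (retract R (u t))) \<le> 0" using c by (simp add: mult_le_0_iff)
    then show "2 * B (u t) (G (u t)) \<le> 0" by (simp add: G_def \<Lambda>u[OF t])
  qed (use t in auto)
  have "G (u t) = F (u t)" if t: "t \<ge> 0" for t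
  proof -
    have "Bn (u t) \<le> R" using Bu[OF t] by (simp add: Bn_def R_def add_increasing2)
    then show ?thesis by (simp add: G_def \<Lambda>u[OF t] retract_def cut_def)
  qed
  then show ?thesis using that u \<Lambda>u by metis
qed

text \<open>Both solutions stay in one ball, where a single Lipschitz constant serves. A Gronwall
  weight forces the \<open>B\<close>-length of the difference to vanish, and on the range
  \<open>B\<close> controls the norm.\<close>

lemma uniqueness:
  assumes u: "\<And>t. t \<ge> 0 \<Longrightarrow> (u has_vector_derivative F (u t)) (at t within {0..})" "\<Lambda> (u 0) = u 0"
    and w: "\<And>t. t \<ge> 0 \<Longrightarrow> (w has_vector_derivative F (w t)) (at t within {0..})"
    and eq: "w 0 = u 0" and t: "t \<ge> 0"
  shows "w t = u t"
proof -
  define R where "R = C * Bn (u 0)"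
  have w0: "\<Lambda> (w 0) = w 0" using u(2) eq by simp
  have nu: "norm (u t) \<le> R" if "t \<ge> 0" for t
  proof -
    have "Bn (u t) \<le> Bn (u 0)" using solution_bound[OF u that] by (simp add: Bn_def)
    then show ?thesis using norm_Bn[OF range_solution[OF u that]] mult_left_mono[OF _ C] unfolding R_def by (meson order_trans)
  qed
  have nw: "norm (w t) \<le> R" if "t \<ge> 0" for t
  proof -
    have "Bn (w t) \<le> Bn (u 0)" using solution_bound[OF w w0 that] eq by (simp add: Bn_def)
    then show ?thesis using norm_Bn[OF range_solution[OF w w0 that]] mult_left_mono[OF _ C] unfolding R_def by (meson order_trans)
  qed
  define d where "d t = w t - u t" for t
  \<comment> \<open>The 2 comes from differentiating a square, \<open>\<bar>L R\<bar>\<close> from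
    the field, and \<open>C\<^sup>2\<close> from replacing the squared norm by
    \<open>B\<close>.\<close>
  define M where "M = 2 * \<bar>L R\<bar> * C\<^sup>2"
  have \<Lambda>d: "\<Lambda> (d t) = d t" if "t \<ge> 0" for t
    using range_solution[OF u that] range_solution[OF w w0 that] by (simp add: d_def \<Lambda>.diff)
  have "exp (- M * t) * B (d t) (d t) \<le> exp (- M * 0) * B (d 0) (d 0)"
  proof (rule nonincreasing_on_halfline[where g="\<lambda>t. exp (- M * t) * B (d t) (d t)" and
        g'="\<lambda>t. exp (- M * t) * (2 * B (d t) (F (w t) - F (u t)) - M * B (d t) (d t))"])
    fix t :: real assume t: "t \<ge> 0"
    have "(d has_vector_derivative (F (w t) - F (u t))) (at t within {0..})"
      unfolding d_def using u(1)[OF t] w[OF t] by (rule has_vector_derivative_diff[rotated])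
    from has_derivative_B[OF this]
    show "((\<lambda>t. exp (- M * t) * B (d t) (d t)) has_real_derivative
        exp (- M * t) * (2 * B (d t) (F (w t) - F (u t)) - M * B (d t) (d t))) (at t within {0..})"
      by (auto intro!: derivative_eq_intros simp: algebra_simps)
    have "B (d t) (F (w t) - F (u t)) \<le> norm (d t) * norm (F (w t) - F (u t))"
      using Bnorm[of "d t"] by (simp add: abs_le_iff)
    also have "\<dots> \<le> norm (d t) * (\<bar>L R\<bar> * norm (d t))"
    proof (rule mult_left_mono)
      have "norm (F (w t) - F (u t)) \<le> L R * norm (d t)"
        unfolding d_def using nu nw t range_solution[OF u t] range_solution[OF w w0 t] by (intro lip) auto
      also have "\<dots> \<le> \<bar>L R\<bar> * norm (d t)" by (intro mult_right_mono) auto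
      finally show "norm (F (w t) - F (u t)) \<le> \<bar>L R\<bar> * norm (d t)" .
    qed simp
    also have "\<dots> = \<bar>L R\<bar> * (norm (d t))\<^sup>2" by (simp add: power2_eq_square)
    also have "\<dots> \<le> \<bar>L R\<bar> * (C * Bn (d t))\<^sup>2"
      using norm_Bn[OF \<Lambda>d[OF t]] by (intro mult_left_mono power_mono) auto
    also have "\<dots> = M / 2 * B (d t) (d t)" by (simp add: M_def power_mult_distrib Bn_sq)
    finally show "exp (- M * t) * (2 * B (d t) (F (w t) - F (u t)) - M * B (d t) (d t)) \<le> 0"
      by (intro mult_nonneg_nonpos) auto
  qed (use t in auto)
  also have "\<dots> = 0" by (simp add: d_def eq B.zero_left)
  finally have "B (d t) (d t) \<le> 0" by (simp add: mult_le_0_iff)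
  then have "Bn (d t) = 0" using pos[of "d t"] by (simp add: Bn_def)
  then have "norm (d t) \<le> 0" using norm_Bn[OF \<Lambda>d[OF t]] by simp
  then show ?thesis by (simp add: d_def)
qed

end

section \<open>Integration over the unit cell\<close>

lemma restrict_space_pair_measure:
  assumes M: "sigma_finite_measure M" and N: "sigma_finite_measure N"
    and A: "A \<in> sets M" and B: "B \<in> sets N"
  shows "restrict_space M A \<Otimes>\<^sub>M restrict_space N B = restrict_space (M \<Otimes>\<^sub>M N) (A \<times> B)"
proof (rule pair_measure_eqI)
  interpret M: sigma_finite_measure M by fact
  interpret N: sigma_finite_measure N by fact
  show "sigma_finite_measure (restrict_space M A)" "sigma_finite_measure (restrict_space N B)"
    using A B M N by (auto intro: sigma_finite_measure_restrict_space)
  have AB: "A \<times> B \<in> sets (M \<Otimes>\<^sub>M N)" using A B by simp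
  have sp: "space (restrict_space M A \<Otimes>\<^sub>M restrict_space N B) = A \<times> B"
      "space (restrict_space (M \<Otimes>\<^sub>M N) (A \<times> B)) = A \<times> B"
    using sets.sets_into_space[OF A] sets.sets_into_space[OF B] sets.sets_into_space[OF AB]
    by (simp_all add: space_pair_measure space_restrict_space Int_absorb2)
  have 1: "(\<lambda>z. z) \<in> measurable (restrict_space (M \<Otimes>\<^sub>M N) (A \<times> B)) (restrict_space M A \<Otimes>\<^sub>M restrict_space N B)"
  proof (rule measurable_pair)
    show "fst \<circ> (\<lambda>z. z) \<in> measurable (restrict_space (M \<Otimes>\<^sub>M N) (A \<times> B)) (restrict_space M A)"
      unfolding comp_def
    proof (rule measurable_restrict_space2)
      show "fst \<in> space (restrict_space (M \<Otimes>\<^sub>M N) (A \<times> B)) \<rightarrow> A" unfolding sp by auto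
    qed (intro measurable_restrict_space1 measurable_fst)
    show "snd \<circ> (\<lambda>z. z) \<in> measurable (restrict_space (M \<Otimes>\<^sub>M N) (A \<times> B)) (restrict_space N B)"
      unfolding comp_def
    proof (rule measurable_restrict_space2)
      show "snd \<in> space (restrict_space (M \<Otimes>\<^sub>M N) (A \<times> B)) \<rightarrow> B" unfolding sp by auto
    qed (intro measurable_restrict_space1 measurable_snd)
  qed
  have 2: "(\<lambda>z. z) \<in> measurable (restrict_space M A \<Otimes>\<^sub>M restrict_space N B) (restrict_space (M \<Otimes>\<^sub>M N) (A \<times> B))"
  proof (rule measurable_restrict_space2)
    have id1: "(\<lambda>x. x) \<in> measurable (restrict_space M A) M" "(\<lambda>x. x) \<in> measurable (restrict_space N B) N"
      by (auto intro: measurable_restrict_space1)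
    show "(\<lambda>z. z) \<in> measurable (restrict_space M A \<Otimes>\<^sub>M restrict_space N B) (M \<Otimes>\<^sub>M N)"
      by (rule measurable_pair)
        (auto simp: comp_def intro: measurable_compose[OF measurable_fst id1(1)] measurable_compose[OF measurable_snd id1(2)])
  qed (auto simp: sp)
  show "sets (restrict_space M A \<Otimes>\<^sub>M restrict_space N B) = sets (restrict_space (M \<Otimes>\<^sub>M N) (A \<times> B))"
  proof (intro equalityI subsetI)
    fix X assume X: "X \<in> sets (restrict_space M A \<Otimes>\<^sub>M restrict_space N B)"
    show "X \<in> sets (restrict_space (M \<Otimes>\<^sub>M N) (A \<times> B))"
      using measurable_sets[OF 1 X] sets.sets_into_space[OF X] unfolding sp by (simp add: Int_absorb2)
  next
    fix X assume X: "X \<in> sets (restrict_space (M \<Otimes>\<^sub>M N) (A \<times> B))"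
    show "X \<in> sets (restrict_space M A \<Otimes>\<^sub>M restrict_space N B)"
      using measurable_sets[OF 2 X] sets.sets_into_space[OF X] unfolding sp by (simp add: Int_absorb2)
  qed
  fix X Y assume "X \<in> sets (restrict_space M A)" "Y \<in> sets (restrict_space N B)"
  then have X: "X \<in> sets M" "X \<subseteq> A" and Y: "Y \<in> sets N" "Y \<subseteq> B"
    using A B by (auto simp: sets_restrict_space_iff)
  have "emeasure (restrict_space (M \<Otimes>\<^sub>M N) (A \<times> B)) (X \<times> Y) = emeasure (M \<Otimes>\<^sub>M N) (X \<times> Y)"
    using X Y AB by (intro emeasure_restrict_space) auto
  also have "\<dots> = emeasure M X * emeasure N Y"
    using X Y by (intro N.emeasure_pair_measure_Times) auto
  finally show "emeasure (restrict_space M A) X * emeasure (restrict_space N B) Y =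
      emeasure (restrict_space (M \<Otimes>\<^sub>M N) (A \<times> B)) (X \<times> Y)"
    using X Y A B by (simp add: emeasure_restrict_space)
qed

definition ival :: "real \<Rightarrow> real measure" where
  "ival a = restrict_space lborel {a..a+1}"

definition cube :: "real \<Rightarrow> (real^3) measure" where
  "cube a = restrict_space lborel (cbox (\<chi> i. a) (\<chi> i. a+1))"

lemma torus_eq: "torus = cube 0" and vel_eq: "vel = cube (-1/2)"
  by (simp_all add: torus_def vel_def cube_def)

text \<open>Coordinates in a chosen order. The last argument fills the index that is left over, so
  any coordinate can be made the innermost variable of an iterated integral.\<close>

definition place :: "3 \<Rightarrow> 3 \<Rightarrow> real \<times> real \<times> real \<Rightarrow> real^3" where
  "place i j = (\<lambda>(r, s, t). \<chi> n. if n = i then r else if n = j then s else t)"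

lemma UNIV_3_distinct:
  fixes i j k :: 3
  assumes "i \<noteq> j" "i \<noteq> k" "j \<noteq> k"
  shows "UNIV = {i, j, k}"
proof (rule sym, rule card_subset_eq)
  show "card {i, j, k} = card (UNIV :: 3 set)" using assms by simp
qed auto

lemma all_3_distinct:
  fixes i j k :: 3
  assumes "i \<noteq> j" "i \<noteq> k" "j \<noteq> k"
  shows "(\<forall>n. P n) \<longleftrightarrow> P i \<and> P j \<and> P k"
  using UNIV_3_distinct[OF assms] by (metis (full_types) UNIV_I insertE singletonD)

lemma continuous_on_place: "continuous_on S (place i j)"
proof -
  have "continuous_on S (\<lambda>z. if n = i then fst z else if n = j then fst (snd z) else snd (snd z))" for n
    by (cases "n = i"; cases "n = j") (auto intro!: continuous_intros)
  then show ?thesis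
    unfolding place_def case_prod_beta' by (intro continuous_on_vec_lambda) auto
qed

text \<open>Lebesgue measure is determined by its values on open boxes, and a box pulls back to a
  product of intervals.\<close>

lemma lborel_distr_place:
  fixes i j k :: 3
  assumes ijk: "i \<noteq> j" "i \<noteq> k" "j \<noteq> k"
  shows "lborel = distr (lborel \<Otimes>\<^sub>M (lborel \<Otimes>\<^sub>M lborel)) borel (place i j)"
proof (rule lborel_eqI)
  have m: "place i j \<in> measurable (lborel \<Otimes>\<^sub>M (lborel \<Otimes>\<^sub>M lborel)) borel"
    unfolding lborel_prod by (simp add: borel_measurable_continuous_onI continuous_on_place)
  fix l u :: "real^3"
  assume lu: "\<And>b. b \<in> Basis \<Longrightarrow> l \<bullet> b \<le> u \<bullet> b"
  have lu': "l $ n \<le> u $ n" for n using lu[of "axis n 1"] by (simp add: inner_axis)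
  have U: "UNIV = {i, j, k}" by (rule UNIV_3_distinct[OF ijk])
  note all = all_3_distinct[OF ijk]
  have pre: "place i j -` box l u \<inter> space (lborel \<Otimes>\<^sub>M (lborel \<Otimes>\<^sub>M lborel)) =
      {l$i<..<u$i} \<times> ({l$j<..<u$j} \<times> {l$k<..<u$k})"
    using ijk by (auto simp: place_def mem_box_cart all space_pair_measure)
  have "emeasure (distr (lborel \<Otimes>\<^sub>M (lborel \<Otimes>\<^sub>M lborel)) borel (place i j)) (box l u) =
     emeasure (lborel \<Otimes>\<^sub>M (lborel \<Otimes>\<^sub>M lborel)) ({l$i<..<u$i} \<times> ({l$j<..<u$j} \<times> {l$k<..<u$k}))"
    by (subst emeasure_distr[OF m]) (simp_all add: pre)
  also have "\<dots> = ennreal (u$i - l$i) * (ennreal (u$j - l$j) * ennreal (u$k - l$k))"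
    by (subst sigma_finite_measure.emeasure_pair_measure_Times;
        (subst sigma_finite_measure.emeasure_pair_measure_Times)?)
       (auto simp: lu' lborel_prod intro: lborel.sigma_finite_measure_axioms)
  also have "\<dots> = ennreal (\<Prod>n\<in>UNIV. u $ n - l $ n)"
    using ijk by (subst U) (simp add: ennreal_mult lu')
  also have "(\<Prod>n\<in>UNIV. u $ n - l $ n) = (\<Prod>b\<in>(\<lambda>n. axis n 1)`UNIV. (u - l) \<bullet> b)"
    by (subst prod.reindex) (auto simp: inj_on_def axis_eq_axis inner_axis)
  also have "(\<lambda>n. axis n 1)`UNIV = (Basis :: (real^3) set)"
    by (auto simp: Basis_vec_def)
  finally show "emeasure (distr (lborel \<Otimes>\<^sub>M (lborel \<Otimes>\<^sub>M lborel)) borel (place i j)) (box l u) =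
     ennreal (\<Prod>b\<in>Basis. (u - l) \<bullet> b)" .
qed simp

lemma ival_triple:
  "ival a \<Otimes>\<^sub>M (ival a \<Otimes>\<^sub>M ival a) =
    restrict_space (lborel \<Otimes>\<^sub>M (lborel \<Otimes>\<^sub>M lborel)) ({a..a+1} \<times> ({a..a+1} \<times> {a..a+1}))"
proof -
  have s: "sigma_finite_measure (lborel \<Otimes>\<^sub>M lborel :: (real \<times> real) measure)"
    unfolding lborel_prod by (rule lborel.sigma_finite_measure_axioms)
  show ?thesis
    unfolding ival_def
    by (simp only: restrict_space_pair_measure[OF lborel.sigma_finite_measure_axioms lborel.sigma_finite_measure_axioms]
        restrict_space_pair_measure[OF lborel.sigma_finite_measure_axioms s]
        sets_lborel atLeastAtMost_borel pair_measureI)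
qed

lemma cube_distr_place:
  fixes i j k :: 3
  assumes ijk: "i \<noteq> j" "i \<noteq> k" "j \<noteq> k"
  shows "cube a = distr (ival a \<Otimes>\<^sub>M (ival a \<Otimes>\<^sub>M ival a)) (cube a) (place i j)"
proof (rule measure_eqI)
  let ?L = "lborel \<Otimes>\<^sub>M (lborel \<Otimes>\<^sub>M lborel) :: (real \<times> real \<times> real) measure"
  let ?C = "{a..a+1} \<times> ({a..a+1} \<times> {a..a+1})"
  have U: "UNIV = {i, j, k}" by (rule UNIV_3_distinct[OF ijk])
  note all = all_3_distinct[OF ijk]
  have m: "place i j \<in> measurable ?L borel"
    unfolding lborel_prod by (simp add: borel_measurable_continuous_onI continuous_on_place)
  have m': "place i j \<in> measurable (restrict_space ?L ?C) (cube a)"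
    unfolding cube_def using m ijk
    by (intro measurable_restrict_space2 measurable_restrict_space1)
       (auto simp: space_restrict_space place_def mem_box_cart all)
  have C: "?C \<in> sets ?L" by (intro pair_measureI) auto
  fix B assume "B \<in> sets (cube a)"
  then have B: "B \<in> sets borel" "B \<subseteq> cbox (\<chi> i. a) (\<chi> i. a+1)" and B': "B \<in> sets (cube a)"
    by (auto simp: cube_def sets_restrict_space_iff)
  have pre: "place i j -` B \<inter> space (restrict_space ?L ?C) = place i j -` B \<inter> space ?L"
  proof -
    have "z \<in> ?C" if "place i j z \<in> B" for z
    proof -
      have "place i j z \<in> cbox (\<chi> i. a) (\<chi> i. a+1)" using that B by blast
      then show ?thesis using ijk by (cases z) (auto simp: place_def mem_box_cart all)
    qed
    then show ?thesis by (auto simp: space_restrict_space space_pair_measure)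
  qed
  have "emeasure (cube a) B = emeasure lborel B"
    unfolding cube_def using B by (intro emeasure_restrict_space) auto
  also have "\<dots> = emeasure ?L (place i j -` B \<inter> space ?L)"
    by (subst lborel_distr_place[OF ijk], subst emeasure_distr[OF m]) (use B in auto)
  also have "\<dots> = emeasure (restrict_space ?L ?C) (place i j -` B \<inter> space (restrict_space ?L ?C))"
    unfolding pre using C pre by (intro emeasure_restrict_space[symmetric]) (auto simp: space_restrict_space)
  also have "\<dots> = emeasure (distr (ival a \<Otimes>\<^sub>M (ival a \<Otimes>\<^sub>M ival a)) (cube a) (place i j)) B"
    unfolding ival_triple using m' B' by (intro emeasure_distr[symmetric]) auto
  finally show "emeasure (cube a) B = \<dots>" .
qed simp

lemma finite_measure_ival: "finite_measure (ival a)"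
  and emeasure_ival: "emeasure (ival a) (space (ival a)) = 1"
proof -
  show 1: "emeasure (ival a) (space (ival a)) = 1"
    by (simp add: ival_def space_restrict_space emeasure_restrict_space)
  show "finite_measure (ival a)" by (rule finite_measureI) (simp add: 1)
qed

lemma measurable_place:
  fixes i j k :: 3
  assumes ijk: "i \<noteq> j" "i \<noteq> k" "j \<noteq> k"
  shows "place i j \<in> measurable (ival a \<Otimes>\<^sub>M (ival a \<Otimes>\<^sub>M ival a)) (cube a)"
proof -
  note all = all_3_distinct[OF ijk]
  show ?thesis
    unfolding ival_triple cube_def
  proof (rule measurable_restrict_space2)
    show "place i j \<in> measurable (restrict_space (lborel \<Otimes>\<^sub>M lborel \<Otimes>\<^sub>M lborel) ({a..a + 1} \<times> {a..a + 1} \<times> {a..a + 1})) lborel"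
      by (intro measurable_restrict_space1) (simp add: lborel_prod borel_measurable_continuous_onI continuous_on_place)
  qed (use ijk in \<open>auto simp: space_restrict_space place_def mem_box_cart all\<close>)
qed

lemma finite_measure_cube: "finite_measure (cube a)"
  and emeasure_cube: "emeasure (cube a) (space (cube a)) = 1"
proof -
  have "emeasure (cube a) (space (cube a)) = emeasure (ival a \<Otimes>\<^sub>M (ival a \<Otimes>\<^sub>M ival a)) (space (ival a \<Otimes>\<^sub>M (ival a \<Otimes>\<^sub>M ival a)))"
    using measurable_place[of 1 2 3 a]
    by (subst cube_distr_place[of 1 2 3]) (auto simp: emeasure_distr dest: measurable_space intro!: arg_cong2[where f=emeasure])
  also have "\<dots> = 1"
  proof -
    interpret finite_measure "ival a" by (rule finite_measure_ival)
    interpret P: pair_sigma_finite "ival a" "ival a" ..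
    have "emeasure (ival a \<Otimes>\<^sub>M ival a) (space (ival a) \<times> space (ival a)) = 1"
      by (subst emeasure_pair_measure_Times) (simp_all add: emeasure_ival)
    then show ?thesis
      unfolding space_pair_measure
      by (subst sigma_finite_measure.emeasure_pair_measure_Times[OF P.sigma_finite_measure_axioms])
         (simp_all add: emeasure_ival pair_measureI)
  qed
  finally show 1: "emeasure (cube a) (space (cube a)) = 1" .
  show "finite_measure (cube a)" by (rule finite_measureI) (simp add: 1)
qed

interpretation ival: finite_measure "ival a" by (rule finite_measure_ival)
interpretation cube: finite_measure "cube a" by (rule finite_measure_cube)
interpretation torus: finite_measure torus unfolding torus_eq by (rule finite_measure_cube)
interpretation vel: finite_measure vel unfolding vel_eq by (rule finite_measure_cube)
interpretation tv: pair_sigma_finite torus vel ..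
interpretation ival2: pair_sigma_finite "ival a" "ival a" ..

interpretation phase: finite_measure phase
  unfolding phase_def by (intro finite_measure_pair_measure torus.finite_measure_axioms vel.finite_measure_axioms)

lemma measure_vel [simp]: "measure vel (space vel) = 1"
  by (simp add: measure_def emeasure_cube vel_eq)

lemma measure_phase [simp]: "measure phase (space phase) = 1"
proof -
  have "emeasure phase (space phase) = emeasure torus (space torus) * emeasure vel (space vel)"
    unfolding phase_def space_pair_measure by (rule vel.emeasure_pair_measure_Times) auto
  then show ?thesis by (simp add: measure_def emeasure_cube torus_eq vel_eq)
qed

text \<open>The product form of \<open>phase\<close> is for Fubini; this restricted form is for
  integrands that are continuous on a compact set.\<close>

lemma phase_eq: "phase = restrict_space lborel (cbox (\<chi> i. 0) (\<chi> i. 1) \<times> cbox (\<chi> i. -1/2) (\<chi> i. 1/2))"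
  unfolding phase_def torus_def vel_def
  by (subst restrict_space_pair_measure) (auto simp: lborel_prod intro: lborel.sigma_finite_measure_axioms)

lemma space_torus: "space torus = cbox (\<chi> i. 0) (\<chi> i. 1)"
  and space_vel: "space vel = cbox (\<chi> i. -1/2) (\<chi> i. 1/2)"
  by (simp_all add: torus_def vel_def space_restrict_space)

lemma space_phase: "space phase = space torus \<times> space vel"
  by (simp add: phase_def space_pair_measure)

section \<open>Measurability and integrability on the cells\<close>

lemma measurable_phase_borel [measurable (raw)]: "f \<in> measurable borel M \<Longrightarrow> f \<in> measurable phase M"
  unfolding phase_eq by (rule measurable_restrict_space1) simp
lemma measurable_cube_borel: "f \<in> measurable borel M \<Longrightarrow> f \<in> measurable (cube a) M"
  unfolding cube_def by (rule measurable_restrict_space1) simp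
lemma measurable_ival_borel: "f \<in> measurable borel M \<Longrightarrow> f \<in> measurable (ival a) M"
  unfolding ival_def by (rule measurable_restrict_space1) simp
lemma measurable_torus_borel: "f \<in> measurable borel M \<Longrightarrow> f \<in> measurable torus M"
  and measurable_vel_borel: "f \<in> measurable borel M \<Longrightarrow> f \<in> measurable vel M"
  unfolding torus_eq vel_eq by (simp_all add: measurable_cube_borel)

lemma integrable_continuous_compact_restrict:
  fixes f :: "'a::euclidean_space \<Rightarrow> 'b::{banach, second_countable_topology}"
  assumes "compact S" "continuous_on S f"
  shows "integrable (restrict_space lborel S) f"
  using borel_integrable_compact[OF assms] compact_imp_closed[OF assms(1)]
  by (simp add: integrable_restrict_space borel_closed)

lemma integrable_phase_continuous:
  fixes f :: "_ \<Rightarrow> 'b::{banach, second_countable_topology}"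
  assumes "continuous_on UNIV f" shows "integrable phase f"
  unfolding phase_eq using assms
  by (intro integrable_continuous_compact_restrict compact_Times compact_cbox continuous_on_subset[OF assms]) auto

lemma integrable_cube_continuous:
  fixes f :: "_ \<Rightarrow> 'b::{banach, second_countable_topology}"
  assumes "continuous_on UNIV f" shows "integrable (cube a) f"
  unfolding cube_def using assms
  by (intro integrable_continuous_compact_restrict compact_cbox continuous_on_subset[OF assms]) auto

lemma integrable_torus_continuous:
  fixes f :: "_ \<Rightarrow> 'b::{banach, second_countable_topology}"
  assumes "continuous_on UNIV f" shows "integrable torus f"
  unfolding torus_eq using assms by (rule integrable_cube_continuous)

lemma integrable_vel_continuous:
  fixes f :: "_ \<Rightarrow> 'b::{banach, second_countable_topology}"
  assumes "continuous_on UNIV f" shows "integrable vel f"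
  unfolding vel_eq using assms by (rule integrable_cube_continuous)

lemma integrable_mult_bounded:
  fixes q :: "'a \<Rightarrow> real"
  assumes "integrable M q" "d \<in> borel_measurable M" "\<And>x. x \<in> space M \<Longrightarrow> \<bar>d x\<bar> \<le> B"
  shows "integrable M (\<lambda>x. q x * d x)"
proof (rule Bochner_Integration.integrable_bound)
  show "integrable M (\<lambda>x. q x * B)" using assms(1) by simp
  show "AE x in M. norm (q x * d x) \<le> norm (q x * B)"
  proof (rule AE_I2)
    fix x assume "x \<in> space M"
    then have "\<bar>d x\<bar> \<le> \<bar>B\<bar>" using assms(3)[of x] by simp
    then show "norm (q x * d x) \<le> norm (q x * B)"
      unfolding real_norm_def abs_mult by (rule mult_left_mono) simp
  qed
qed (use assms in auto)

lemma continuous_bounded_torus: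
  assumes "continuous_on UNIV (\<phi> :: real^3 \<Rightarrow> real)"
  obtains M where "\<And>x. x \<in> space torus \<Longrightarrow> \<bar>\<phi> x\<bar> \<le> M"
proof -
  have "bounded (\<phi> ` space torus)"
    unfolding space_torus by (intro compact_imp_bounded compact_continuous_image continuous_on_subset[OF assms]) auto
  then show ?thesis using that unfolding bounded_iff by auto
qed

lemma integral_cube_place:
  fixes i j k :: 3 and f :: "_ \<Rightarrow> 'b::{banach, second_countable_topology}"
  assumes ijk: "i \<noteq> j" "i \<noteq> k" "j \<noteq> k" and f: "f \<in> borel_measurable (cube a)"
  shows "(LINT x|cube a. f x) = (LINT z|(ival a \<Otimes>\<^sub>M (ival a \<Otimes>\<^sub>M ival a)). f (place i j z))"
  by (subst cube_distr_place[OF ijk], subst integral_distr[OF measurable_place[OF ijk] f]) simp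

lemma integrable_cube_place:
  fixes i j k :: 3 and f :: "_ \<Rightarrow> 'b::{banach, second_countable_topology}"
  assumes ijk: "i \<noteq> j" "i \<noteq> k" "j \<noteq> k" and f: "integrable (cube a) f"
  shows "integrable (ival a \<Otimes>\<^sub>M (ival a \<Otimes>\<^sub>M ival a)) (\<lambda>z. f (place i j z))"
  using f integrable_distr_eq[OF measurable_place[OF ijk, of a], of f] borel_measurable_integrable[OF f]
    cube_distr_place[OF ijk, of a] by metis

lemma integral_cube_iterated:
  fixes i j k :: 3 and f :: "_ \<Rightarrow> 'b::{banach, second_countable_topology}"
  assumes ijk: "i \<noteq> j" "i \<noteq> k" "j \<noteq> k" and f: "continuous_on UNIV f"
  shows "(LINT x|cube a. f x) = (LINT r|ival a. LINT s|ival a. LINT t|ival a. f (place i j (r, s, t)))"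
proof -
  have s2: "sigma_finite_measure (ival a \<Otimes>\<^sub>M ival a)"
    by (rule ival2.sigma_finite_measure_axioms)
  interpret Q: pair_sigma_finite "ival a" "ival a \<Otimes>\<^sub>M ival a"
    by (intro pair_sigma_finite.intro s2 ival.sigma_finite_measure_axioms)
  have "integrable (ival a \<Otimes>\<^sub>M (ival a \<Otimes>\<^sub>M ival a)) (\<lambda>z. f (place i j z))"
    using integrable_cube_place[OF ijk integrable_cube_continuous[OF f]] .
  from Q.integral_fst'[OF this] have "(LINT x|cube a. f x) = (LINT r|ival a. LINT z|(ival a \<Otimes>\<^sub>M ival a). f (place i j (r, z)))"
    using integral_cube_place[OF ijk borel_measurable_integrable[OF integrable_cube_continuous[OF f]]] by metis
  also have "\<dots> = (LINT r|ival a. LINT s|ival a. LINT t|ival a. f (place i j (r, s, t)))"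
  proof (rule Bochner_Integration.integral_cong[OF refl])
    fix r
    have "continuous_on UNIV (\<lambda>z. f (place i j (r, z)))"
      by (intro continuous_on_compose2[OF f] continuous_on_compose2[OF continuous_on_place] continuous_intros) auto
    then have "integrable (ival a \<Otimes>\<^sub>M ival a) (\<lambda>z. f (place i j (r, z)))"
      unfolding ival_def
      by (subst restrict_space_pair_measure)
        (auto simp: lborel_prod intro!: lborel.sigma_finite_measure_axioms integrable_continuous_compact_restrict compact_Times
          elim: continuous_on_subset)
    from ival2.integral_fst'[OF this]
    show "(LINT z|(ival a \<Otimes>\<^sub>M ival a). f (place i j (r, z))) = (LINT s|ival a. LINT t|ival a. f (place i j (r, s, t)))"
      by simp
  qed
  finally show ?thesis .
qed

text \<open>With the \<open>j\<close>-th coordinate innermost, the fundamental theorem leaves the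
  difference of two values one period apart. Both integration by parts in \<open>x\<close> and the
  orthogonality of the characters rest on this.\<close>

lemma integral_cube_periodic_deriv:
  assumes c: "continuous_on UNIV \<psi>'" and per: "\<And>x. \<psi> (x + axis j 1) = \<psi> x"
    and d: "\<And>x. ((\<lambda>t. \<psi> (x + t *\<^sub>R axis j 1)) has_real_derivative \<psi>' x) (at 0)"
  shows "(LINT x|cube a. \<psi>' x) = 0"
proof -
  obtain i k :: 3 where ik: "i \<noteq> k" "i \<noteq> j" "k \<noteq> j"
  proof -
    have "j = 1 \<or> j = 2 \<or> j = 3" by (rule exhaust_3)
    then show ?thesis using that[of 1 2] that[of 1 3] that[of 2 3] by auto
  qed
  have "(LINT t|ival a. \<psi>' (place i k (r, s, t))) = 0" for r s
  proof -
    have pl: "place i k (r, s, t + h) = place i k (r, s, t) + h *\<^sub>R axis j 1" for t h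
      using ik UNIV_3_distinct[OF ik] by (auto simp: place_def vec_eq_iff axis_def)
    let ?f = "\<lambda>t. \<psi>' (place i k (r, s, t))"
    have cf: "continuous_on UNIV ?f"
      by (intro continuous_on_compose2[OF c] continuous_on_compose2[OF continuous_on_place] continuous_intros) auto
    have df: "((\<lambda>t. \<psi> (place i k (r, s, t))) has_real_derivative ?f t) (at t)" for t
    proof -
      have "((\<lambda>h. \<psi> (place i k (r, s, t + h))) has_real_derivative ?f t) (at 0)"
        using d[of "place i k (r, s, t)"] unfolding pl .
      then show ?thesis using DERIV_shift[of "\<lambda>t. \<psi> (place i k (r, s, t))" "?f t" 0 t]
        by (simp add: add.commute)
    qed
    have "(LINT t|ival a. ?f t) = (\<integral>t. ?f t * indicator {a..a+1} t \<partial>lborel)"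
      unfolding ival_def by (subst integral_restrict_space) (auto simp: mult.commute)
    also have "\<dots> = \<psi> (place i k (r, s, a+1)) - \<psi> (place i k (r, s, a))"
      using df cf by (intro integral_FTC_Icc_real) (auto simp: continuous_on_eq_continuous_at)
    also have "\<dots> = 0" using per[of "place i k (r, s, a)"] pl[of a 1] by simp
    finally show ?thesis .
  qed
  then show ?thesis by (subst integral_cube_iterated[OF ik c]) simp
qed

section \<open>Weak derivatives on the torus\<close>

lemma integral_phase_iterated:
  fixes f :: "_ \<Rightarrow> real"
  assumes "integrable phase f"
  shows "(LINT z|phase. f z) = (LINT v|vel. LINT x|torus. f (x, v))"
    and "(LINT z|phase. f z) = (LINT x|torus. LINT v|vel. f (x, v))"
  using assms tv.integral_snd[of "\<lambda>x v. f (x, v)"] tv.integral_fst'[of f]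
  by (simp_all add: phase_def)

text \<open>Classical derivatives in a form closed under the operations of the equation.
  Differentiability at \<open>t = 0\<close> from every base point gives it along the whole line;
  periodicity of both functions puts them into \<open>L2\<close>.\<close>

definition xder :: "3 \<Rightarrow> density \<Rightarrow> density \<Rightarrow> bool" where
  "xder j h h' \<longleftrightarrow> continuous_on UNIV h \<and> continuous_on UNIV h' \<and>
     (\<forall>x v i. h (x + axis i 1, v) = h (x, v)) \<and> (\<forall>x v i. h' (x + axis i 1, v) = h' (x, v)) \<and>
     (\<forall>x v. ((\<lambda>t. h (x + t *\<^sub>R axis j 1, v)) has_real_derivative h' (x, v)) (at 0))"

lemma xder_integral_eq_0:
  assumes "xder j h h'" shows "(LINT x|torus. h' (x, v)) = 0"
  unfolding torus_eq using assms
  by (intro integral_cube_periodic_deriv[where j=j and \<psi>="\<lambda>x. h (x, v)"])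
     (auto simp: xder_def intro!: continuous_on_compose2[of UNIV h'] continuous_intros)

lemma xder_const_x:
  assumes "continuous_on UNIV a" shows "xder j (\<lambda>(x, v). a v) (\<lambda>_. 0)"
  unfolding xder_def using assms
  by (auto simp: case_prod_beta' intro!: continuous_on_compose2[OF assms] continuous_intros)

lemma xder_add: "xder j f f' \<Longrightarrow> xder j g g' \<Longrightarrow> xder j (\<lambda>z. f z + g z) (\<lambda>z. f' z + g' z)"
  unfolding xder_def by (auto intro!: continuous_intros derivative_eq_intros)

lemma xder_diff: "xder j f f' \<Longrightarrow> xder j g g' \<Longrightarrow> xder j (\<lambda>z. f z - g z) (\<lambda>z. f' z - g' z)"
  unfolding xder_def by (auto intro!: continuous_intros derivative_eq_intros)

lemma xder_cmult: "xder j f f' \<Longrightarrow> xder j (\<lambda>z. c * f z) (\<lambda>z. c * f' z)"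
  unfolding xder_def by (auto intro!: continuous_intros derivative_eq_intros)

lemma xder_mult: "xder j f f' \<Longrightarrow> xder j g g' \<Longrightarrow> xder j (\<lambda>z. f z * g z) (\<lambda>z. f' z * g z + f z * g' z)"
  unfolding xder_def by (auto intro!: continuous_intros derivative_eq_intros)

lemma xder_zero: "xder j (\<lambda>_. 0) (\<lambda>_. 0)"
  unfolding xder_def by auto

lemma xder_sum: "(\<And>i. i \<in> I \<Longrightarrow> xder j (f i) (f' i)) \<Longrightarrow> xder j (\<lambda>z. \<Sum>i\<in>I. f i z) (\<lambda>z. \<Sum>i\<in>I. f' i z)"
proof (induction I rule: infinite_finite_induct)
  case (insert x F)
  then show ?case using xder_add[of j "f x" "f' x"] by simp
qed (auto intro: xder_zero)

lemma pd_eq: "(\<phi> has_derivative D) (at x) \<Longrightarrow> pd j \<phi> x = D (axis j 1)"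
  unfolding pd_def using frechet_derivative_at by metis

lemma torus_smooth_xder:
  assumes s: "torus_smooth \<phi>" shows "xder j (\<lambda>(x, v). \<phi> x) (\<lambda>(x, v). pd j \<phi> x)"
proof -
  have d: "\<phi> differentiable (at x)" for x
    using s unfolding torus_smooth_def by (metis foldr.simps(1) id_apply)
  have d1: "pd j \<phi> differentiable (at x)" for x
    using s unfolding torus_smooth_def by (metis foldr.simps comp_apply id_apply)
  have per: "\<phi> (x + axis i 1) = \<phi> x" for x i using s unfolding torus_smooth_def by blast
  have D: "(\<phi> has_derivative frechet_derivative \<phi> (at x)) (at x)" for x
    using d frechet_derivative_works by blast
  have c: "continuous_on UNIV \<phi>" "continuous_on UNIV (pd j \<phi>)"
    using d d1 by (auto intro!: continuous_at_imp_continuous_on differentiable_imp_continuous_within)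
  have der: "((\<lambda>t. \<phi> (x + t *\<^sub>R axis j 1)) has_real_derivative pd j \<phi> x) (at 0)" for x
  proof -
    have "((\<lambda>t. x + t *\<^sub>R axis j 1) has_derivative (\<lambda>t. t *\<^sub>R axis j 1)) (at 0)"
      by (auto intro!: derivative_eq_intros)
    from has_derivative_compose[OF this, of \<phi> "frechet_derivative \<phi> (at x)"] D[of x]
    have "((\<lambda>t. \<phi> (x + t *\<^sub>R axis j 1)) has_derivative (\<lambda>t. frechet_derivative \<phi> (at x) (t *\<^sub>R axis j 1))) (at 0)"
      by simp
    moreover have "frechet_derivative \<phi> (at x) (t *\<^sub>R axis j 1) = pd j \<phi> x * t" for t
      using linear_cmul[OF linear_frechet_derivative[OF d]] by (simp add: pd_def)
    ultimately show ?thesis by (simp add: has_field_derivative_def)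
  qed
  have pp: "pd j \<phi> (x + axis i 1) = pd j \<phi> x" for x i
  proof -
    have "(\<lambda>t. \<phi> (x + axis i 1 + t *\<^sub>R axis j 1)) = (\<lambda>t. \<phi> (x + t *\<^sub>R axis j 1))"
      using per[of "x + t *\<^sub>R axis j 1" i for t] by (simp add: ac_simps)
    then show ?thesis using der[of "x + axis i 1"] der[of x] DERIV_unique by metis
  qed
  show ?thesis
    unfolding xder_def using per pp der
    by (auto simp: case_prod_beta' intro!: continuous_on_compose2[OF c(1)] continuous_on_compose2[OF c(2)] continuous_intros)
qed

lemma xder_continuous:
  assumes "xder j h h'"
  shows "continuous_on S h" "continuous_on S h'"
  using assms continuous_on_subset unfolding xder_def by blast+

lemma xder_slice:
  assumes "xder j h h'"
  shows "continuous_on S (\<lambda>x. h (x, v))" "continuous_on S (\<lambda>x. h' (x, v))"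
  by (rule continuous_on_compose2[OF xder_continuous(1)[OF assms]], auto intro!: continuous_intros)
     (rule continuous_on_compose2[OF xder_continuous(2)[OF assms]], auto intro!: continuous_intros)

text \<open>The product with a test function has a derivative whose integral over the torus is zero,
  and this at every \<open>v\<close>.\<close>

lemma xder_weak_deriv:
  assumes h: "xder j h h'" shows "weak_deriv_x j h h'"
  unfolding weak_deriv_x_def
proof (intro allI impI AE_I2)
  fix \<phi> v assume s: "torus_smooth \<phi>"
  note sx = torus_smooth_xder[OF s, of j]
  have "(LINT x|torus. h' (x, v) * \<phi> x + h (x, v) * pd j \<phi> x) = 0"
    using xder_integral_eq_0[OF xder_mult[OF h sx], of v] by simp
  moreover have "integrable torus (\<lambda>x. h' (x, v) * \<phi> x)" "integrable torus (\<lambda>x. h (x, v) * pd j \<phi> x)"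
    using xder_slice[OF h, of UNIV v] xder_slice[OF sx, of UNIV v]
    by (auto intro!: integrable_torus_continuous continuous_on_mult)
  ultimately show "(LINT x|torus. h (x, v) * pd j \<phi> x) = - (LINT x|torus. h' (x, v) * \<phi> x)"
    by simp
qed

lemma continuous_periodic_L2:
  assumes "continuous_on UNIV h" "\<And>x v i. h (x + axis i 1, v) = h (x, v)"
  shows "h \<in> L2"
  unfolding L2_def using assms
  by (auto intro!: integrable_phase_continuous continuous_intros borel_measurable_integrable)

lemma xder_L2: "xder j h h' \<Longrightarrow> h \<in> L2" "xder j h h' \<Longrightarrow> h' \<in> L2"
  unfolding xder_def by (auto intro!: continuous_periodic_L2)

text \<open>\<open>L2\<close> without the periodicity, which integrals over \<open>phase\<close> do
  not see.\<close>

definition sqint :: "density \<Rightarrow> bool" where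
  "sqint h \<longleftrightarrow> h \<in> borel_measurable phase \<and> integrable phase (\<lambda>z. (h z)\<^sup>2)"

lemma L2_sqint: "h \<in> L2 \<Longrightarrow> sqint h" by (simp add: L2_def sqint_def)

lemma sqint_continuous: "continuous_on UNIV h \<Longrightarrow> sqint h"
  unfolding sqint_def by (auto intro!: integrable_phase_continuous continuous_intros borel_measurable_integrable)

lemma sqint_integrable_mult:
  assumes "sqint h" "sqint g" shows "integrable phase (\<lambda>z. h z * g z)"
proof (rule Bochner_Integration.integrable_bound)
  show "integrable phase (\<lambda>z. (h z)\<^sup>2 + (g z)\<^sup>2)" using assms by (auto simp: sqint_def)
  show "AE z in phase. norm (h z * g z) \<le> norm ((h z)\<^sup>2 + (g z)\<^sup>2)"
  proof (rule AE_I2)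
    fix z
    have "2 * \<bar>h z * g z\<bar> \<le> (h z)\<^sup>2 + (g z)\<^sup>2"
      using sum_squares_bound[of "\<bar>h z\<bar>" "\<bar>g z\<bar>"] by (simp add: abs_mult)
    moreover have "0 \<le> \<bar>h z * g z\<bar>" by simp
    ultimately show "norm (h z * g z) \<le> norm ((h z)\<^sup>2 + (g z)\<^sup>2)"
      unfolding real_norm_def by linarith
  qed
qed (use assms in \<open>auto simp: sqint_def\<close>)

lemma sqint_integrable: "sqint h \<Longrightarrow> integrable phase h"
  using sqint_integrable_mult[of h "\<lambda>_. 1"] by (simp add: sqint_continuous)

lemma L2_integrable: "h \<in> L2 \<Longrightarrow> integrable phase h"
  by (intro sqint_integrable L2_sqint)

lemma sqint_add: "sqint h \<Longrightarrow> sqint g \<Longrightarrow> sqint (\<lambda>z. h z + g z)"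
  using sqint_integrable_mult[of h g] by (auto simp: sqint_def power2_sum mult.assoc)

lemma sqint_diff: "sqint h \<Longrightarrow> sqint g \<Longrightarrow> sqint (\<lambda>z. h z - g z)"
  using sqint_integrable_mult[of h g] by (auto simp: sqint_def power2_diff mult.assoc)

lemma sqint_cmult: "sqint h \<Longrightarrow> sqint (\<lambda>z. c * h z)"
  by (auto simp: sqint_def power_mult_distrib)

lemma L2_diff: "h \<in> L2 \<Longrightarrow> g \<in> L2 \<Longrightarrow> (\<lambda>z. h z - g z) \<in> L2"
  using sqint_diff[of h g] by (auto simp: L2_def sqint_def)

section \<open>Periodic test functions and the fundamental lemma of the calculus of
  variations\<close>

inductive trig_smooth :: "(real^3 \<Rightarrow> real) \<Rightarrow> bool" where
  const: "trig_smooth (\<lambda>_. c)"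
| cos: "(\<And>i. m $ i \<in> \<int>) \<Longrightarrow> trig_smooth (\<lambda>x. cos (2 * pi * (m \<bullet> x)))"
| sin: "(\<And>i. m $ i \<in> \<int>) \<Longrightarrow> trig_smooth (\<lambda>x. sin (2 * pi * (m \<bullet> x)))"
| add: "trig_smooth f \<Longrightarrow> trig_smooth g \<Longrightarrow> trig_smooth (\<lambda>x. f x + g x)"
| mult: "trig_smooth f \<Longrightarrow> trig_smooth g \<Longrightarrow> trig_smooth (\<lambda>x. f x * g x)"

lemma cos_sin_Ints_shift:
  assumes "k \<in> \<int>" shows "cos (2 * pi * (a + k)) = cos (2 * pi * a)" "sin (2 * pi * (a + k)) = sin (2 * pi * a)"
  using assms by (auto elim!: Ints_cases simp: distrib_left cos_add sin_add sin_integer_2pi cos_integer_2pi)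

lemma trig_smooth_periodic: "trig_smooth f \<Longrightarrow> f (x + axis i 1) = f x"
  by (induction rule: trig_smooth.induct)
     (auto simp: inner_add_right inner_axis cos_sin_Ints_shift)

lemma has_derivative_cos_inner:
  "((\<lambda>x. cos (2 * pi * (m \<bullet> x))) has_derivative (\<lambda>h. - sin (2 * pi * (m \<bullet> x)) * (2 * pi * (m \<bullet> h)))) (at x)"
  "((\<lambda>x. sin (2 * pi * (m \<bullet> x))) has_derivative (\<lambda>h. cos (2 * pi * (m \<bullet> x)) * (2 * pi * (m \<bullet> h)))) (at x)"
  by (auto intro!: derivative_eq_intros ext simp: mult_ac)

lemma pd_cos: "pd j (\<lambda>x. cos (2 * pi * (m \<bullet> x))) x = - (2 * pi * m $ j) * sin (2 * pi * (m \<bullet> x))"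
  and pd_sin: "pd j (\<lambda>x. sin (2 * pi * (m \<bullet> x))) x = 2 * pi * m $ j * cos (2 * pi * (m \<bullet> x))"
  by (subst pd_eq[OF has_derivative_cos_inner(1)], simp add: inner_axis)
     (subst pd_eq[OF has_derivative_cos_inner(2)], simp add: inner_axis)

text \<open>\<open>torus_smooth\<close> speaks of all iterated partial derivatives; a class stable
  under \<open>pd\<close> settles them by induction on the list of directions.\<close>

lemma trig_smooth_pd:
  "trig_smooth f \<Longrightarrow> (\<forall>x. f differentiable (at x)) \<and> trig_smooth (pd j f)"
proof (induction rule: trig_smooth.induct)
  case (const c)
  have "pd j (\<lambda>_. c) = (\<lambda>_. 0)" by (auto simp: pd_def)
  then show ?case by (auto intro: trig_smooth.const)
next
  case (cos m)
  have "pd j (\<lambda>x. cos (2 * pi * (m \<bullet> x))) = (\<lambda>x. - (2 * pi * m $ j) * sin (2 * pi * (m \<bullet> x)))"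
    by (rule ext) (rule pd_cos)
  moreover have "trig_smooth (\<lambda>x. - (2 * pi * m $ j) * sin (2 * pi * (m \<bullet> x)))"
    by (intro trig_smooth.mult[OF trig_smooth.const trig_smooth.sin] cos)
  ultimately show ?case
    using has_derivative_cos_inner(1) unfolding differentiable_def by metis
next
  case (sin m)
  have "pd j (\<lambda>x. sin (2 * pi * (m \<bullet> x))) = (\<lambda>x. 2 * pi * m $ j * cos (2 * pi * (m \<bullet> x)))"
    by (rule ext) (rule pd_sin)
  then show ?case
    using has_derivative_cos_inner(2) sin by (auto simp: differentiable_def intro: trig_smooth.mult[OF trig_smooth.const trig_smooth.cos])
next
  case (add f g)
  have "pd j (\<lambda>x. f x + g x) = (\<lambda>x. pd j f x + pd j g x)"
  proof
    fix x
    have "(f has_derivative frechet_derivative f (at x)) (at x)" "(g has_derivative frechet_derivative g (at x)) (at x)"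
      using add.IH frechet_derivative_works by blast+
    from has_derivative_add[OF this]
    show "pd j (\<lambda>x. f x + g x) x = pd j f x + pd j g x"
      by (subst pd_eq) (auto simp: pd_def)
  qed
  then show ?case using add by (auto intro: trig_smooth.add differentiable_add)
next
  case (mult f g)
  have "pd j (\<lambda>x. f x * g x) = (\<lambda>x. f x * pd j g x + pd j f x * g x)"
  proof
    fix x
    have "(f has_derivative frechet_derivative f (at x)) (at x)" "(g has_derivative frechet_derivative g (at x)) (at x)"
      using mult.IH frechet_derivative_works by blast+
    from has_derivative_mult[OF this]
    show "pd j (\<lambda>x. f x * g x) x = f x * pd j g x + pd j f x * g x"
      by (subst pd_eq) (auto simp: pd_def)
  qed
  then show ?case using mult by (auto intro: trig_smooth.add trig_smooth.mult differentiable_mult)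
qed

lemma trig_smooth_torus_smooth:
  assumes "trig_smooth f" shows "torus_smooth f"
proof -
  have "trig_smooth (foldr pd js f)" for js
    using assms trig_smooth_pd by (induction js) auto
  then show ?thesis unfolding torus_smooth_def
    using trig_smooth_periodic[OF assms] trig_smooth_pd by blast
qed

lemma trig_smooth_sum: "(\<And>i. i \<in> I \<Longrightarrow> trig_smooth (f i)) \<Longrightarrow> trig_smooth (\<lambda>x. \<Sum>i\<in>I. f i x)"
  by (induction I rule: infinite_finite_induct) (auto intro: trig_smooth.intros)

text \<open>The quotient map onto the torus, realised as a product of three circles. Its components
  are the cosines and sines that generate the trigonometric polynomials.\<close>

definition circle_map :: "real^3 \<Rightarrow> (real^3) \<times> (real^3)" where
  "circle_map x = ((\<chi> i. cos (2 * pi * x $ i)), (\<chi> i. sin (2 * pi * x $ i)))"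

lemma continuous_on_circle_map: "continuous_on S circle_map"
  unfolding circle_map_def by (intro continuous_intros continuous_on_vec_lambda)

lemma real_polynomial_circle_map:
  assumes "real_polynomial_function p" shows "trig_smooth (\<lambda>x. p (circle_map x))"
  using assms
proof (induction rule: real_polynomial_function.induct)
  case (linear f)
  then interpret bounded_linear f .
  have "f (circle_map x) = (\<Sum>i\<in>UNIV. cos (2 * pi * (axis i 1 \<bullet> x)) * f (axis i 1, 0))
      + (\<Sum>i\<in>UNIV. sin (2 * pi * (axis i 1 \<bullet> x)) * f (0, axis i 1))" for x
  proof -
    have "circle_map x = (\<Sum>i\<in>UNIV. cos (2 * pi * x $ i) *\<^sub>R (axis i 1, 0)) + (\<Sum>i\<in>UNIV. sin (2 * pi * x $ i) *\<^sub>R (0, axis i 1))"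
      by (simp add: circle_map_def prod_eq_iff fst_sum snd_sum vec_eq_iff axis_def if_distrib sum.delta' cong: if_cong)
    then show ?thesis
      by (simp only: add sum scaleR real_scaleR_def inner_axis' inner_real_def mult_1)
  qed
  moreover have "axis i 1 $ k \<in> \<int>" for i k :: 3 by (auto simp: axis_def)
  ultimately show ?case by (auto intro!: trig_smooth.intros trig_smooth_sum)
qed (auto intro: trig_smooth.intros)

text \<open>One point has to be interior, since opposite faces have the same image. The faces are a
  null set and are discarded later.\<close>

lemma circle_map_inj:
  assumes "circle_map x = circle_map y" "x \<in> box (\<chi> i. 0) (\<chi> i. 1)" "y \<in> cbox (\<chi> i. 0) (\<chi> i. 1)"
  shows "x = y"
proof -
  have "x $ i = y $ i" for i
  proof -
    have "cos (2 * pi * x $ i) = cos (2 * pi * y $ i)" "sin (2 * pi * x $ i) = sin (2 * pi * y $ i)"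
      using assms(1) by (auto simp: circle_map_def vec_eq_iff)
    then have "\<exists>n::int. 2 * pi * x $ i = 2 * pi * y $ i + 2 * pi * n"
      by (subst sin_cos_eq_iff[symmetric]) auto
    then obtain n :: int where "2 * pi * x $ i = 2 * pi * y $ i + 2 * pi * n" by blast
    then have "2 * pi * (x $ i - y $ i) = 2 * pi * n" by (simp add: right_diff_distrib)
    then have "x $ i - y $ i = n" by simp
    moreover have "0 < x $ i" "x $ i < 1" "0 \<le> y $ i" "y $ i \<le> 1" using assms(2,3) by (auto simp: mem_box_cart)
    ultimately have "real_of_int n < 1" "-1 < real_of_int n" by linarith+
    then have "n = 0" by linarith
    then show ?thesis using \<open>x $ i - y $ i = n\<close> by simp
  qed
  then show ?thesis by (simp add: vec_eq_iff)
qed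

text \<open>A function of \<open>circle_map x\<close> is periodic, so polynomial approximation of continuous functions on
  the image of the unit cell produces periodic test functions.\<close>

lemma compact_indicator_approx:
  fixes K :: "(real^3) set"
  assumes K: "compact K" "K \<noteq> {}" "K \<subseteq> cbox (\<chi> i. 0) (\<chi> i. 1)"
  obtains \<phi> where "\<And>n. torus_smooth (\<phi> n)" "\<And>n x. x \<in> cbox (\<chi> i. 0) (\<chi> i. 1) \<Longrightarrow> \<bar>\<phi> n x\<bar> \<le> 2"
    "\<And>x. x \<in> box (\<chi> i. 0) (\<chi> i. 1) \<Longrightarrow> (\<lambda>n. \<phi> n x) \<longlonglongrightarrow> indicator K x"
proof -
  let ?C = "cbox (\<chi> i. 0) (\<chi> i. 1) :: (real^3) set"
  let ?EK = "circle_map ` K"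
  \<comment> \<open>A bump that is 1 on the compact image and 0 once \<open>n\<close> times the
    distance to it reaches 1.\<close>
  define F where "F n p = max 0 (1 - real n * infdist p ?EK)" for n p
  have cF: "continuous_on S (F n)" for S n
    unfolding F_def by (intro continuous_intros)
  \<comment> \<open>This error tends to 0 and never exceeds 1. Together with a bump between 0 and 1
    it gives the uniform bound 2 that dominated convergence will use.\<close>
  have "\<exists>g. real_polynomial_function g \<and> (\<forall>p\<in>circle_map ` ?C. \<bar>F n p - g p\<bar> < inverse (Suc n))" for n
    using Stone_Weierstrass_real_polynomial_function[OF compact_continuous_image[OF continuous_on_circle_map compact_cbox] cF, of "inverse (Suc n)" _ _ n]
    by (metis inverse_positive_iff_positive of_nat_0_less_iff zero_less_Suc)
  then obtain g where g: "\<And>n. real_polynomial_function (g n)" "\<And>n x. x \<in> ?C \<Longrightarrow> \<bar>F n (circle_map x) - g n (circle_map x)\<bar> < inverse (Suc n)"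
    by (metis imageI)
  have F01: "0 \<le> F n p" "F n p \<le> 1" for n p
    using infdist_nonneg[of p ?EK] by (auto simp: F_def)
  show ?thesis
  proof
    show "torus_smooth (\<lambda>x. g n (circle_map x))" for n
      by (intro trig_smooth_torus_smooth real_polynomial_circle_map g)
    show "\<bar>g n (circle_map x)\<bar> \<le> 2" if "x \<in> ?C" for n x
    proof -
      have "inverse (real (Suc n)) \<le> 1" by (simp add: inverse_le_1_iff)
      then show ?thesis using g(2)[OF that, of n] F01[of n "circle_map x"] by linarith
    qed
    fix x :: "real^3" assume x: "x \<in> box (\<chi> i. 0) (\<chi> i. 1)"
    then have xC: "x \<in> ?C" using box_subset_cbox by blast
    have "(\<lambda>n. F n (circle_map x)) \<longlonglongrightarrow> indicator K x"
    proof (cases "x \<in> K")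
      case True
      then have "infdist (circle_map x) ?EK = 0" by (intro infdist_zero) auto
      then show ?thesis using True by (simp add: F_def)
    next
      case False
      have "circle_map x \<notin> ?EK" using False circle_map_inj[OF _ x] K(3) by blast
      moreover have "closed ?EK" "?EK \<noteq> {}"
        using K by (auto intro!: compact_imp_closed compact_continuous_image continuous_on_circle_map)
      ultimately have d: "infdist (circle_map x) ?EK > 0"
        using infdist_nonneg in_closed_iff_infdist_zero by (metis less_eq_real_def)
      obtain N where N: "1 < real N * infdist (circle_map x) ?EK" using reals_Archimedean3[OF d] by blast
      have "F n (circle_map x) = 0" if "n \<ge> N" for n
      proof -
        have "real N * infdist (circle_map x) ?EK \<le> real n * infdist (circle_map x) ?EK"
          using that d by (intro mult_right_mono) auto
        then show ?thesis using N by (simp add: F_def)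
      qed
      then show ?thesis using False by (auto intro!: tendsto_eventually eventually_sequentiallyI)
    qed
    moreover have "(\<lambda>n. F n (circle_map x) - g n (circle_map x)) \<longlonglongrightarrow> 0"
      by (rule Lim_null_comparison[OF _ LIMSEQ_inverse_real_of_nat])
         (use g(2)[OF xC] in \<open>auto intro!: always_eventually less_imp_le\<close>)
    ultimately have "(\<lambda>n. F n (circle_map x) - (F n (circle_map x) - g n (circle_map x))) \<longlonglongrightarrow> indicator K x - 0"
      by (rule tendsto_diff)
    then show "(\<lambda>n. g n (circle_map x)) \<longlonglongrightarrow> indicator K x" by simp
  qed
qed

text \<open>\<open>ennreal\<close> clips at 0, so \<open>h\<close> and \<open>- h\<close> define the
  densities of the positive and the negative part. The two measures agree on open boxes, which
  generate the Borel sets and are stable under intersection, and densities are unique.\<close>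

lemma AE_eq_0_of_box_integrals:
  fixes h :: "'a::euclidean_space \<Rightarrow> real"
  assumes h: "integrable lborel h" and z: "\<And>l u. (LINT x|lborel. h x * indicator (box l u) x) = 0"
  shows "AE x in lborel. h x = 0"
proof -
  have [measurable]: "h \<in> borel_measurable borel" using h by auto
  have emb: "emeasure (density lborel (\<lambda>x. ennreal (f x))) A = ennreal (LINT x|lborel. max 0 (f x) * indicator A x)"
    if f: "integrable lborel f" and A: "A \<in> sets borel" for f :: "'a \<Rightarrow> real" and A
  proof -
    have [measurable]: "f \<in> borel_measurable borel" using f by auto
    have "integrable lborel (\<lambda>x. max 0 (f x) * indicator A x)"
      using f A by (intro integrable_real_mult_indicator integrable_max) auto
    then have "ennreal (LINT x|lborel. max 0 (f x) * indicator A x) = (\<integral>\<^sup>+x. ennreal (max 0 (f x) * indicator A x) \<partial>lborel)"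
      by (intro nn_integral_eq_integral[symmetric]) auto
    also have "\<dots> = (\<integral>\<^sup>+x. ennreal (f x) * indicator A x \<partial>lborel)"
      by (intro nn_integral_cong) (auto simp: max_def ennreal_neg split: split_indicator)
    finally show ?thesis using A by (simp add: emeasure_density)
  qed
  have "density lborel (\<lambda>x. ennreal (h x)) = density lborel (\<lambda>x. ennreal (- h x))"
  proof (rule measure_eqI_generator_eq)
    let ?E = "range (\<lambda>(a, b). box a b::'a set)"
    show "Int_stable ?E" by (auto simp: Int_stable_def box_Int_box)
    show "?E \<subseteq> Pow UNIV" "sets (density lborel (\<lambda>x. ennreal (h x))) = sigma_sets UNIV ?E"
      "sets (density lborel (\<lambda>x. ennreal (- h x))) = sigma_sets UNIV ?E"
      by (simp_all add: borel_eq_box)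
    let ?A = "\<lambda>n::nat. box (- (real n *\<^sub>R One)) (real n *\<^sub>R One) :: 'a set"
    show "range ?A \<subseteq> ?E" "(\<Union>i. ?A i) = UNIV" unfolding UN_box_eq_UNIV by auto
    show "emeasure (density lborel (\<lambda>x. ennreal (h x))) (?A i) \<noteq> \<infinity>" for i
      by (subst emb[OF h]) auto
    fix X assume "X \<in> ?E"
    then obtain l u where X: "X = box l u" by auto
    have "(LINT x|lborel. max 0 (h x) * indicator X x) - (LINT x|lborel. max 0 (- h x) * indicator X x)
        = (LINT x|lborel. max 0 (h x) * indicator X x - max 0 (- h x) * indicator X x)"
      using h X by (intro Bochner_Integration.integral_diff[symmetric] integrable_real_mult_indicator integrable_max) auto
    also have "\<dots> = (LINT x|lborel. h x * indicator X x)"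
      by (intro Bochner_Integration.integral_cong) (auto simp: max_def split: split_indicator)
    finally show "emeasure (density lborel (\<lambda>x. ennreal (h x))) X = emeasure (density lborel (\<lambda>x. ennreal (- h x))) X"
      using h z X by (subst (1 2) emb) auto
  qed
  then have "AE x in lborel. ennreal (h x) = ennreal (- h x)"
    by (intro sigma_finite_measure.density_unique lborel.sigma_finite_measure_axioms) auto
  then show ?thesis
  proof eventually_elim
    fix x assume e: "ennreal (h x) = ennreal (- h x)"
    show "h x = 0"
    proof (cases "0 \<le> h x")
      case True
      then have "ennreal (h x) = 0" using e by (simp add: ennreal_neg)
      then show ?thesis using True by simp
    next
      case False
      then have "ennreal (- h x) = 0" using e by (simp add: ennreal_neg)
      then show ?thesis using False by simp
    qed
  qed
qed

lemma borel_fst: "fst \<in> borel_measurable (borel :: ('a::topological_space \<times> 'b::topological_space) measure)"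
  and borel_snd: "snd \<in> borel_measurable (borel :: ('a::topological_space \<times> 'b::topological_space) measure)"
  by (intro borel_measurable_continuous_onI continuous_intros)+

lemma AE_torus_interior: "AE x in torus. x \<in> box (\<chi> i. 0) (\<chi> i. 1)"
  unfolding torus_def
  by (subst AE_restrict_space_iff) (auto intro!: AE_I'[of "cbox (\<chi> i. 0) (\<chi> i. 1) - box (\<chi> i. 0) (\<chi> i. 1)"]
    simp: null_sets_cbox_Diff_box)

lemma AE_phase_interior: "AE z in phase. fst z \<in> box (\<chi> i. 0) (\<chi> i. 1)"
proof -
  have "AE x in torus. AE v in vel. fst (x, v) \<in> box (\<chi> i. 0) (\<chi> i. 1)"
    using AE_torus_interior by eventually_elim simp
  moreover have "{z \<in> space phase. fst z \<in> box (\<chi> i. 0) (\<chi> i. 1)} \<in> sets phase"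
    using measurable_sets[OF measurable_phase_borel[OF borel_fst] borel_open[OF open_box]]
    by (simp add: vimage_def Int_def conj_commute)
  ultimately show ?thesis unfolding phase_def by (intro tv.AE_pair_measure) auto
qed

text \<open>The exceptional set of velocities depends on the test function, so no limit may be taken
  at fixed \<open>v\<close>. Each identity is first integrated over a Borel set of velocities; only
  then does the test function tend to the indicator of a compact set.\<close>

lemma weak_null_AE_0:
  assumes g: "g \<in> L2"
    and w: "\<And>\<phi>. torus_smooth \<phi> \<Longrightarrow> AE v in vel. (LINT x|torus. g (x, v) * \<phi> x) = 0"
  shows "AE z in phase. g z = 0"
proof -
  let ?C = "cbox (\<chi> i. 0) (\<chi> i. 1) :: (real^3) set" and ?W = "cbox (\<chi> i. -1/2) (\<chi> i. 1/2) :: (real^3) set"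
  have gi: "integrable phase g" by (rule L2_integrable[OF g])
  have gm [measurable]: "g \<in> borel_measurable phase" using g by (simp add: L2_def)
  have smooth: "(LINT z|phase. g z * (\<phi> (fst z) * indicator A (snd z))) = 0"
    if s: "torus_smooth \<phi>" and A: "A \<in> sets borel" for \<phi> and A :: "(real^3) set"
  proof -
    have c: "continuous_on UNIV \<phi>" using xder_slice(1)[OF torus_smooth_xder[OF s]] by simp
    have m1: "(\<lambda>z. \<phi> (fst z)) \<in> borel_measurable phase" "(\<lambda>z. indicator A (snd z) :: real) \<in> borel_measurable phase"
      using A borel_measurable_continuous_onI[OF c]
      by (auto intro!: measurable_phase_borel measurable_compose[OF borel_fst] measurable_compose[OF borel_snd])
    obtain M where M: "\<And>x. x \<in> space torus \<Longrightarrow> \<bar>\<phi> x\<bar> \<le> M" using continuous_bounded_torus[OF c] by blast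
    have "\<bar>\<phi> (fst z) * indicator A (snd z)\<bar> \<le> \<bar>M\<bar>" if "z \<in> space phase" for z
      using M[of "fst z"] that by (auto simp: space_phase split: split_indicator)
    then have "integrable phase (\<lambda>z. g z * (\<phi> (fst z) * indicator A (snd z)))"
      using m1 by (intro integrable_mult_bounded[OF gi]) auto
    then have "(LINT z|phase. g z * (\<phi> (fst z) * indicator A (snd z))) =
        (LINT v|vel. LINT x|torus. g (x, v) * (\<phi> x * indicator A v))"
      by (subst integral_phase_iterated(1)) auto
    also have "\<dots> = (LINT v|vel. indicator A v * (LINT x|torus. g (x, v) * \<phi> x))"
    proof (intro Bochner_Integration.integral_cong refl)
      fix v
      have "(\<lambda>x. g (x, v) * (\<phi> x * indicator A v)) = (\<lambda>x. indicator A v * (g (x, v) * \<phi> x))"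
        by (simp add: mult_ac)
      then show "(LINT x|torus. g (x, v) * (\<phi> x * indicator A v)) = indicator A v * (LINT x|torus. g (x, v) * \<phi> x)"
        by simp
    qed
    also have "\<dots> = (LINT v|vel. 0)"
    proof (rule integral_cong_AE)
      have "(\<lambda>v. LINT x|torus. g (x, v) * \<phi> x) \<in> borel_measurable vel"
      proof -
        have "(\<lambda>z. g z * \<phi> (fst z)) \<in> borel_measurable (torus \<Otimes>\<^sub>M vel)" using m1 gm unfolding phase_def by auto
        then have "(\<lambda>(v, x). g (x, v) * \<phi> x) \<in> borel_measurable (vel \<Otimes>\<^sub>M torus)"
          by (auto dest: measurable_pair_swap simp: case_prod_beta')
        then show ?thesis by (rule torus.borel_measurable_lebesgue_integral)
      qed
      then show "(\<lambda>v. indicator A v * (LINT x|torus. g (x, v) * \<phi> x)) \<in> borel_measurable vel"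
        using A by (intro borel_measurable_times) (auto intro: measurable_vel_borel)
      show "AE v in vel. indicator A v * (LINT x|torus. g (x, v) * \<phi> x) = 0"
        using w[OF s] by eventually_elim simp
    qed simp
    finally show ?thesis by simp
  qed
  have compact: "(LINT z|phase. g z * (indicator K (fst z) * indicator A (snd z))) = 0"
    if K: "compact K" "K \<subseteq> ?C" and A: "A \<in> sets borel" for K and A :: "(real^3) set"
  proof (cases "K = {}")
    case False
    obtain \<phi> where \<phi>: "\<And>n. torus_smooth (\<phi> n)" "\<And>n x. x \<in> ?C \<Longrightarrow> \<bar>\<phi> n x\<bar> \<le> 2"
      "\<And>x. x \<in> box (\<chi> i. 0) (\<chi> i. 1) \<Longrightarrow> (\<lambda>n. \<phi> n x) \<longlonglongrightarrow> indicator K x"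
      using compact_indicator_approx[OF K(1) False K(2)] by blast
    have m1: "(\<lambda>z. \<phi> n (fst z)) \<in> borel_measurable phase" for n
    proof -
      have c: "continuous_on UNIV (\<phi> n)" using xder_slice(1)[OF torus_smooth_xder[OF \<phi>(1)]] by simp
      then show ?thesis by (auto intro!: measurable_phase_borel borel_measurable_continuous_onI continuous_on_compose2[OF c] continuous_intros)
    qed
    have m2: "(\<lambda>z. indicator A (snd z) :: real) \<in> borel_measurable phase" "(\<lambda>z. indicator K (fst z) :: real) \<in> borel_measurable phase"
      using A borel_closed[OF compact_imp_closed[OF K(1)]]
      by (auto intro!: measurable_phase_borel measurable_compose[OF borel_snd] measurable_compose[OF borel_fst])
    have "(\<lambda>n. LINT z|phase. g z * (\<phi> n (fst z) * indicator A (snd z))) \<longlonglongrightarrow> (LINT z|phase. g z * (indicator K (fst z) * indicator A (snd z)))"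
    proof (rule integral_dominated_convergence[where w="\<lambda>z. \<bar>g z\<bar> * 2"])
      show "integrable phase (\<lambda>z. \<bar>g z\<bar> * 2)" using gi by auto
      show "AE z in phase. (\<lambda>n. g z * (\<phi> n (fst z) * indicator A (snd z))) \<longlonglongrightarrow> g z * (indicator K (fst z) * indicator A (snd z))"
        using AE_phase_interior by eventually_elim (intro tendsto_intros \<phi>(3))
      show "AE z in phase. norm (g z * (\<phi> n (fst z) * indicator A (snd z))) \<le> \<bar>g z\<bar> * 2" for n
      proof (rule AE_I2)
        fix z assume "z \<in> space phase"
        then have "\<bar>\<phi> n (fst z)\<bar> \<le> 2" by (intro \<phi>(2)) (simp add: space_phase space_torus mem_Times_iff)
        then have "\<bar>\<phi> n (fst z) * indicator A (snd z)\<bar> \<le> 2" by (auto split: split_indicator)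
        then show "norm (g z * (\<phi> n (fst z) * indicator A (snd z))) \<le> \<bar>g z\<bar> * 2"
          unfolding real_norm_def abs_mult[of "g z"] by (rule mult_left_mono) simp
      qed
    qed (use m1 m2 in auto)
    then show ?thesis using smooth[OF \<phi>(1) A] by (simp add: LIMSEQ_const_iff)
  qed simp
  \<comment> \<open>Extension by zero turns integrals over \<open>phase\<close> into Lebesgue
    integrals on the whole space, where boxes generate.\<close>
  define h where "h z = g z * indicator (?C \<times> ?W) z" for z
  have CW: "?C \<times> ?W \<in> sets borel" by (intro borel_closed closed_Times closed_cbox)
  have hi: "integrable lborel h"
    using gi CW unfolding phase_eq h_def by (subst (asm) integrable_restrict_space) (auto simp: mult.commute)
  have phase_h: "(LINT z|phase. g z * f z) = (LINT z|lborel. h z * f z)" for f :: "_ \<Rightarrow> real"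
    using CW unfolding phase_eq h_def by (subst integral_restrict_space) (auto intro!: Bochner_Integration.integral_cong)
  have "AE z in lborel. h z = 0"
  proof (rule AE_eq_0_of_box_integrals[OF hi])
    fix l u :: "(real^3) \<times> (real^3)"
    obtain l1 l2 u1 u2 where lu: "l = (l1, l2)" "u = (u1, u2)" by (cases l, cases u)
    let ?A = "box l2 u2"
    have b: "box l u = box l1 u1 \<times> ?A" unfolding lu by (auto simp: box_def Basis_prod_def ball_Un)
    have K: "compact (?C - box l1 u1)" by (intro compact_diff) auto
    \<comment> \<open>An open box is not compact, but within the cell its indicator is the
      difference of those of two compact sets: the cell, and the cell without the box.\<close>
    have "(LINT z|lborel. h z * indicator (box l u) z) = (LINT z|phase. g z * (indicator ?C (fst z) * indicator ?A (snd z)) - g z * (indicator (?C - box l1 u1) (fst z) * indicator ?A (snd z)))"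
      unfolding phase_h[symmetric] b
      by (intro Bochner_Integration.integral_cong) (auto simp: space_phase space_torus split: split_indicator)
    also have "\<dots> = (LINT z|phase. g z * (indicator ?C (fst z) * indicator ?A (snd z))) - (LINT z|phase. g z * (indicator (?C - box l1 u1) (fst z) * indicator ?A (snd z)))"
    proof (rule Bochner_Integration.integral_diff)
      have "integrable phase (\<lambda>z. g z * (indicator B (fst z) * indicator ?A (snd z)))" if "B \<in> sets borel" for B
      proof (rule integrable_mult_bounded[OF gi, of _ 1])
        show "(\<lambda>z. indicator B (fst z) * indicator ?A (snd z) :: real) \<in> borel_measurable phase"
          using that
          by (auto intro!: borel_measurable_times measurable_phase_borel measurable_compose[OF borel_snd] measurable_compose[OF borel_fst])
      qed (auto split: split_indicator)
      then show "integrable phase (\<lambda>z. g z * (indicator ?C (fst z) * indicator ?A (snd z)))"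
        "integrable phase (\<lambda>z. g z * (indicator (?C - box l1 u1) (fst z) * indicator ?A (snd z)))"
        using compact_imp_closed[OF K] by (auto intro: borel_closed)
    qed
    also have "\<dots> = 0" using compact[OF K, of ?A] compact[of ?C ?A] by simp
    finally show "(LINT z|lborel. h z * indicator (box l u) z) = 0" .
  qed
  then have "AE z in lborel. z \<in> ?C \<times> ?W \<longrightarrow> g z = 0"
    by eventually_elim (auto simp: h_def indicator_eq_0_iff)
  then show ?thesis unfolding phase_eq using CW by (subst AE_restrict_space_iff) auto
qed

lemma AE_integrable_slice:
  fixes f :: "_ \<Rightarrow> real"
  assumes "integrable phase f"
  shows "AE v in vel. integrable torus (\<lambda>x. f (x, v))" "AE x in torus. integrable vel (\<lambda>v. f (x, v))"
proof -
  interpret vt: pair_sigma_finite vel torus ..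
  show "AE x in torus. integrable vel (\<lambda>v. f (x, v))"
    using tv.AE_integrable_fst'[of f] assms by (simp add: phase_def)
  have "integrable (vel \<Otimes>\<^sub>M torus) (\<lambda>(x, y). f (y, x))"
    using tv.integrable_product_swap[of f] assms by (simp add: phase_def)
  from vt.AE_integrable_fst'[OF this] show "AE v in vel. integrable torus (\<lambda>x. f (x, v))" by simp
qed

lemma integrable_torus_mult_continuous:
  fixes f :: "_ \<Rightarrow> real"
  assumes f: "integrable torus f" and c: "continuous_on UNIV \<phi>"
  shows "integrable torus (\<lambda>x. f x * \<phi> x)"
proof -
  obtain M where "\<And>x. x \<in> space torus \<Longrightarrow> \<bar>\<phi> x\<bar> \<le> M" using continuous_bounded_torus[OF c] by blast
  then show ?thesis
    using f measurable_torus_borel[OF borel_measurable_continuous_onI[OF c]] by (intro integrable_mult_bounded) auto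
qed

lemma weak_deriv_unique:
  assumes g: "g \<in> L2" "g' \<in> L2" and w: "weak_deriv_x j h g" "weak_deriv_x j h g'"
  shows "AE z in phase. g z = g' z"
proof -
  have "AE z in phase. g z - g' z = 0"
  proof (rule weak_null_AE_0[OF L2_diff[OF g]])
    fix \<phi> assume s: "torus_smooth \<phi>"
    then have c: "continuous_on UNIV \<phi>" using xder_slice(1)[OF torus_smooth_xder[OF s]] by simp
    have "AE v in vel. (LINT x|torus. h (x, v) * pd j \<phi> x) = - (LINT x|torus. g (x, v) * \<phi> x)"
      "AE v in vel. (LINT x|torus. h (x, v) * pd j \<phi> x) = - (LINT x|torus. g' (x, v) * \<phi> x)"
      using w s by (auto simp: weak_deriv_x_def)
    with AE_integrable_slice(1)[OF L2_integrable[OF g(1)]] AE_integrable_slice(1)[OF L2_integrable[OF g(2)]]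
    show "AE v in vel. (LINT x|torus. (g (x, v) - g' (x, v)) * \<phi> x) = 0"
      by eventually_elim (simp add: left_diff_distrib integrable_torus_mult_continuous c)
  qed
  then show ?thesis by simp
qed

lemma dx_H1:
  assumes "h \<in> H1" shows "dx j h \<in> L2" "weak_deriv_x j h (dx j h)"
  using assms someI_ex[of "\<lambda>g. g \<in> L2 \<and> weak_deriv_x j h g"] unfolding H1_def dx_def by auto

lemma H1_xder: "(\<And>j. xder j h (D j)) \<Longrightarrow> h \<in> H1"
  unfolding H1_def using xder_L2 xder_weak_deriv by blast

lemma dx_xder:
  assumes "xder j h h'" shows "dx j h \<in> L2" "AE z in phase. dx j h z = h' z"
proof -
  have *: "dx j h \<in> L2 \<and> weak_deriv_x j h (dx j h)"
    unfolding dx_def using someI[of "\<lambda>g. g \<in> L2 \<and> weak_deriv_x j h g" h'] xder_L2[OF assms] xder_weak_deriv[OF assms] by blast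
  then show "dx j h \<in> L2" by simp
  show "AE z in phase. dx j h z = h' z"
    using * weak_deriv_unique xder_L2(2)[OF assms] xder_weak_deriv[OF assms] by blast
qed

section \<open>The inner product behind the X norm\<close>

definition ip :: "density \<Rightarrow> density \<Rightarrow> real" where
  "ip f g = (LINT z|phase. f z * g z)"

lemma ip_cong_AE:
  assumes "AE z in phase. f z = f' z" "f \<in> borel_measurable phase" "f' \<in> borel_measurable phase" "g \<in> borel_measurable phase"
  shows "ip f g = ip f' g"
  unfolding ip_def using assms by (intro integral_cong_AE) auto

lemma X_norm_xder:
  assumes "\<And>j. xder j h (D j)"
  shows "(X_norm h)\<^sup>2 = ip h h + (\<Sum>j\<in>UNIV. ip (D j) (D j))"
proof -
  have "(LINT z|phase. (dx j h z)\<^sup>2) = ip (D j) (D j)" for j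
    unfolding ip_def power2_eq_square
    using dx_xder[OF assms, of j] xder_L2(2)[OF assms, of j]
    by (intro integral_cong_AE) (auto simp: L2_def)
  then show ?thesis
    unfolding X_norm_def ip_def power2_eq_square[symmetric]
    by (subst real_sqrt_pow2) (auto intro!: add_nonneg_nonneg sum_nonneg)
qed

section \<open>The truncation as a Fourier projection\<close>

definition cs :: "(real^3) \<times> (real^3) \<Rightarrow> density" where
  "cs \<sigma> z = cos (2 * pi * (\<sigma> \<bullet> z))"

definition sn :: "(real^3) \<times> (real^3) \<Rightarrow> density" where
  "sn \<sigma> z = sin (2 * pi * (\<sigma> \<bullet> z))"

text \<open>For a symmetric \<open>S\<close> the terms at \<open>\<sigma>\<close> and
  \<open>- \<sigma>\<close> are equal. This doubling is the factor 2 of a real Fourier series, and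
  the zero frequency, occurring once, gets the right weight without a case distinction.\<close>

definition truncation :: "((real^3) \<times> (real^3)) set \<Rightarrow> density \<Rightarrow> density" where
  "truncation S h z = (\<Sum>\<sigma>\<in>S. ip h (cs \<sigma>) * cs \<sigma> z + ip h (sn \<sigma>) * sn \<sigma> z)"

definition freqs :: "real \<Rightarrow> ((real^3) \<times> (real^3)) set" where
  "freqs R = freq ` {m. norm (freq m) < R} \<times> freq ` {k. \<forall>i. real_of_int \<bar>k $ i\<bar> < R}"

lemma finite_int_less: "finite {m::int. real_of_int \<bar>m\<bar> < R}"
proof (rule finite_subset)
  show "{m::int. real_of_int \<bar>m\<bar> < R} \<subseteq> {- \<lceil>R\<rceil>..\<lceil>R\<rceil>}"
  proof
    fix m :: int assume "m \<in> {m. real_of_int \<bar>m\<bar> < R}"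
    then have "\<bar>m\<bar> \<le> \<lceil>R\<rceil>" by (simp add: le_ceiling_iff)
    then show "m \<in> {- \<lceil>R\<rceil>..\<lceil>R\<rceil>}" by auto
  qed
qed (rule finite_atLeastAtMost_int)

lemma finite_int_vec_less: "finite {k::int^3. \<forall>i. real_of_int \<bar>k $ i\<bar> < R}"
proof (rule finite_imageD)
  show "finite (vec_nth ` {k::int^3. \<forall>i. real_of_int \<bar>k $ i\<bar> < R})"
    by (rule finite_subset[OF _ finite_PiE[of UNIV "\<lambda>_. {m::int. real_of_int \<bar>m\<bar> < R}"]])
       (auto simp: finite_int_less[simplified])
qed (auto simp: inj_on_def vec_nth_inject)

lemma finite_norm_freq_less: "finite {m. norm (freq m) < R}"
proof (rule finite_subset[OF _ finite_int_vec_less[of R]], safe)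
  fix m :: "int^3" and i assume "norm (freq m) < R"
  moreover have "\<bar>freq m $ i\<bar> \<le> norm (freq m)" by (rule component_le_norm_cart)
  ultimately show "real_of_int \<bar>m $ i\<bar> < R" by (simp add: freq_def)
qed

lemma inj_freq: "inj freq" by (auto simp: inj_def freq_def vec_eq_iff)

lemma freqs_finite: "finite (freqs R)"
  unfolding freqs_def by (intro finite_SigmaI finite_imageI finite_norm_freq_less finite_int_vec_less)

lemma freqs_Ints: "\<sigma> \<in> freqs R \<Longrightarrow> fst \<sigma> $ i \<in> \<int> \<and> snd \<sigma> $ i \<in> \<int>"
  by (auto simp: freqs_def freq_def)

lemma freq_uminus: "freq (- m) = - freq m"
  by (auto simp: freq_def vec_eq_iff)

lemma freqs_uminus: "\<sigma> \<in> freqs R \<Longrightarrow> - \<sigma> \<in> freqs R"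
  unfolding freqs_def
  by (auto simp: freq_uminus[symmetric] simp del: freq_uminus intro!: imageI) (simp_all add: freq_uminus)

text \<open>\<open>f\<close> is real, so the real part passes under the integral and leaves the
  cosine of a phase difference: a truncated series becomes integration against a kernel. Used for
  the velocity and the position variable.\<close>

lemma re_truncated_sum:
  fixes f :: "'a \<Rightarrow> real"
  assumes f: "integrable M f" and S: "finite S" and \<theta>: "\<And>m. m \<in> S \<Longrightarrow> \<theta> m \<in> borel_measurable M"
  shows "Re (\<Sum>m\<in>S. (LINT y|M. complex_of_real (f y) * cis (- \<theta> m y)) * cis (\<phi> m)) =
    (LINT y|M. f y * (\<Sum>m\<in>S. cos (\<phi> m - \<theta> m y)))"
proof -
  have int: "integrable M (\<lambda>y. f y * cos (\<phi> m - \<theta> m y))" if m: "m \<in> S" for m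
  proof (rule Bochner_Integration.integrable_bound[OF f])
    show "(\<lambda>y. f y * cos (\<phi> m - \<theta> m y)) \<in> borel_measurable M"
      using f \<theta>[OF m] by (intro borel_measurable_times measurable_compose[OF _ borel_measurable_cos]) auto
  qed (auto simp: abs_mult mult_left_le)
  have "Re ((LINT y|M. complex_of_real (f y) * cis (- \<theta> m y)) * cis (\<phi> m)) = (LINT y|M. f y * cos (\<phi> m - \<theta> m y))"
    if m: "m \<in> S" for m
  proof -
    have mc: "(\<lambda>y. cis (- \<theta> m y)) \<in> borel_measurable M"
      unfolding cis_conv_exp using \<theta>[OF m]
      by (intro measurable_compose[OF _ borel_measurable_continuous_onI[OF continuous_on_exp[OF continuous_on_id]]]) auto
    have i: "integrable M (\<lambda>y. complex_of_real (f y) * cis (- \<theta> m y))"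
    proof (rule Bochner_Integration.integrable_bound[OF f])
      show "(\<lambda>y. complex_of_real (f y) * cis (- \<theta> m y)) \<in> borel_measurable M"
        using f mc by (intro borel_measurable_times) auto
    qed (auto simp: norm_mult)
    have "(LINT y|M. complex_of_real (f y) * cis (- \<theta> m y)) * cis (\<phi> m) = (LINT y|M. complex_of_real (f y) * cis (- \<theta> m y) * cis (\<phi> m))"
      using i by simp
    also have "Re \<dots> = (LINT y|M. Re (complex_of_real (f y) * cis (- \<theta> m y) * cis (\<phi> m)))"
      by (rule integral_Re[symmetric]) (use i in simp)
    also have "\<dots> = (LINT y|M. f y * cos (\<phi> m - \<theta> m y))"
      by (intro Bochner_Integration.integral_cong refl) (simp add: cis_mult mult.assoc)
    finally show ?thesis .
  qed
  then have "Re (\<Sum>m\<in>S. (LINT y|M. complex_of_real (f y) * cis (- \<theta> m y)) * cis (\<phi> m)) =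
      (\<Sum>m\<in>S. (LINT y|M. f y * cos (\<phi> m - \<theta> m y)))" by simp
  also have "\<dots> = (LINT y|M. (\<Sum>m\<in>S. f y * cos (\<phi> m - \<theta> m y)))"
    using int by (intro Bochner_Integration.integral_sum[symmetric]) auto
  finally show ?thesis by (simp add: sum_distrib_left)
qed

section \<open>Dirichlet kernels for the nested truncations\<close>

definition dirichlet :: "real \<Rightarrow> real \<Rightarrow> real" where
  "dirichlet R s = (\<Sum>m\<in>{m::int. real_of_int \<bar>m\<bar> < R}. cos (2 * pi * real_of_int m * s))"

lemma trunc1_ival: "trunc1 R g y = Re (\<Sum>m\<in>{m::int. real_of_int \<bar>m\<bar> < R}.
     (LINT w|ival (-1/2). complex_of_real (g w) * cis (- (2 * pi * real_of_int m * w)))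
       * cis (2 * pi * real_of_int m * y))"
proof -
  have "(LINT w:{-1/2..1/2}|lborel. F w) = (LINT w|ival (-1/2). F w)" for F :: "real \<Rightarrow> complex"
    unfolding ival_def set_lebesgue_integral_def by (subst integral_restrict_space) auto
  then show ?thesis by (simp add: trunc1_def)
qed

lemma trunc1_dirichlet:
  assumes "integrable (ival (-1/2)) g"
  shows "trunc1 R g y = (LINT w|ival (-1/2). g w * dirichlet R (y - w))"
proof -
  have "trunc1 R g y = (LINT w|ival (-1/2). g w * (\<Sum>m\<in>{m::int. real_of_int \<bar>m\<bar> < R}. cos (2 * pi * real_of_int m * y - 2 * pi * real_of_int m * w)))"
    unfolding trunc1_ival
    by (rule re_truncated_sum[OF assms finite_int_less]) (auto intro!: measurable_ival_borel)
  then show ?thesis by (simp add: dirichlet_def right_diff_distrib)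
qed

lemma measurable_trunc1:
  assumes f: "(\<lambda>(x, a). f x a) \<in> borel_measurable (M \<Otimes>\<^sub>M ival (-1/2))"
  shows "(\<lambda>x. trunc1 R (f x) y) \<in> borel_measurable M"
proof -
  have "(\<lambda>x. LINT w|ival (-1/2). complex_of_real (f x w) * cis (- (2 * pi * real_of_int m * w))) \<in> borel_measurable M" for m
  proof (rule ival.borel_measurable_lebesgue_integral)
    have "(\<lambda>w. cis (- (2 * pi * real_of_int m * w))) \<in> borel_measurable (ival (-1/2))"
      by (intro measurable_ival_borel borel_measurable_continuous_onI continuous_intros)
    then show "(\<lambda>(x, w). complex_of_real (f x w) * cis (- (2 * pi * real_of_int m * w))) \<in> borel_measurable (M \<Otimes>\<^sub>M ival (-1/2))"
      using f by (auto simp: case_prod_beta' intro!: borel_measurable_times)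
  qed
  then show ?thesis unfolding trunc1_ival by auto
qed

lemma continuous_dirichlet: "continuous_on S (dirichlet R)"
  unfolding dirichlet_def by (intro continuous_intros)

lemma dirichlet_bound: "\<bar>dirichlet R s\<bar> \<le> card {m::int. real_of_int \<bar>m\<bar> < R}"
proof -
  have "\<bar>dirichlet R s\<bar> \<le> (\<Sum>m\<in>{m::int. real_of_int \<bar>m\<bar> < R}. \<bar>cos (2 * pi * real_of_int m * s)\<bar>)"
    unfolding dirichlet_def by (rule sum_abs)
  also have "\<dots> \<le> (\<Sum>m\<in>{m::int. real_of_int \<bar>m\<bar> < R}. 1)" by (intro sum_mono) simp
  finally show ?thesis by simp
qed

lemma measurable_dirichlet: "f \<in> borel_measurable M \<Longrightarrow> (\<lambda>x. dirichlet R (f x)) \<in> borel_measurable M"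
  by (rule measurable_compose[OF _ borel_measurable_continuous_onI[OF continuous_dirichlet]])

lemma measurable_ival_id: "(\<lambda>x. x) \<in> borel_measurable (ival a)"
  by (rule measurable_ival_borel) simp

text \<open>The kernel formula requires an integrable slice, hence holds for almost every parameter
  only. Since \<open>trunc1\<close> is measurable in all parameters, integrability still passes from
  the kernel form to it.\<close>

lemma trunc1_AE:
  assumes M: "finite_measure M" and q: "integrable (M \<Otimes>\<^sub>M ival (-1/2)) q"
  shows "AE x in M. trunc1 R (\<lambda>a. q (x, a)) y = (LINT a|ival (-1/2). q (x, a) * dirichlet R (y - a))"
    and "integrable M (\<lambda>x. LINT a|ival (-1/2). q (x, a) * dirichlet R (y - a))"
    and "integrable M (\<lambda>x. trunc1 R (\<lambda>a. q (x, a)) y)"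
proof -
  interpret M: finite_measure M by fact
  interpret MI: pair_sigma_finite M "ival (-1/2)" ..
  show 1: "AE x in M. trunc1 R (\<lambda>a. q (x, a)) y = (LINT a|ival (-1/2). q (x, a) * dirichlet R (y - a))"
    using MI.AE_integrable_fst'[OF q] by eventually_elim (rule trunc1_dirichlet)
  have "integrable (M \<Otimes>\<^sub>M ival (-1/2)) (\<lambda>z. q z * dirichlet R (y - snd z))"
    by (rule integrable_mult_bounded[OF q _ dirichlet_bound])
       (intro measurable_dirichlet borel_measurable_diff borel_measurable_const measurable_compose[OF measurable_snd measurable_ival_id])
  from MI.integrable_fst'[OF this]
  show 2: "integrable M (\<lambda>x. LINT a|ival (-1/2). q (x, a) * dirichlet R (y - a))" by simp
  show "integrable M (\<lambda>x. trunc1 R (\<lambda>a. q (x, a)) y)"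
    using 2 by (rule Bochner_Integration.integrable_cong_AE_imp) (use 1 q in \<open>auto intro!: measurable_trunc1 simp: case_prod_eta\<close>)
qed

definition dirichlet3 :: "real \<Rightarrow> real^3 \<Rightarrow> real" where
  "dirichlet3 R s = (\<Prod>i\<in>UNIV. dirichlet R (s $ i))"

lemma dirichlet3_3: "dirichlet3 R s = dirichlet R (s $ 1) * dirichlet R (s $ 2) * dirichlet R (s $ 3)"
  unfolding dirichlet3_def UNIV_3 by (simp add: mult.assoc)

text \<open>Each inner kernel formula holds for almost every outer variable, which suffices under
  the next integral; Fubini then collapses the nest. The order \<open>place 3 2\<close> makes the
  first coordinate, truncated first, the innermost one.\<close>

lemma trunc1_triple:
  assumes H: "integrable vel H"
  shows "trunc1 R (\<lambda>c. trunc1 R (\<lambda>b. trunc1 R (\<lambda>a. H (place 3 2 (c, b, a))) (v $ 1)) (v $ 2)) (v $ 3) =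
    (LINT w|vel. H w * dirichlet3 R (v - w))"
proof -
  let ?I = "ival (-1/2)" and ?D = "dirichlet R"
  define Q where "Q z = H (place 3 2 z)" for z
  have s2: "finite_measure (?I \<Otimes>\<^sub>M ?I)" by (intro finite_measure_pair_measure ival.finite_measure_axioms)
  interpret I2: finite_measure "?I \<Otimes>\<^sub>M ?I" by (rule s2)
  interpret I3: pair_sigma_finite ?I "?I \<Otimes>\<^sub>M ?I" ..
  have Q: "integrable (?I \<Otimes>\<^sub>M (?I \<Otimes>\<^sub>M ?I)) Q"
    unfolding Q_def by (rule integrable_cube_place[of 3 2 1]) (use H in \<open>simp_all add: vel_eq\<close>)
  have mI: "(\<lambda>z. ?D (y - fst z)) \<in> borel_measurable (?I \<Otimes>\<^sub>M N)" "(\<lambda>z. ?D (y - snd z)) \<in> borel_measurable (N' \<Otimes>\<^sub>M ?I)"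
    for y and N :: "'n measure" and N' :: "'m measure"
    by (intro measurable_dirichlet borel_measurable_diff borel_measurable_const
        measurable_compose[OF measurable_snd measurable_ival_id] measurable_compose[OF measurable_fst measurable_ival_id])+
  define QD where "QD z = Q z * ?D (v$1 - snd (snd z)) * ?D (v$2 - fst (snd z))" for z
  have QD: "integrable (?I \<Otimes>\<^sub>M (?I \<Otimes>\<^sub>M ?I)) QD"
    unfolding QD_def
    by (intro integrable_mult_bounded[OF _ _ dirichlet_bound] Q measurable_compose[OF measurable_snd mI(1)] measurable_compose[OF measurable_snd mI(2)])
  have inner: "AE c in ?I. trunc1 R (\<lambda>b. trunc1 R (\<lambda>a. Q (c, b, a)) (v $ 1)) (v $ 2) = (LINT z|(?I \<Otimes>\<^sub>M ?I). QD (c, z))"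
    using I3.AE_integrable_fst'[OF Q]
  proof eventually_elim
    fix c assume i: "integrable (?I \<Otimes>\<^sub>M ?I) (\<lambda>z. Q (c, z))"
    note t = trunc1_AE[OF ival.finite_measure_axioms i, where R=R and y="v $ 1"]
    have "trunc1 R (\<lambda>b. trunc1 R (\<lambda>a. Q (c, b, a)) (v $ 1)) (v $ 2) = (LINT b|?I. trunc1 R (\<lambda>a. Q (c, b, a)) (v $ 1) * ?D (v $ 2 - b))"
      by (rule trunc1_dirichlet[OF t(3)])
    also have "\<dots> = (LINT b|?I. (LINT a|?I. Q (c, b, a) * ?D (v $ 1 - a)) * ?D (v $ 2 - b))"
      using t by (intro integral_cong_AE borel_measurable_times measurable_dirichlet borel_measurable_diff borel_measurable_const measurable_ival_id
        borel_measurable_integrable) auto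
    also have "\<dots> = (LINT b|?I. LINT a|?I. QD (c, b, a))"
      by (simp add: QD_def)
    also have "\<dots> = (LINT z|(?I \<Otimes>\<^sub>M ?I). QD (c, z))"
    proof (rule ival2.integral_fst')
      show "integrable (?I \<Otimes>\<^sub>M ?I) (\<lambda>z. QD (c, z))"
        unfolding QD_def fst_conv snd_conv by (intro integrable_mult_bounded[OF _ _ dirichlet_bound] i mI)
    qed
    finally show "trunc1 R (\<lambda>b. trunc1 R (\<lambda>a. Q (c, b, a)) (v $ 1)) (v $ 2) = (LINT z|(?I \<Otimes>\<^sub>M ?I). QD (c, z))" .
  qed
  have Qm: "(\<lambda>(x, a). Q (fst x, snd x, a)) \<in> borel_measurable ((?I \<Otimes>\<^sub>M ?I) \<Otimes>\<^sub>M ?I)"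
    using borel_measurable_integrable[OF Q] by (auto simp: case_prod_beta')
  have m: "(\<lambda>c. trunc1 R (\<lambda>b. trunc1 R (\<lambda>a. Q (c, b, a)) (v $ 1)) (v $ 2)) \<in> borel_measurable ?I"
    using measurable_trunc1[OF Qm, of R "v $ 1"]
    by (intro measurable_trunc1) (simp add: case_prod_beta')
  have ic: "integrable ?I (\<lambda>c. LINT z|(?I \<Otimes>\<^sub>M ?I). QD (c, z))" by (rule I3.integrable_fst'[OF QD])
  have ir: "integrable ?I (\<lambda>c. trunc1 R (\<lambda>b. trunc1 R (\<lambda>a. Q (c, b, a)) (v $ 1)) (v $ 2))"
    using ic by (rule Bochner_Integration.integrable_cong_AE_imp[OF _ m]) (use inner in auto)
  have "trunc1 R (\<lambda>c. trunc1 R (\<lambda>b. trunc1 R (\<lambda>a. Q (c, b, a)) (v $ 1)) (v $ 2)) (v $ 3)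
     = (LINT c|?I. trunc1 R (\<lambda>b. trunc1 R (\<lambda>a. Q (c, b, a)) (v $ 1)) (v $ 2) * ?D (v $ 3 - c))"
    by (rule trunc1_dirichlet[OF ir])
  also have "\<dots> = (LINT c|?I. (LINT z|(?I \<Otimes>\<^sub>M ?I). QD (c, z)) * ?D (v $ 3 - c))"
    using inner m ic by (intro integral_cong_AE borel_measurable_times measurable_dirichlet borel_measurable_diff borel_measurable_const measurable_ival_id
        borel_measurable_integrable[OF ic]) auto
  also have "\<dots> = (LINT c|?I. LINT z|(?I \<Otimes>\<^sub>M ?I). QD (c, z) * ?D (v $ 3 - fst (c, z)))" by simp
  also have "\<dots> = (LINT z|(?I \<Otimes>\<^sub>M (?I \<Otimes>\<^sub>M ?I)). QD z * ?D (v $ 3 - fst z))"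
    by (rule I3.integral_fst') (intro integrable_mult_bounded[OF _ _ dirichlet_bound] QD mI)
  also have "\<dots> = (LINT z|(?I \<Otimes>\<^sub>M (?I \<Otimes>\<^sub>M ?I)). (\<lambda>w. H w * dirichlet3 R (v - w)) (place 3 2 z))"
  proof (intro Bochner_Integration.integral_cong refl)
    fix z :: "real \<times> real \<times> real"
    obtain c b a where z: "z = (c, b, a)" by (cases z)
    show "QD z * ?D (v $ 3 - fst z) = H (place 3 2 z) * dirichlet3 R (v - place 3 2 z)"
      unfolding z QD_def Q_def dirichlet3_3 by (simp add: place_def)
  qed
  also have "\<dots> = (LINT w|vel. H w * dirichlet3 R (v - w))"
    unfolding vel_eq
  proof (rule integral_cube_place[of 3 2 1, symmetric])
    have "(\<lambda>w. dirichlet3 R (v - w)) \<in> borel_measurable (cube (-1/2))"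
      unfolding dirichlet3_def
      by (intro measurable_cube_borel borel_measurable_continuous_onI continuous_intros continuous_on_compose2[OF continuous_dirichlet]) auto
    then show "(\<lambda>w. H w * dirichlet3 R (v - w)) \<in> borel_measurable (cube (-1/2))"
      using H by (auto simp: vel_eq)
  qed simp_all
  finally show ?thesis by (simp add: Q_def)
qed

lemma Lam_v_place:
  "Lam_v \<epsilon> \<gamma> h (x, v) = trunc1 (\<epsilon> powr - \<gamma>) (\<lambda>c. trunc1 (\<epsilon> powr - \<gamma>) (\<lambda>b. trunc1 (\<epsilon> powr - \<gamma>)
     (\<lambda>a. h (x, place 3 2 (c, b, a))) (v $ 1)) (v $ 2)) (v $ 3)"
proof -
  have "(\<chi> k. if k = 1 then a else (\<chi> k. if k = 2 then b else (\<chi> k. if k = 3 then c else v $ k) $ k) $ k) = place 3 2 (c, b, a)"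
    for a b c by (auto simp: vec_eq_iff forall_3 place_def)
  then show ?thesis unfolding Lam_v_def Lam_vj_def by simp
qed

lemma Lam_v_eq:
  assumes "integrable vel (\<lambda>w. h (x, w))"
  shows "Lam_v \<epsilon> \<gamma> h (x, v) = (LINT w|vel. h (x, w) * dirichlet3 (\<epsilon> powr - \<gamma>) (v - w))"
  unfolding Lam_v_place by (rule trunc1_triple[OF assms])

text \<open>The kernel formula describes this function only almost everywhere. To inherit
  integrability from it, the function must be measurable as it is defined, default values on bad
  slices included.\<close>

lemma measurable_Lam_v_slice:
  assumes h: "h \<in> borel_measurable phase"
  shows "(\<lambda>y. Lam_v \<epsilon> \<gamma> h (y, v)) \<in> borel_measurable torus"
proof -
  let ?I = "ival (-1/2)"
  have pl: "(\<lambda>z. place 3 2 (snd (fst (fst z)), snd (fst z), snd z)) \<in> measurable (((torus \<Otimes>\<^sub>M ?I) \<Otimes>\<^sub>M ?I) \<Otimes>\<^sub>M ?I) vel"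
    unfolding vel_eq by (rule measurable_compose[OF _ measurable_place[of 3 2 1]]) simp_all
  have "(\<lambda>z. h (fst (fst (fst z)), place 3 2 (snd (fst (fst z)), snd (fst z), snd z))) \<in> borel_measurable (((torus \<Otimes>\<^sub>M ?I) \<Otimes>\<^sub>M ?I) \<Otimes>\<^sub>M ?I)"
    using h pl unfolding phase_def by (intro measurable_compose[OF _ h[unfolded phase_def]] measurable_Pair) simp_all
  then have "(\<lambda>z. trunc1 (\<epsilon> powr - \<gamma>) (\<lambda>a. h (fst (fst z), place 3 2 (snd (fst z), snd z, a))) (v $ 1)) \<in> borel_measurable ((torus \<Otimes>\<^sub>M ?I) \<Otimes>\<^sub>M ?I)"
    by (intro measurable_trunc1) (simp add: case_prod_beta')
  then have "(\<lambda>z. trunc1 (\<epsilon> powr - \<gamma>) (\<lambda>b. trunc1 (\<epsilon> powr - \<gamma>) (\<lambda>a. h (fst z, place 3 2 (snd z, b, a))) (v $ 1)) (v $ 2)) \<in> borel_measurable (torus \<Otimes>\<^sub>M ?I)"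
    by (intro measurable_trunc1) (simp add: case_prod_beta')
  then show ?thesis unfolding Lam_v_place
    by (intro measurable_trunc1) (simp add: case_prod_beta')
qed

lemma complex_dirichlet: "complex_of_real (dirichlet R s) = (\<Sum>m\<in>{m::int. real_of_int \<bar>m\<bar> < R}. cis (2 * pi * real_of_int m * s))"
proof -
  let ?M = "{m::int. real_of_int \<bar>m\<bar> < R}"
  have "(\<Sum>m\<in>?M. sin (2 * pi * real_of_int m * s)) = (\<Sum>m\<in>?M. sin (2 * pi * real_of_int (- m) * s))"
    by (rule sum.reindex_bij_witness[of _ uminus uminus]) auto
  then have "(\<Sum>m\<in>?M. sin (2 * pi * real_of_int m * s)) = 0" by (simp add: sum_negf)
  then show ?thesis by (simp add: complex_eq_iff dirichlet_def)
qed

text \<open>Exponentials are multiplicative, so the product of three kernels expands at once into a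
  sum of characters over a cube of lattice points; with cosines each product would split.\<close>

lemma complex_dirichlet3:
  "complex_of_real (dirichlet3 R s) = (\<Sum>k\<in>{k. \<forall>i. real_of_int \<bar>k $ i\<bar> < R}. cis (2 * pi * (freq k \<bullet> s)))"
proof -
  let ?M = "{m::int. real_of_int \<bar>m\<bar> < R}"
  have "complex_of_real (dirichlet3 R s) = (\<Prod>i\<in>UNIV. \<Sum>m\<in>?M. cis (2 * pi * real_of_int m * s $ i))"
    by (simp add: dirichlet3_def complex_dirichlet)
  also have "\<dots> = (\<Sum>g\<in>PiE UNIV (\<lambda>_. ?M). \<Prod>i\<in>UNIV. cis (2 * pi * real_of_int (g i) * s $ i))"
    by (rule prod_sum_PiE) (simp_all only: finite finite_int_less)
  also have "\<dots> = (\<Sum>k\<in>{k. \<forall>i. real_of_int \<bar>k $ i\<bar> < R}. \<Prod>i\<in>UNIV. cis (2 * pi * real_of_int (k $ i) * s $ i))"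
    by (rule sum.reindex_bij_witness[of _ vec_nth vec_lambda]) (auto simp: PiE_def Pi_def)
  also have "(\<lambda>k. \<Prod>i\<in>UNIV. cis (2 * pi * real_of_int (k $ i) * s $ i)) = (\<lambda>k. cis (2 * pi * (freq k \<bullet> s)))"
  proof
    fix k :: "int^3"
    have "2 * pi * (freq k \<bullet> s) = 2 * pi * real_of_int (k $ 1) * s $ 1 + 2 * pi * real_of_int (k $ 2) * s $ 2 + 2 * pi * real_of_int (k $ 3) * s $ 3"
      by (simp add: inner_vec_def sum_3 freq_def distrib_left)
    then show "(\<Prod>i\<in>UNIV. cis (2 * pi * real_of_int (k $ i) * s $ i)) = cis (2 * pi * (freq k \<bullet> s))"
      unfolding UNIV_3 by (simp add: cis_mult add.assoc)
  qed
  finally show ?thesis .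
qed

text \<open>The identity holds at every point: the null sets of slices that are not integrable, where the
  inner integrals are 0 by convention, only enter under further integrals.\<close>

lemma Lam_truncation:
  assumes h: "h \<in> borel_measurable phase" "integrable phase h"
  shows "Lam \<epsilon> \<gamma> h = truncation (freqs (\<epsilon> powr - \<gamma>)) h"
proof
  fix z :: "(real^3) \<times> (real^3)"
  obtain x v where z: "z = (x, v)" by (cases z)
  let ?R = "\<epsilon> powr - \<gamma>"
  let ?Sx = "{m. norm (freq m) < ?R}" and ?Sv = "{k::int^3. \<forall>i. real_of_int \<bar>k $ i\<bar> < ?R}"
  have m3: "(\<lambda>w. dirichlet3 ?R (v - w)) \<in> borel_measurable borel"
    unfolding dirichlet3_def
    by (intro borel_measurable_continuous_onI continuous_intros continuous_on_compose2[OF continuous_dirichlet]) auto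
  define B where "B = real (card {m::int. real_of_int \<bar>m\<bar> < ?R}) ^ 3"
  have b3: "\<bar>dirichlet3 ?R s\<bar> \<le> B" for s
  proof -
    have "\<bar>dirichlet3 ?R s\<bar> = (\<Prod>i\<in>UNIV. \<bar>dirichlet ?R (s $ i)\<bar>)" by (simp add: dirichlet3_def abs_prod)
    also have "\<dots> \<le> (\<Prod>i\<in>(UNIV::3 set). real (card {m::int. real_of_int \<bar>m\<bar> < ?R}))"
      by (intro prod_mono conjI dirichlet_bound) auto
    finally show ?thesis by (simp add: B_def)
  qed
  have hd: "integrable phase (\<lambda>z. h z * dirichlet3 ?R (v - snd z))"
    by (rule integrable_mult_bounded[OF h(2) _ b3]) (intro measurable_phase_borel measurable_compose[OF borel_snd m3])
  define f where "f y = Lam_v \<epsilon> \<gamma> h (y, v)" for y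
  have f_AE: "AE y in torus. f y = (LINT w|vel. h (y, w) * dirichlet3 ?R (v - w))"
    using AE_integrable_slice(2)[OF h(2)] unfolding f_def by eventually_elim (rule Lam_v_eq)
  have fi: "integrable torus (\<lambda>y. LINT w|vel. h (y, w) * dirichlet3 ?R (v - w))"
    using tv.integrable_fst'[OF hd[unfolded phase_def]] by simp
  have f: "integrable torus f"
    using fi by (rule Bochner_Integration.integrable_cong_AE_imp)
      (use f_AE measurable_Lam_v_slice[OF h(1)] in \<open>auto simp: f_def[abs_def]\<close>)
  define D where "D s = (\<Sum>m\<in>?Sx. cos (2 * pi * (freq m \<bullet> s)))" for s
  have mD: "(\<lambda>y. D (x - y)) \<in> borel_measurable borel"
    unfolding D_def by (intro borel_measurable_continuous_onI continuous_intros)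
  have bD: "\<bar>D s\<bar> \<le> real (card ?Sx)" for s
  proof -
    have "\<bar>D s\<bar> \<le> (\<Sum>m\<in>?Sx. \<bar>cos (2 * pi * (freq m \<bullet> s))\<bar>)" unfolding D_def by (rule sum_abs)
    also have "\<dots> \<le> (\<Sum>m\<in>?Sx. 1)" by (intro sum_mono) simp
    finally show ?thesis by simp
  qed
  have "Lam \<epsilon> \<gamma> h z = Re (\<Sum>m\<in>?Sx. (LINT y|torus. complex_of_real (f y) * cis (- (2 * pi * (freq m \<bullet> y)))) * cis (2 * pi * (freq m \<bullet> x)))"
    by (simp add: z Lam_def Lam_x_def f_def)
  also have "\<dots> = (LINT y|torus. f y * (\<Sum>m\<in>?Sx. cos (2 * pi * (freq m \<bullet> x) - 2 * pi * (freq m \<bullet> y))))"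
    by (rule re_truncated_sum[OF f finite_norm_freq_less])
      (auto intro!: measurable_torus_borel borel_measurable_continuous_onI continuous_intros)
  also have "\<dots> = (LINT y|torus. f y * D (x - y))"
    by (simp add: D_def inner_diff_right right_diff_distrib)
  also have "\<dots> = (LINT y|torus. (LINT w|vel. h (y, w) * dirichlet3 ?R (v - w)) * D (x - y))"
    using f_AE by (intro integral_cong_AE borel_measurable_times measurable_torus_borel mD borel_measurable_integrable f fi) auto
  also have "\<dots> = (LINT y|torus. LINT w|vel. (\<lambda>z. h z * dirichlet3 ?R (v - snd z) * D (x - fst z)) (y, w))"
    by simp
  also have "\<dots> = (LINT z|phase. h z * dirichlet3 ?R (v - snd z) * D (x - fst z))"
    by (rule integral_phase_iterated(2)[symmetric])
       (intro integrable_mult_bounded[OF hd _ bD] measurable_phase_borel measurable_compose[OF borel_fst mD])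
  \<comment> \<open>The position kernel runs over a Euclidean ball of frequencies, the velocity
    kernel over a cube; their product is the kernel of the product set \<open>freqs\<close>.\<close>
  also have "\<dots> = (LINT z'|phase. h z' * (\<Sum>\<sigma>\<in>freqs ?R. cos (2 * pi * (\<sigma> \<bullet> (z - z')))))"
  proof (intro Bochner_Integration.integral_cong refl)
    fix z' :: "(real^3) \<times> (real^3)"
    \<comment> \<open>\<open>dirichlet3\<close> is real and may be pulled inside the real part,
      after which both factors are sums of exponentials.\<close>
    have "dirichlet3 ?R (v - snd z') * D (x - fst z') = Re (complex_of_real (dirichlet3 ?R (v - snd z')) * (\<Sum>m\<in>?Sx. cis (2 * pi * (freq m \<bullet> (x - fst z')))))"
      by (simp add: D_def)
    also have "\<dots> = Re (\<Sum>m\<in>?Sx. \<Sum>k\<in>?Sv. cis (2 * pi * (freq m \<bullet> (x - fst z'))) * cis (2 * pi * (freq k \<bullet> (v - snd z'))))"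
      unfolding complex_dirichlet3 sum_product by (subst sum.swap) (simp only: mult.commute)
    also have "\<dots> = (\<Sum>m\<in>?Sx. \<Sum>k\<in>?Sv. cos (2 * pi * ((freq m, freq k) \<bullet> (z - z'))))"
      by (simp only: cis_mult Re_sum cis.sel) (simp add: z inner_prod_def algebra_simps)
    also have "\<dots> = (\<Sum>(m, k)\<in>?Sx \<times> ?Sv. cos (2 * pi * ((freq m, freq k) \<bullet> (z - z'))))"
      by (rule sum.cartesian_product)
    also have "\<dots> = (\<Sum>\<sigma>\<in>freqs ?R. cos (2 * pi * (\<sigma> \<bullet> (z - z'))))"
      unfolding freqs_def map_prod_surj_on[OF refl refl, symmetric]
      by (subst sum.reindex) (auto simp: inj_on_def inj_eq[OF inj_freq] map_prod_def case_prod_beta')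
    finally show "h z' * dirichlet3 ?R (v - snd z') * D (x - fst z') = h z' * (\<Sum>\<sigma>\<in>freqs ?R. cos (2 * pi * (\<sigma> \<bullet> (z - z'))))"
      by (simp add: mult.assoc)
  qed
  also have "\<dots> = (LINT z'|phase. (\<Sum>\<sigma>\<in>freqs ?R. h z' * cs \<sigma> z' * cs \<sigma> z + h z' * sn \<sigma> z' * sn \<sigma> z))"
    unfolding sum_distrib_left
  proof (intro Bochner_Integration.integral_cong refl sum.cong)
    fix z' \<sigma>
    have "cos (2 * pi * (\<sigma> \<bullet> (z - z'))) = cs \<sigma> z' * cs \<sigma> z + sn \<sigma> z' * sn \<sigma> z"
      by (simp add: cs_def sn_def inner_diff_right right_diff_distrib cos_diff)
    then show "h z' * cos (2 * pi * (\<sigma> \<bullet> (z - z'))) = h z' * cs \<sigma> z' * cs \<sigma> z + h z' * sn \<sigma> z' * sn \<sigma> z"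
      by (simp only: distrib_left mult.assoc)
  qed
  also have "\<dots> = truncation (freqs ?R) h z"
  proof -
    have "integrable phase (\<lambda>z'. h z' * cs \<sigma> z')" "integrable phase (\<lambda>z'. h z' * sn \<sigma> z')" for \<sigma>
      by (rule integrable_mult_bounded[OF h(2), of _ 1];
          auto simp: cs_def sn_def intro!: measurable_phase_borel borel_measurable_continuous_onI continuous_intros)+
    then show ?thesis
      unfolding truncation_def ip_def by (subst Bochner_Integration.integral_sum) auto
  qed
  finally show "Lam \<epsilon> \<gamma> h z = truncation (freqs ?R) h z" .
qed

section \<open>Trigonometric polynomials\<close>

lemma ip_commute: "ip f g = ip g f"
  by (simp add: ip_def mult.commute)

lemma ip_add_left: "sqint f \<Longrightarrow> sqint g \<Longrightarrow> sqint h \<Longrightarrow> ip (\<lambda>z. f z + g z) h = ip f h + ip g h"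
  by (simp add: ip_def distrib_right sqint_integrable_mult)

lemma ip_diff_left: "sqint f \<Longrightarrow> sqint g \<Longrightarrow> sqint h \<Longrightarrow> ip (\<lambda>z. f z - g z) h = ip f h - ip g h"
  by (simp add: ip_def left_diff_distrib sqint_integrable_mult)

lemma ip_add_right: "sqint f \<Longrightarrow> sqint g \<Longrightarrow> sqint h \<Longrightarrow> ip h (\<lambda>z. f z + g z) = ip h f + ip h g"
  using ip_add_left[of f g h] by (simp add: ip_commute)

lemma ip_diff_right: "sqint f \<Longrightarrow> sqint g \<Longrightarrow> sqint h \<Longrightarrow> ip h (\<lambda>z. f z - g z) = ip h f - ip h g"
  using ip_diff_left[of f g h] by (simp add: ip_commute)

lemma ip_cmult_left: "ip (\<lambda>z. c * f z) h = c * ip f h"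
  by (simp add: ip_def mult.assoc)

lemma ip_cmult_right: "ip h (\<lambda>z. c * f z) = c * ip h f"
  using ip_cmult_left[of c f h] by (simp add: ip_commute)

lemma ip_sum_left: "(\<And>i. i \<in> I \<Longrightarrow> sqint (f i)) \<Longrightarrow> sqint h \<Longrightarrow> ip (\<lambda>z. \<Sum>i\<in>I. f i z) h = (\<Sum>i\<in>I. ip (f i) h)"
  by (simp add: ip_def sum_distrib_right sqint_integrable_mult)

lemma ip_sum_right: "(\<And>i. i \<in> I \<Longrightarrow> sqint (f i)) \<Longrightarrow> sqint h \<Longrightarrow> ip h (\<lambda>z. \<Sum>i\<in>I. f i z) = (\<Sum>i\<in>I. ip h (f i))"
  using ip_sum_left[of I f h] by (simp add: ip_commute)

lemma ip_nonneg: "0 \<le> ip f f"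
  unfolding ip_def by simp

lemma ip_cauchy_schwarz:
  assumes "sqint f" "sqint g" shows "\<bar>ip f g\<bar> \<le> sqrt (ip f f) * sqrt (ip g g)"
proof -
  have "0 \<le> ip f f + 2 * t * ip f g + t\<^sup>2 * ip g g" for t
  proof -
    have "ip (\<lambda>z. f z + t * g z) (\<lambda>z. f z + t * g z) = ip f f + 2 * t * ip f g + t\<^sup>2 * ip g g"
      using assms by (simp add: ip_add_left ip_add_right ip_cmult_left ip_cmult_right sqint_add sqint_cmult
          ip_commute[of g f] power2_eq_square algebra_simps)
    then show ?thesis using ip_nonneg[of "\<lambda>z. f z + t * g z"] by simp
  qed
  then have "(ip f g)\<^sup>2 \<le> ip f f * ip g g" by (rule quadratic_nonneg_discriminant)
  then have "sqrt ((ip f g)\<^sup>2) \<le> sqrt (ip f f * ip g g)" by (rule real_sqrt_le_mono)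
  then show ?thesis by (simp add: real_sqrt_mult)
qed

text \<open>The integrand is the derivative of a periodic sine in a direction where \<open>k\<close>
  does not vanish. The phase \<open>c\<close> absorbs a frozen second variable and, at
  \<open>- (pi / 2)\<close>, turns the cosine into a sine.\<close>

lemma integral_cube_cos:
  fixes k :: "real^3"
  assumes k: "\<And>i. k $ i \<in> \<int>" "k \<noteq> 0"
  shows "(LINT x|cube a. cos (2 * pi * (k \<bullet> x) + c)) = 0"
proof -
  obtain j where j: "k $ j \<noteq> 0" using k(2) by (auto simp: vec_eq_iff)
  show ?thesis
  proof (rule integral_cube_periodic_deriv[where j=j and \<psi>="\<lambda>x. sin (2 * pi * (k \<bullet> x) + c) / (2 * pi * k $ j)"])
    show "continuous_on UNIV (\<lambda>x. cos (2 * pi * (k \<bullet> x) + c))" by (intro continuous_intros)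
    fix x :: "real^3"
    have "sin (2 * pi * (k \<bullet> (x + axis j 1)) + c) = sin ((2 * pi * (k \<bullet> x) + c) + 2 * pi * k $ j)"
      by (simp add: inner_add_right inner_axis distrib_left algebra_simps)
    also have "\<dots> = sin (2 * pi * (k \<bullet> x) + c)"
      using k(1)[of j] by (subst sin_add) (auto elim!: Ints_cases simp: sin_integer_2pi cos_integer_2pi)
    finally show "sin (2 * pi * (k \<bullet> (x + axis j 1)) + c) / (2 * pi * k $ j) = sin (2 * pi * (k \<bullet> x) + c) / (2 * pi * k $ j)"
      by simp
    have "((\<lambda>t. sin (2 * pi * (k \<bullet> x + t * k $ j) + c) / (2 * pi * k $ j)) has_real_derivative
        cos (2 * pi * (k \<bullet> x + 0 * k $ j) + c)) (at 0)"
      using j by (auto intro!: derivative_eq_intros)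
    then show "((\<lambda>t. sin (2 * pi * (k \<bullet> (x + t *\<^sub>R axis j 1)) + c) / (2 * pi * k $ j)) has_real_derivative cos (2 * pi * (k \<bullet> x) + c)) (at 0)"
      by (simp add: inner_add_right inner_axis)
  qed
qed

lemma continuous_cs: "continuous_on T (cs \<sigma>)" and continuous_sn: "continuous_on T (sn \<sigma>)"
  unfolding cs_def[abs_def] sn_def[abs_def] by (intro continuous_intros)+

lemma sqint_cs: "sqint (cs \<sigma>)" and sqint_sn: "sqint (sn \<sigma>)"
  by (intro sqint_continuous continuous_cs continuous_sn)+

lemma integral_phase_cos:
  assumes \<sigma>: "\<And>i. fst \<sigma> $ i \<in> \<int>" "\<And>i. snd \<sigma> $ i \<in> \<int>" "\<sigma> \<noteq> 0"
  shows "(LINT z|phase. cos (2 * pi * (\<sigma> \<bullet> z) + c)) = 0"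
proof -
  obtain m k where mk: "\<sigma> = (m, k)" by (cases \<sigma>)
  have i: "integrable phase (\<lambda>z. cos (2 * pi * (\<sigma> \<bullet> z) + c))"
    by (intro integrable_phase_continuous continuous_intros)
  show ?thesis
  proof (cases "m = 0")
    case False
    have "(LINT x|torus. cos (2 * pi * (\<sigma> \<bullet> (x, v)) + c)) = 0" for v
      using integral_cube_cos[of m 0 "2 * pi * (k \<bullet> v) + c"] \<sigma> False
      by (simp add: mk torus_eq distrib_left add.assoc)
    then show ?thesis by (subst integral_phase_iterated(1)[OF i]) simp
  next
    case True
    have "(LINT v|vel. cos (2 * pi * (\<sigma> \<bullet> (x, v)) + c)) = 0" for x
      using integral_cube_cos[of k "-1/2" c] \<sigma> True by (simp add: mk vel_eq zero_prod_def)
    then show ?thesis by (subst integral_phase_iterated(2)[OF i]) simp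
  qed
qed

locale fourier_set =
  fixes S :: "((real^3) \<times> (real^3)) set"
  assumes finite_S: "finite S" and uminus_S: "\<sigma> \<in> S \<Longrightarrow> - \<sigma> \<in> S"
    and Ints_S: "\<sigma> \<in> S \<Longrightarrow> fst \<sigma> $ i \<in> \<int>" "\<sigma> \<in> S \<Longrightarrow> snd \<sigma> $ i \<in> \<int>"

lemma fourier_set_freqs: "fourier_set (freqs R)"
  using freqs_finite freqs_uminus freqs_Ints by unfold_locales auto

context fourier_set
begin

lemma integral_cos_S:
  assumes "\<sigma> \<in> S" "\<tau> \<in> S"
  shows "(LINT z|phase. cos (2 * pi * ((\<sigma> - \<tau>) \<bullet> z) + c)) = (if \<sigma> = \<tau> then cos c else 0)"
    "(LINT z|phase. cos (2 * pi * ((\<sigma> + \<tau>) \<bullet> z) + c)) = (if \<sigma> = - \<tau> then cos c else 0)"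
  using integral_phase_cos[of "\<sigma> - \<tau>" c] integral_phase_cos[of "\<sigma> + \<tau>" c] Ints_S assms
  by (auto simp: add_eq_0_iff2)

text \<open>Product-to-sum formulas reduce these to single characters. Both deltas fire together
  exactly at frequency 0, giving 1 for the constant cosine and 0 for the vanishing sine.\<close>

lemma ip_trig:
  assumes "\<sigma> \<in> S" "\<tau> \<in> S"
  shows "ip (cs \<sigma>) (cs \<tau>) = ((if \<sigma> = \<tau> then 1 else 0) + (if \<sigma> = - \<tau> then 1 else 0)) / 2"
    "ip (sn \<sigma>) (sn \<tau>) = ((if \<sigma> = \<tau> then 1 else 0) - (if \<sigma> = - \<tau> then 1 else 0)) / 2"
    "ip (cs \<sigma>) (sn \<tau>) = 0"
proof -
  have i: "integrable phase (\<lambda>z. cos (2 * pi * (\<rho> \<bullet> z) + c))" for \<rho> c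
    by (intro integrable_phase_continuous continuous_intros)
  note S = integral_cos_S[OF assms, of 0, simplified] integral_cos_S[OF assms, of "- (pi / 2)"]
  note i0 = i[of _ 0, simplified]
  have "ip (cs \<sigma>) (cs \<tau>) = (LINT z|phase. (cos (2 * pi * ((\<sigma> - \<tau>) \<bullet> z)) + cos (2 * pi * ((\<sigma> + \<tau>) \<bullet> z))) / 2)"
    by (simp add: ip_def cs_def cos_times_cos inner_diff_left inner_add_left algebra_simps)
  then show "ip (cs \<sigma>) (cs \<tau>) = ((if \<sigma> = \<tau> then 1 else 0) + (if \<sigma> = - \<tau> then 1 else 0)) / 2"
    using i0 S(1,2) by simp
  have "ip (sn \<sigma>) (sn \<tau>) = (LINT z|phase. (cos (2 * pi * ((\<sigma> - \<tau>) \<bullet> z)) - cos (2 * pi * ((\<sigma> + \<tau>) \<bullet> z))) / 2)"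
    by (simp add: ip_def sn_def sin_times_sin inner_diff_left inner_add_left algebra_simps)
  then show "ip (sn \<sigma>) (sn \<tau>) = ((if \<sigma> = \<tau> then 1 else 0) - (if \<sigma> = - \<tau> then 1 else 0)) / 2"
    using i0 S(1,2) by simp
  have "ip (cs \<sigma>) (sn \<tau>) = (LINT z|phase. (sin (2 * pi * ((\<sigma> + \<tau>) \<bullet> z)) - sin (2 * pi * ((\<sigma> - \<tau>) \<bullet> z))) / 2)"
    by (simp add: ip_def cs_def sn_def cos_times_sin inner_diff_left inner_add_left algebra_simps)
  also have "\<dots> = (LINT z|phase. (cos (2 * pi * ((\<sigma> + \<tau>) \<bullet> z) + - (pi / 2)) - cos (2 * pi * ((\<sigma> - \<tau>) \<bullet> z) + - (pi / 2))) / 2)"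
    by (simp add: cos_diff)
  also have "\<dots> = 0" using i[of _ "- (pi / 2)"] S(3,4) by simp
  finally show "ip (cs \<sigma>) (sn \<tau>) = 0" .
qed

abbreviation "tr \<equiv> truncation S"

lemma continuous_tr: "continuous_on T (tr h)"
  unfolding truncation_def[abs_def] by (intro continuous_intros continuous_cs continuous_sn)

lemma sqint_tr: "sqint (tr h)" by (intro sqint_continuous continuous_tr)

lemma ip_tr: "sqint g \<Longrightarrow> ip (tr h) g = (\<Sum>\<sigma>\<in>S. ip h (cs \<sigma>) * ip g (cs \<sigma>) + ip h (sn \<sigma>) * ip g (sn \<sigma>))"
  unfolding truncation_def[abs_def]
  by (subst ip_sum_left)
     (auto simp: ip_add_left ip_cmult_left ip_commute[of g "cs _"] ip_commute[of g "sn _"] sqint_cmult sqint_cs sqint_sn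
       intro!: sqint_add)

lemma tr_selfadjoint: "sqint h \<Longrightarrow> sqint g \<Longrightarrow> ip (tr h) g = ip h (tr g)"
  by (subst (2) ip_commute) (simp add: ip_tr mult.commute)

lemma cs_sn_uminus: "cs (- \<sigma>) = cs \<sigma>" "sn (- \<sigma>) = (\<lambda>z. - sn \<sigma> z)"
  by (auto simp: cs_def sn_def)

text \<open>Orthogonality averages the coefficients at \<open>\<tau>\<close> and
  \<open>- \<tau>\<close>, with a sign for sines; the two agree, so nothing changes. Hence
  \<open>tr\<close> is a projection although each character is listed twice.\<close>

lemma ip_tr_trig:
  assumes "\<tau> \<in> S"
  shows "ip (tr h) (cs \<tau>) = ip h (cs \<tau>)" "ip (tr h) (sn \<tau>) = ip h (sn \<tau>)"
proof -
  have d: "(\<Sum>\<sigma>\<in>S. f \<sigma> * (((if \<sigma> = \<tau> then 1 else 0) + (if \<sigma> = - \<tau> then 1 else 0)) / 2)) = (f \<tau> + f (- \<tau>)) / 2"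
    "(\<Sum>\<sigma>\<in>S. f \<sigma> * (((if \<sigma> = \<tau> then 1 else 0) - (if \<sigma> = - \<tau> then 1 else 0)) / 2)) = (f \<tau> - f (- \<tau>)) / 2"
    for f :: "_ \<Rightarrow> real"
    using finite_S assms uminus_S[OF assms]
    by (simp_all add: distrib_left right_diff_distrib add_divide_distrib diff_divide_distrib sum.distrib sum_subtractf sum_divide_distrib[symmetric]
        if_distrib[of "\<lambda>x. _ * x"] sum.delta cong: if_cong)
  have neg: "ip h (\<lambda>z. - sn \<tau> z) = - ip h (sn \<tau>)" by (simp add: ip_def)
  have "ip (tr h) (cs \<tau>) = (\<Sum>\<sigma>\<in>S. ip h (cs \<sigma>) * (((if \<sigma> = \<tau> then 1 else 0) + (if \<sigma> = - \<tau> then 1 else 0)) / 2))"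
    unfolding ip_tr[OF sqint_cs]
    by (intro sum.cong refl) (auto simp: ip_trig(1,3)[OF assms])
  then show "ip (tr h) (cs \<tau>) = ip h (cs \<tau>)" unfolding d by (simp add: cs_sn_uminus)
  have "ip (tr h) (sn \<tau>) = (\<Sum>\<sigma>\<in>S. ip h (sn \<sigma>) * (((if \<sigma> = \<tau> then 1 else 0) - (if \<sigma> = - \<tau> then 1 else 0)) / 2))"
    unfolding ip_tr[OF sqint_sn]
    by (intro sum.cong refl) (auto simp: ip_trig(2)[OF assms] ip_commute[of "sn \<tau>" "cs _"] ip_trig(3)[OF _ assms])
  then show "ip (tr h) (sn \<tau>) = ip h (sn \<tau>)" unfolding d by (simp add: cs_sn_uminus neg)
qed

lemma tr_tr: "tr (tr h) = tr h"
proof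
  fix z
  have "tr (tr h) z = (\<Sum>\<sigma>\<in>S. ip (tr h) (cs \<sigma>) * cs \<sigma> z + ip (tr h) (sn \<sigma>) * sn \<sigma> z)" by (rule truncation_def)
  also have "\<dots> = (\<Sum>\<sigma>\<in>S. ip h (cs \<sigma>) * cs \<sigma> z + ip h (sn \<sigma>) * sn \<sigma> z)"
    by (intro sum.cong refl) (simp add: ip_tr_trig)
  also have "\<dots> = tr h z" by (rule truncation_def[symmetric])
  finally show "tr (tr h) z = tr h z" .
qed

lemma tr_cong: "(\<And>\<sigma>. ip f (cs \<sigma>) = ip g (cs \<sigma>)) \<Longrightarrow> (\<And>\<sigma>. ip f (sn \<sigma>) = ip g (sn \<sigma>)) \<Longrightarrow> tr f = tr g"
  unfolding truncation_def[abs_def] by simp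

lemma tr_cong_AE:
  assumes "AE z in phase. f z = g z" "f \<in> borel_measurable phase" "g \<in> borel_measurable phase"
  shows "tr f = tr g"
  using assms sqint_cs sqint_sn by (intro tr_cong ip_cong_AE) (auto simp: sqint_def)

lemma tr_add: "sqint f \<Longrightarrow> sqint g \<Longrightarrow> tr (\<lambda>z. f z + g z) z = tr f z + tr g z"
  unfolding truncation_def
  by (simp add: ip_add_left sqint_cs sqint_sn sum.distrib[symmetric] algebra_simps)

lemma tr_diff: "sqint f \<Longrightarrow> sqint g \<Longrightarrow> tr (\<lambda>z. f z - g z) z = tr f z - tr g z"
  unfolding truncation_def
  by (simp add: ip_diff_left sqint_cs sqint_sn sum_subtractf[symmetric] algebra_simps)

lemma tr_cmult: "tr (\<lambda>z. c * f z) z = c * tr f z"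
  unfolding truncation_def by (simp add: ip_cmult_left sum_distrib_left algebra_simps)

lemma tr_bessel: "sqint h \<Longrightarrow> ip (tr h) (tr h) \<le> ip h h"
proof -
  assume h: "sqint h"
  have e: "ip (tr h) (tr h) = ip h (tr h)" using tr_selfadjoint[OF h sqint_tr, of h] by (simp add: tr_tr)
  have "0 \<le> ip (\<lambda>z. h z - tr h z) (\<lambda>z. h z - tr h z)" by (rule ip_nonneg)
  also have "\<dots> = ip h h - ip (tr h) (tr h)"
    using h by (simp add: ip_diff_left ip_diff_right sqint_tr sqint_diff e[symmetric] ip_commute[of "tr h" h])
  finally show ?thesis by simp
qed

text \<open>The derivative of \<open>tr h\<close>, not of \<open>h\<close>, expressed by the Fourier
  coefficients of \<open>h\<close>. It makes sense for every density, and for a weakly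
  differentiable \<open>h\<close> it can be compared with the truncated weak derivative.\<close>

definition td :: "3 \<Rightarrow> density \<Rightarrow> density" where
  "td j h z = (\<Sum>\<sigma>\<in>S. 2 * pi * fst \<sigma> $ j * (ip h (sn \<sigma>) * cs \<sigma> z - ip h (cs \<sigma>) * sn \<sigma> z))"

lemma trig_periodic:
  assumes "\<sigma> \<in> S" shows "cs \<sigma> (x + axis i 1, v) = cs \<sigma> (x, v)" "sn \<sigma> (x + axis i 1, v) = sn \<sigma> (x, v)"
proof -
  have "\<sigma> \<bullet> (x + axis i 1, v) = \<sigma> \<bullet> (x, v) + fst \<sigma> $ i" by (cases \<sigma>) (simp add: inner_add_right inner_axis)
  then show "cs \<sigma> (x + axis i 1, v) = cs \<sigma> (x, v)" "sn \<sigma> (x + axis i 1, v) = sn \<sigma> (x, v)"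
    unfolding cs_def sn_def using cos_sin_Ints_shift[OF Ints_S(1)[OF assms]] by simp_all
qed

lemma xder_trig:
  assumes "\<sigma> \<in> S"
  shows "xder j (cs \<sigma>) (\<lambda>z. - (2 * pi * fst \<sigma> $ j) * sn \<sigma> z)" "xder j (sn \<sigma>) (\<lambda>z. 2 * pi * fst \<sigma> $ j * cs \<sigma> z)"
proof -
  have e: "\<sigma> \<bullet> (x + t *\<^sub>R axis j 1, v) = \<sigma> \<bullet> (x, v) + t * fst \<sigma> $ j" for x v t
    by (cases \<sigma>) (simp add: inner_add_right inner_axis)
  have "((\<lambda>t. cos (2 * pi * (\<sigma> \<bullet> (x, v) + t * fst \<sigma> $ j))) has_real_derivative - (2 * pi * fst \<sigma> $ j) * sin (2 * pi * (\<sigma> \<bullet> (x, v) + 0 * fst \<sigma> $ j))) (at 0)" for x v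
    by (auto intro!: derivative_eq_intros)
  moreover have "((\<lambda>t. sin (2 * pi * (\<sigma> \<bullet> (x, v) + t * fst \<sigma> $ j))) has_real_derivative (2 * pi * fst \<sigma> $ j) * cos (2 * pi * (\<sigma> \<bullet> (x, v) + 0 * fst \<sigma> $ j))) (at 0)" for x v
    by (auto intro!: derivative_eq_intros)
  ultimately show "xder j (cs \<sigma>) (\<lambda>z. - (2 * pi * fst \<sigma> $ j) * sn \<sigma> z)" "xder j (sn \<sigma>) (\<lambda>z. 2 * pi * fst \<sigma> $ j * cs \<sigma> z)"
    using trig_periodic[OF assms] unfolding xder_def
    by (auto simp: cs_def[of \<sigma> "(_ + _ *\<^sub>R _, _)"] sn_def[of \<sigma> "(_ + _ *\<^sub>R _, _)"] e intro!: continuous_intros continuous_cs continuous_sn)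
       (simp_all add: cs_def sn_def)
qed

lemma xder_tr: "xder j (tr h) (td j h)"
proof -
  have "xder j (tr h) (\<lambda>z. \<Sum>\<sigma>\<in>S. ip h (cs \<sigma>) * (- (2 * pi * fst \<sigma> $ j) * sn \<sigma> z) + ip h (sn \<sigma>) * (2 * pi * fst \<sigma> $ j * cs \<sigma> z))"
    unfolding truncation_def[abs_def] by (intro xder_sum xder_add xder_cmult xder_trig)
  then show ?thesis by (rule back_subst[where P="xder j (tr h)"]) (auto simp: td_def algebra_simps intro!: sum.cong)
qed

lemma continuous_td: "continuous_on T (td j h)"
  using xder_continuous(2)[OF xder_tr] .

lemma sqint_td: "sqint (td j h)" by (intro sqint_continuous continuous_td)

end

lemma xder_ip:
  assumes f: "xder j f f'" and g: "xder j g g'"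
  shows "ip f' g = - ip f g'"
proof -
  have i: "integrable phase (\<lambda>z. f' z * g z)" "integrable phase (\<lambda>z. f z * g' z)"
    using xder_continuous[OF f] xder_continuous[OF g] by (auto intro!: integrable_phase_continuous continuous_intros)
  have "(LINT z|phase. f' z * g z + f z * g' z) = (LINT v|vel. LINT x|torus. f' (x, v) * g (x, v) + f (x, v) * g' (x, v))"
    using i by (intro integral_phase_iterated(1)) auto
  also have "\<dots> = 0" using xder_integral_eq_0[OF xder_mult[OF f g]] by simp
  finally show ?thesis using i by (simp add: ip_def)
qed

section \<open>Truncation and differentiation\<close>

context fourier_set
begin

lemma ip_td_trig:
  assumes "\<sigma> \<in> S"
  shows "ip (td j h) (cs \<sigma>) = 2 * pi * fst \<sigma> $ j * ip h (sn \<sigma>)" "ip (td j h) (sn \<sigma>) = - (2 * pi * fst \<sigma> $ j) * ip h (cs \<sigma>)"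
  using xder_ip[OF xder_tr xder_trig(1)[OF assms]] xder_ip[OF xder_tr xder_trig(2)[OF assms]]
  by (simp_all only: ip_cmult_right ip_tr_trig[OF assms])  simp_all

lemma tr_td: "tr (td j h) = td j h"
  by (rule ext) (auto simp: truncation_def td_def[of j h] ip_td_trig algebra_simps intro!: sum.cong)

lemma td_tr: "td j (tr h) = td j h"
  by (rule ext) (auto simp: td_def ip_tr_trig intro!: sum.cong)

lemma td_td_commute: "td j (td k h) = td k (td j h)"
  unfolding td_def[of _ "td _ h", abs_def] by (rule ext, rule sum.cong) (simp_all add: ip_td_trig algebra_simps)

lemma xder_td: "xder j (td k h) (td j (td k h))"
  using xder_tr[of j "td k h"] by (simp add: tr_td)

lemma td_diff: "sqint f \<Longrightarrow> sqint g \<Longrightarrow> td j (\<lambda>z. f z - g z) z = td j f z - td j g z"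
  unfolding td_def
  by (simp add: ip_diff_left sqint_cs sqint_sn sum_subtractf[symmetric] algebra_simps)

lemma td_add: "sqint f \<Longrightarrow> sqint g \<Longrightarrow> td j (\<lambda>z. f z + g z) z = td j f z + td j g z"
  unfolding td_def
  by (simp add: ip_add_left sqint_cs sqint_sn sum.distrib[symmetric] algebra_simps)

lemma td_cmult: "td j (\<lambda>z. c * f z) z = c * td j f z"
  unfolding td_def by (simp add: ip_cmult_left sum_distrib_left algebra_simps)

text \<open>Weak derivatives are tested with functions of \<open>x\<close> at almost every
  \<open>v\<close>. Integrating that identity against \<open>a\<close> yields test functions of
  product form on \<open>phase\<close>.\<close>

lemma weak_deriv_ip:
  assumes h: "h \<in> L2" "g \<in> L2" and w: "weak_deriv_x j h g" and \<phi>: "torus_smooth \<phi>" and a: "continuous_on UNIV a"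
  shows "ip h (\<lambda>z. pd j \<phi> (fst z) * a (snd z)) = - ip g (\<lambda>z. \<phi> (fst z) * a (snd z))"
proof -
  have c: "continuous_on UNIV \<phi>" "continuous_on UNIV (pd j \<phi>)" using xder_slice[OF torus_smooth_xder[OF \<phi>, of j], of UNIV 0] by simp_all
  have ca: "continuous_on UNIV (\<lambda>z::(real^3)\<times>(real^3). pd j \<phi> (fst z) * a (snd z))" "continuous_on UNIV (\<lambda>z::(real^3)\<times>(real^3). \<phi> (fst z) * a (snd z))"
    by (intro continuous_intros continuous_on_compose2[OF c(1)] continuous_on_compose2[OF c(2)] continuous_on_compose2[OF a]; simp)+
  have ih: "integrable phase (\<lambda>z. h z * (pd j \<phi> (fst z) * a (snd z)))" "integrable phase (\<lambda>z. g z * (\<phi> (fst z) * a (snd z)))"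
    using ca by (intro sqint_integrable_mult L2_sqint h sqint_continuous; simp)+
  have "ip h (\<lambda>z. pd j \<phi> (fst z) * a (snd z)) = (LINT v|vel. LINT x|torus. h (x, v) * (pd j \<phi> x * a v))"
    unfolding ip_def using integral_phase_iterated(1)[OF ih(1)] by simp
  also have "\<dots> = (LINT v|vel. - (LINT x|torus. g (x, v) * (\<phi> x * a v)))"
  proof (rule integral_cong_AE)
    interpret vt: pair_sigma_finite vel torus ..
    have sw: "integrable vel (\<lambda>v. LINT x|torus. f (x, v))" if "integrable phase f" for f :: "_ \<Rightarrow> real"
      using vt.integrable_fst'[OF tv.integrable_product_swap[OF that[unfolded phase_def]]] by simp
    show "(\<lambda>v. LINT x|torus. h (x, v) * (pd j \<phi> x * a v)) \<in> borel_measurable vel"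
      "(\<lambda>v. - (LINT x|torus. g (x, v) * (\<phi> x * a v))) \<in> borel_measurable vel"
      using sw[OF ih(1)] sw[OF ih(2)] by auto
    have "AE v in vel. (LINT x|torus. h (x, v) * pd j \<phi> x) = - (LINT x|torus. g (x, v) * \<phi> x)"
      using w \<phi> by (auto simp: weak_deriv_x_def)
    then show "AE v in vel. (LINT x|torus. h (x, v) * (pd j \<phi> x * a v)) = - (LINT x|torus. g (x, v) * (\<phi> x * a v))"
      by eventually_elim (simp add: mult.assoc[symmetric])
  qed
  also have "\<dots> = - ip g (\<lambda>z. \<phi> (fst z) * a (snd z))"
    unfolding ip_def using integral_phase_iterated(1)[OF ih(2)] by simp
  finally show ?thesis .
qed

text \<open>The addition formulas split each character into products of a function of
  \<open>x\<close> and a function of \<open>v\<close>, which \<open>weak_deriv_ip\<close> can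
  handle. This brings Bessel's inequality to the derivatives of the initial datum.\<close>

lemma td_weak_deriv:
  assumes h: "h \<in> L2" "g \<in> L2" and w: "weak_deriv_x j h g"
  shows "td j h = tr g"
proof -
  have "ip g (cs \<sigma>) = 2 * pi * fst \<sigma> $ j * ip h (sn \<sigma>) \<and> ip g (sn \<sigma>) = - (2 * pi * fst \<sigma> $ j) * ip h (cs \<sigma>)" if "\<sigma> \<in> S" for \<sigma>
  proof -
    obtain m k where mk: "\<sigma> = (m, k)" by (cases \<sigma>)
    have m: "m $ i \<in> \<int>" for i using Ints_S(1)[OF that, of i] by (simp add: mk)
    have ts: "torus_smooth (\<lambda>x. cos (2 * pi * (m \<bullet> x)))" "torus_smooth (\<lambda>x. sin (2 * pi * (m \<bullet> x)))"
      by (intro trig_smooth_torus_smooth trig_smooth.cos trig_smooth.sin m)+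
    have ca: "continuous_on UNIV (\<lambda>v::real^3. cos (2 * pi * (k \<bullet> v)))" "continuous_on UNIV (\<lambda>v::real^3. sin (2 * pi * (k \<bullet> v)))"
      by (intro continuous_intros)+
    have ca2: "sqint (\<lambda>z. cos (2 * pi * (m \<bullet> fst z)) * cos (2 * pi * (k \<bullet> snd z)))" "sqint (\<lambda>z. cos (2 * pi * (m \<bullet> fst z)) * sin (2 * pi * (k \<bullet> snd z)))"
      "sqint (\<lambda>z. sin (2 * pi * (m \<bullet> fst z)) * cos (2 * pi * (k \<bullet> snd z)))" "sqint (\<lambda>z. sin (2 * pi * (m \<bullet> fst z)) * sin (2 * pi * (k \<bullet> snd z)))"
      by (intro sqint_continuous continuous_intros)+
    have c: "cs \<sigma> = (\<lambda>z. cos (2 * pi * (m \<bullet> fst z)) * cos (2 * pi * (k \<bullet> snd z)) - sin (2 * pi * (m \<bullet> fst z)) * sin (2 * pi * (k \<bullet> snd z)))"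
      and s: "sn \<sigma> = (\<lambda>z. sin (2 * pi * (m \<bullet> fst z)) * cos (2 * pi * (k \<bullet> snd z)) + cos (2 * pi * (m \<bullet> fst z)) * sin (2 * pi * (k \<bullet> snd z)))"
      by (auto simp: cs_def sn_def mk inner_prod_def distrib_left cos_add sin_add)
    have W: "ip g (\<lambda>z. cos (2 * pi * (m \<bullet> fst z)) * a (snd z)) = 2 * pi * m $ j * ip h (\<lambda>z. sin (2 * pi * (m \<bullet> fst z)) * a (snd z))"
      "ip g (\<lambda>z. sin (2 * pi * (m \<bullet> fst z)) * a (snd z)) = - (2 * pi * m $ j) * ip h (\<lambda>z. cos (2 * pi * (m \<bullet> fst z)) * a (snd z))"
      if "continuous_on UNIV a" for a
      using weak_deriv_ip[OF h w ts(1) that] weak_deriv_ip[OF h w ts(2) that]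
      unfolding pd_cos pd_sin mult.assoc[of _ "sin _"] mult.assoc[of _ "cos _"] ip_cmult_right by simp_all
    note W' = W[OF ca(1)] W[OF ca(2)]
    note sq = L2_sqint[OF h(1)] L2_sqint[OF h(2)]
    show ?thesis
      unfolding c s using W' sq ca2
      by (simp add: ip_add_right ip_diff_right mk algebra_simps)
  qed
  then show ?thesis
    by (intro ext) (auto simp: td_def truncation_def algebra_simps intro!: sum.cong)
qed

section \<open>Sup norm bounds from Fourier coefficients\<close>

lemma ip_trig_self_le: "ip (cs \<sigma>) (cs \<sigma>) \<le> 1" "ip (sn \<sigma>) (sn \<sigma>) \<le> 1"
proof -
  have b: "(LINT z|phase. f z * f z) \<le> 1" if "continuous_on UNIV f" "\<And>z. \<bar>f z\<bar> \<le> 1" for f :: density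
  proof -
    have "(LINT z|phase. f z * f z) \<le> (LINT z|phase. 1)"
    proof (rule integral_mono)
      show "f z * f z \<le> 1" for z using that(2)[of z] by (simp add: abs_square_le_1[symmetric] power2_eq_square[symmetric])
    qed (use that in \<open>auto intro!: integrable_phase_continuous continuous_intros\<close>)
    then show ?thesis by simp
  qed
  show "ip (cs \<sigma>) (cs \<sigma>) \<le> 1" "ip (sn \<sigma>) (sn \<sigma>) \<le> 1"
    unfolding ip_def by (intro b continuous_cs continuous_sn; simp add: cs_def sn_def)+
qed

text \<open>Sup norm per unit of coefficient size: two terms for each frequency. In
  \<open>Dc\<close> each of the two carries the factor \<open>2 * pi * norm (fst \<sigma>)\<close>
  of differentiation.\<close>

definition Sc :: real where "Sc = 2 * real (card S)"
definition Dc :: real where "Dc = (\<Sum>\<sigma>\<in>S. 4 * pi * norm (fst \<sigma>))"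

lemma Sc_nonneg: "0 \<le> Sc" and Dc_nonneg: "0 \<le> Dc"
  by (auto simp: Sc_def Dc_def intro!: sum_nonneg)

lemma tr_td_bound:
  assumes "\<And>\<sigma>. \<bar>ip h (cs \<sigma>)\<bar> \<le> a" "\<And>\<sigma>. \<bar>ip h (sn \<sigma>)\<bar> \<le> a"
  shows "\<bar>tr h z\<bar> \<le> Sc * a" "\<bar>td j h z\<bar> \<le> Dc * a"
proof -
  have a: "0 \<le> a" using assms(1)[of 0] by linarith
  have c: "\<bar>ip h (cs \<sigma>) * cs \<tau> z\<bar> \<le> a" "\<bar>ip h (sn \<sigma>) * cs \<tau> z\<bar> \<le> a" "\<bar>ip h (cs \<sigma>) * sn \<tau> z\<bar> \<le> a" "\<bar>ip h (sn \<sigma>) * sn \<tau> z\<bar> \<le> a" for \<sigma> \<tau>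
    using mult_mono[OF assms(1)[of \<sigma>], of "\<bar>cs \<tau> z\<bar>" 1] mult_mono[OF assms(2)[of \<sigma>], of "\<bar>cs \<tau> z\<bar>" 1]
      mult_mono[OF assms(1)[of \<sigma>], of "\<bar>sn \<tau> z\<bar>" 1] mult_mono[OF assms(2)[of \<sigma>], of "\<bar>sn \<tau> z\<bar>" 1] a
    by (auto simp: abs_mult cs_def sn_def)
  have "\<bar>tr h z\<bar> \<le> (\<Sum>\<sigma>\<in>S. 2 * a)"
    unfolding truncation_def
    by (rule order_trans[OF sum_abs]) (intro sum_mono order_trans[OF abs_triangle_ineq], use c in \<open>smt (verit)\<close>)
  then show "\<bar>tr h z\<bar> \<le> Sc * a" by (simp add: Sc_def)
  have "\<bar>td j h z\<bar> \<le> (\<Sum>\<sigma>\<in>S. 4 * pi * norm (fst \<sigma>) * a)"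
    unfolding td_def
  proof (rule order_trans[OF sum_abs], rule sum_mono)
    fix \<sigma>
    have "\<bar>ip h (sn \<sigma>) * cs \<sigma> z - ip h (cs \<sigma>) * sn \<sigma> z\<bar> \<le> 2 * a" using c[of \<sigma> \<sigma>] by linarith
    moreover have "2 * pi * \<bar>fst \<sigma> $ j\<bar> \<le> 2 * pi * norm (fst \<sigma>)" by (simp add: component_le_norm_cart)
    ultimately have "(2 * pi * \<bar>fst \<sigma> $ j\<bar>) * \<bar>ip h (sn \<sigma>) * cs \<sigma> z - ip h (cs \<sigma>) * sn \<sigma> z\<bar> \<le> (2 * pi * norm (fst \<sigma>)) * (2 * a)"
      by (intro mult_mono) auto
    then show "\<bar>2 * pi * fst \<sigma> $ j * (ip h (sn \<sigma>) * cs \<sigma> z - ip h (cs \<sigma>) * sn \<sigma> z)\<bar> \<le> 4 * pi * norm (fst \<sigma>) * a"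
      by (simp add: abs_mult)
  qed
  then show "\<bar>td j h z\<bar> \<le> Dc * a" by (simp add: Dc_def sum_distrib_right)
qed

lemma ip_trig_L2:
  assumes "sqint h" shows "\<bar>ip h (cs \<sigma>)\<bar> \<le> sqrt (ip h h)" "\<bar>ip h (sn \<sigma>)\<bar> \<le> sqrt (ip h h)"
proof -
  have "\<bar>ip h g\<bar> \<le> sqrt (ip h h)" if "sqint g" "ip g g \<le> 1" for g
  proof -
    have "\<bar>ip h g\<bar> \<le> sqrt (ip h h) * sqrt (ip g g)" by (rule ip_cauchy_schwarz[OF assms that(1)])
    also have "\<dots> \<le> sqrt (ip h h) * 1" using that(2) ip_nonneg by (intro mult_left_mono) auto
    finally show ?thesis by simp
  qed
  then show "\<bar>ip h (cs \<sigma>)\<bar> \<le> sqrt (ip h h)" "\<bar>ip h (sn \<sigma>)\<bar> \<le> sqrt (ip h h)"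
    by (auto simp: sqint_cs sqint_sn ip_trig_self_le)
qed

text \<open>Finite dimension in quantitative form. It supplies the hypothesis \<open>ctrl\<close> of
  \<open>dissipative_ode\<close>.\<close>

lemma tr_bound_L2: "sqint h \<Longrightarrow> \<bar>tr h z\<bar> \<le> Sc * sqrt (ip h h)"
  by (rule tr_td_bound(1)) (auto intro: ip_trig_L2)

lemma ip_bound_sup:
  assumes "continuous_on UNIV f" "continuous_on UNIV g" "\<And>z. z \<in> space phase \<Longrightarrow> \<bar>f z\<bar> \<le> a" "\<And>z. z \<in> space phase \<Longrightarrow> \<bar>g z\<bar> \<le> b" "0 \<le> a"
  shows "\<bar>ip f g\<bar> \<le> a * b"
proof -
  have "\<bar>ip f g\<bar> \<le> (LINT z|phase. \<bar>f z * g z\<bar>)" unfolding ip_def by (rule integral_abs_bound)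
  also have "\<dots> \<le> (LINT z|phase. a * b)"
    using assms by (intro integral_mono integrable_phase_continuous continuous_intros) (auto simp: abs_mult intro!: mult_mono)
  finally show ?thesis by simp
qed

lemma ip_trig_sup:
  assumes "continuous_on UNIV f" "\<And>z. z \<in> space phase \<Longrightarrow> \<bar>f z\<bar> \<le> a" "0 \<le> a"
  shows "\<bar>ip f (cs \<sigma>)\<bar> \<le> a" "\<bar>ip f (sn \<sigma>)\<bar> \<le> a"
  using ip_bound_sup[OF assms(1) continuous_cs assms(2) _ assms(3), of \<sigma> 1]
    ip_bound_sup[OF assms(1) continuous_sn assms(2) _ assms(3), of \<sigma> 1]
  by (auto simp: cs_def sn_def)

text \<open>Coefficients see \<open>f\<close> only on \<open>phase\<close>, so a bound there yields
  one at every point. This is essential for \<open>rhs\<close>, whose factor \<open>v\<close> is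
  unbounded outside the velocity cell.\<close>

lemma tr_bound_sup: "continuous_on UNIV f \<Longrightarrow> (\<And>z. z \<in> space phase \<Longrightarrow> \<bar>f z\<bar> \<le> a) \<Longrightarrow> 0 \<le> a \<Longrightarrow> \<bar>tr f z\<bar> \<le> Sc * a"
  by (rule tr_td_bound(1)) (auto intro: ip_trig_sup)

lemma td_bound_sup: "continuous_on UNIV f \<Longrightarrow> (\<And>z. z \<in> space phase \<Longrightarrow> \<bar>f z\<bar> \<le> a) \<Longrightarrow> 0 \<le> a \<Longrightarrow> \<bar>td j f z\<bar> \<le> Dc * a"
  by (rule tr_td_bound(2)) (auto intro: ip_trig_sup)

end

section \<open>The collision operator and the energy inequalities\<close>

text \<open>The gauge integral is where the continuity and Leibniz rules for parameter integrals
  over a box are applied to moments.\<close>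

lemma vel_integral_HK:
  fixes f :: "real^3 \<Rightarrow> real"
  assumes "continuous_on UNIV f"
  shows "(LINT v|vel. f v) = integral (cbox (\<chi> i. -1/2) (\<chi> i. 1/2)) f"
proof -
  let ?W = "cbox (\<chi> i. -1/2) (\<chi> i. 1/2) :: (real^3) set"
  have "set_integrable lborel ?W f"
    unfolding set_integrable_def using assms by (intro borel_integrable_compact compact_cbox continuous_on_subset[OF assms]) auto
  then have "(LINT v:?W|lborel. f v) = integral ?W f" by (rule set_borel_integral_eq_integral(2))
  then show ?thesis
    unfolding vel_def set_lebesgue_integral_def by (subst integral_restrict_space) auto
qed

lemma continuous_slice: "continuous_on UNIV h \<Longrightarrow> continuous_on S (\<lambda>v. h (x, v))"
  by (rule continuous_on_compose2[of UNIV h]) (auto intro!: continuous_intros)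

lemma continuous_moment:
  assumes h: "continuous_on UNIV h" and e: "continuous_on UNIV e"
  shows "continuous_on UNIV (moment h e)"
proof -
  have "moment h e = (\<lambda>x. integral (cbox (\<chi> i. -1/2) (\<chi> i. 1/2)) (\<lambda>v. h (x, v) * e v))"
    unfolding moment_def[abs_def] by (rule ext, rule vel_integral_HK) (intro continuous_intros continuous_slice[OF h] e)
  moreover have "continuous_on UNIV (\<lambda>x. integral (cbox (\<chi> i. -1/2) (\<chi> i. 1/2)) (\<lambda>v. h (x, v) * e v))"
    by (rule integral_continuous_on_param)
       (auto simp: case_prod_beta' intro!: continuous_intros continuous_on_subset[OF h] continuous_on_compose2[OF e])
  ultimately show ?thesis by simp
qed

lemma xder_derivative_at:
  assumes "xder j h h'"
  shows "((\<lambda>t. h (x + t *\<^sub>R axis j 1, v)) has_real_derivative h' (x + s *\<^sub>R axis j 1, v)) (at s)"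
proof -
  have "((\<lambda>t. h ((x + s *\<^sub>R axis j 1) + t *\<^sub>R axis j 1, v)) has_real_derivative h' (x + s *\<^sub>R axis j 1, v)) (at 0)"
    using assms by (simp add: xder_def)
  then have "((\<lambda>t. h (x + (t + s) *\<^sub>R axis j 1, v)) has_real_derivative h' (x + s *\<^sub>R axis j 1, v)) (at 0)"
    by (simp add: scaleR_add_left ac_simps)
  then show ?thesis using DERIV_shift[of "\<lambda>t. h (x + t *\<^sub>R axis j 1, v)" _ 0 s] by simp
qed

lemma xder_moment:
  assumes h: "xder j h h'" and e: "continuous_on UNIV e"
  shows "xder j (\<lambda>z. moment h e (fst z)) (\<lambda>z. moment h' e (fst z))"
proof -
  let ?W = "cbox (\<chi> i. -1/2) (\<chi> i. 1/2) :: (real^3) set"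
  note ch = xder_continuous[OF h, of UNIV]
  have HK: "moment h e x = integral ?W (\<lambda>v. h (x, v) * e v)" "moment h' e x = integral ?W (\<lambda>v. h' (x, v) * e v)" for x
    unfolding moment_def[abs_def] by (rule vel_integral_HK, intro continuous_intros continuous_slice[OF ch(1)] continuous_slice[OF ch(2)] e)+
  have "((\<lambda>t. moment h e (x + t *\<^sub>R axis j 1)) has_real_derivative moment h' e (x + 0 *\<^sub>R axis j 1)) (at 0)" for x
    unfolding HK
  proof (rule leibniz_rule_field_derivative[where U=UNIV])
    show "((\<lambda>s. h (x + s *\<^sub>R axis j 1, v) * e v) has_real_derivative h' (x + s *\<^sub>R axis j 1, v) * e v) (at s)" for s v
      by (intro DERIV_cmult_right xder_derivative_at h)
    show "(\<lambda>v. h (x + s *\<^sub>R axis j 1, v) * e v) integrable_on ?W" for s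
      by (intro integrable_continuous continuous_intros continuous_slice[OF ch(1)] continuous_on_subset[OF e]) auto
    show "continuous_on (UNIV \<times> ?W) (\<lambda>(s, v). h' (x + s *\<^sub>R axis j 1, v) * e v)"
      unfolding case_prod_beta'
      by (intro continuous_intros continuous_on_compose2[OF ch(2)] continuous_on_compose2[OF e]) auto
  qed auto
  moreover have "moment h e (x + axis i 1) = moment h e x" "moment h' e (x + axis i 1) = moment h' e x" for x i
    using h by (auto simp: moment_def xder_def)
  moreover have "continuous_on UNIV (\<lambda>z::(real^3)\<times>(real^3). moment h e (fst z))" "continuous_on UNIV (\<lambda>z::(real^3)\<times>(real^3). moment h' e (fst z))"
    by (intro continuous_on_compose2[OF continuous_moment[OF ch(1) e]] continuous_on_compose2[OF continuous_moment[OF ch(2) e]] continuous_intros; simp)+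
  ultimately show ?thesis unfolding xder_def by simp
qed

lemma xder_v: "xder j f f' \<Longrightarrow> continuous_on UNIV a \<Longrightarrow> xder j (\<lambda>z. a (snd z) * f z) (\<lambda>z. a (snd z) * f' z)"
  using xder_mult[OF xder_const_x, of a j f f'] by (simp add: case_prod_beta')

text \<open>A weight in \<open>v\<close> alone commutes with the \<open>x\<close>-derivative, so
  integration by parts shows that the number equals its own negative.\<close>

lemma ip_transport_eq_0:
  assumes "xder j q q'" "continuous_on UNIV a"
  shows "ip q (\<lambda>z. a (snd z) * q' z) = 0"
proof -
  have "ip q' (\<lambda>z. a (snd z) * q z) = ip q (\<lambda>z. a (snd z) * q' z)"
    unfolding ip_def by (simp add: mult_ac)
  then show ?thesis using xder_ip[OF assms(1) xder_v[OF assms]] by simp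
qed

text \<open>\<open>Proj\<close> for an arbitrary list of velocity functions. The estimates use only
  orthonormality and continuity of the list, so the collision invariants enter at the very
  end.\<close>

definition projb :: "(real^3 \<Rightarrow> real) list \<Rightarrow> density \<Rightarrow> density" where
  "projb bs h z = (\<Sum>i<length bs. moment h (bs ! i) (fst z) * (bs ! i) (snd z))"

definition lopb :: "(real^3 \<Rightarrow> real) list \<Rightarrow> density \<Rightarrow> density" where
  "lopb bs h z = h z - projb bs h z"

locale velocity_basis =
  fixes bs :: "(real^3 \<Rightarrow> real) list"
  assumes orth: "orthonormal_v bs" and cont: "i < length bs \<Longrightarrow> continuous_on UNIV (bs ! i)"
begin

lemma xder_projb: "xder j h h' \<Longrightarrow> xder j (projb bs h) (projb bs h')"
  unfolding projb_def[abs_def]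
proof (intro xder_sum)
  fix i assume "i \<in> {..<length bs}" "xder j h h'"
  then have "xder j (\<lambda>z. (bs ! i) (snd z) * moment h (bs ! i) (fst z)) (\<lambda>z. (bs ! i) (snd z) * moment h' (bs ! i) (fst z))"
    using cont by (intro xder_v xder_moment) auto
  then show "xder j (\<lambda>z. moment h (bs ! i) (fst z) * (bs ! i) (snd z)) (\<lambda>z. moment h' (bs ! i) (fst z) * (bs ! i) (snd z))"
    by (simp add: mult.commute)
qed

lemma xder_lopb: "xder j h h' \<Longrightarrow> xder j (lopb bs h) (lopb bs h')"
  unfolding lopb_def[abs_def] by (intro xder_diff xder_projb)

lemma continuous_projb:
  assumes h: "continuous_on UNIV h" shows "continuous_on T (projb bs h)"
  unfolding projb_def[abs_def]
proof (intro continuous_on_sum continuous_on_mult)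
  fix i assume "i \<in> {..<length bs}"
  then have i: "i < length bs" by simp
  show "continuous_on T (\<lambda>z. moment h (bs ! i) (fst z))"
    by (rule continuous_on_compose2[OF continuous_moment[OF h cont[OF i]]]) (auto intro!: continuous_intros)
  show "continuous_on T (\<lambda>z. (bs ! i) (snd z))"
    by (rule continuous_on_compose2[OF cont[OF i]]) (auto intro!: continuous_intros)
qed

lemma continuous_lopb: "continuous_on UNIV h \<Longrightarrow> continuous_on T (lopb bs h)"
  unfolding lopb_def[abs_def] by (intro continuous_intros continuous_projb) (auto elim: continuous_on_subset)

lemma integrable_vel_mult: "continuous_on UNIV h \<Longrightarrow> i < length bs \<Longrightarrow> integrable vel (\<lambda>v. h (x, v) * (bs ! i) v)"
  by (intro integrable_vel_continuous continuous_intros continuous_slice cont)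

lemma ip_projb:
  assumes p: "continuous_on UNIV p" and q: "continuous_on UNIV q"
  shows "ip (projb bs p) q = (\<Sum>i<length bs. LINT x|torus. moment p (bs ! i) x * moment q (bs ! i) x)"
proof -
  have s: "continuous_on UNIV (\<lambda>z. moment p (bs ! i) (fst z) * (bs ! i) (snd z))" if i: "i < length bs" for i
    by (intro continuous_intros continuous_on_compose2[OF continuous_moment[OF p cont[OF i]]] continuous_on_compose2[OF cont[OF i]]) auto
  have "ip (projb bs p) q = (\<Sum>i<length bs. ip (\<lambda>z. moment p (bs ! i) (fst z) * (bs ! i) (snd z)) q)"
    unfolding projb_def[abs_def] by (rule ip_sum_left) (auto intro!: sqint_continuous s q)
  also have "\<dots> = (\<Sum>i<length bs. LINT x|torus. moment p (bs ! i) x * moment q (bs ! i) x)"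
  proof (intro sum.cong refl)
    fix i assume "i \<in> {..<length bs}"
    then have i: "i < length bs" by simp
    have "ip (\<lambda>z. moment p (bs ! i) (fst z) * (bs ! i) (snd z)) q = (LINT x|torus. LINT v|vel. moment p (bs ! i) x * (bs ! i) v * q (x, v))"
      unfolding ip_def by (subst integral_phase_iterated(2)) (auto intro!: integrable_phase_continuous continuous_on_mult s[OF i] q)
    also have "\<dots> = (LINT x|torus. LINT v|vel. moment p (bs ! i) x * (q (x, v) * (bs ! i) v))"
      by (simp add: mult_ac)
    finally show "ip (\<lambda>z. moment p (bs ! i) (fst z) * (bs ! i) (snd z)) q = (LINT x|torus. moment p (bs ! i) x * moment q (bs ! i) x)"
      by (simp add: moment_def)
  qed
  finally show ?thesis .
qed

lemma projb_selfadjoint: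
  assumes p: "continuous_on UNIV p" and q: "continuous_on UNIV q"
  shows "ip (projb bs p) q = ip p (projb bs q)"
  using ip_projb[OF p q] ip_projb[OF q p] by (simp add: ip_commute[of p] mult.commute)

lemma projb_projb:
  assumes p: "continuous_on UNIV p" shows "projb bs (projb bs p) = projb bs p"
proof -
  have "moment (projb bs p) (bs ! i) x = moment p (bs ! i) x" if i: "i < length bs" for i x
  proof -
    have "moment (projb bs p) (bs ! i) x = (LINT v|vel. (\<Sum>k<length bs. moment p (bs ! k) x * ((bs ! k) v * (bs ! i) v)))"
      by (simp add: moment_def[of "projb bs p"] projb_def sum_distrib_right mult.assoc)
    also have "\<dots> = (\<Sum>k<length bs. (LINT v|vel. moment p (bs ! k) x * ((bs ! k) v * (bs ! i) v)))"
      using i by (intro Bochner_Integration.integral_sum integrable_mult_right integrable_vel_continuous continuous_on_mult cont) auto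
    also have "\<dots> = (\<Sum>k<length bs. moment p (bs ! k) x * (if k = i then 1 else 0))"
      using orth i by (intro sum.cong refl) (simp add: orthonormal_v_def)
    also have "\<dots> = moment p (bs ! i) x" using i by (simp add: if_distrib sum.delta cong: if_cong)
    finally show ?thesis .
  qed
  then show ?thesis by (intro ext) (simp add: projb_def[of bs "projb bs p"] projb_def[of bs p])
qed

text \<open>\<open>projb\<close> is self-adjoint and idempotent; the complementary projection
  inherits both properties.\<close>

lemma ip_lopb:
  assumes p: "continuous_on UNIV p" and q: "continuous_on UNIV q"
  shows "ip p (lopb bs q) = ip (lopb bs p) (lopb bs q)" "ip p (lopb bs q) = ip q (lopb bs p)"
proof -
  note s = sqint_continuous[OF p] sqint_continuous[OF q] sqint_continuous[OF continuous_projb[OF p]] sqint_continuous[OF continuous_projb[OF q]]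
  have "ip (projb bs p) (projb bs q) = ip p (projb bs q)"
    using projb_selfadjoint[OF p continuous_projb[OF q]] projb_projb[OF q] by simp
  then show "ip p (lopb bs q) = ip (lopb bs p) (lopb bs q)"
    unfolding lopb_def[abs_def] using s projb_selfadjoint[OF p q]
    by (simp add: ip_diff_left ip_diff_right sqint_diff)
  show "ip p (lopb bs q) = ip q (lopb bs p)"
    unfolding lopb_def[abs_def] using s projb_selfadjoint[OF p q]
    by (simp add: ip_diff_right ip_commute[of q p] ip_commute[of q "projb bs p"])
qed

lemma lopb_add:
  assumes p: "continuous_on UNIV p" and q: "continuous_on UNIV q"
  shows "lopb bs (\<lambda>z. p z + q z) z = lopb bs p z + lopb bs q z"
proof -
  have "moment (\<lambda>z. p z + q z) (bs ! i) x = moment p (bs ! i) x + moment q (bs ! i) x" if "i < length bs" for i x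
    using integrable_vel_mult[OF p that] integrable_vel_mult[OF q that] by (simp add: moment_def distrib_right)
  then show ?thesis by (simp add: lopb_def projb_def distrib_right sum.distrib)
qed

lemma lopb_cmult: "lopb bs (\<lambda>z. c * p z) z = c * lopb bs p z"
  by (simp add: lopb_def projb_def moment_def mult.assoc right_diff_distrib sum_distrib_left)

lemma lopb_diff:
  assumes "continuous_on UNIV p" "continuous_on UNIV q"
  shows "lopb bs (\<lambda>z. p z - q z) z = lopb bs p z - lopb bs q z"
  using lopb_add[OF assms(1), of "\<lambda>z. - 1 * q z" z] lopb_cmult[of "- 1" q z] assms by (simp add: continuous_on_minus)

lemma lopb_bound:
  obtains M where "M \<ge> 0" "\<And>h a z. continuous_on UNIV h \<Longrightarrow> (\<And>z. z \<in> space phase \<Longrightarrow> \<bar>h z\<bar> \<le> a) \<Longrightarrow> 0 \<le> a \<Longrightarrow>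
    z \<in> space phase \<Longrightarrow> \<bar>lopb bs h z\<bar> \<le> M * a"
proof -
  have "\<exists>m. m \<ge> 0 \<and> (\<forall>v\<in>space vel. \<bar>(bs ! i) v\<bar> \<le> m)" if i: "i < length bs" for i
  proof -
    have "bounded ((bs ! i) ` space vel)"
      unfolding space_vel by (intro compact_imp_bounded compact_continuous_image continuous_on_subset[OF cont[OF i]]) auto
    then obtain m where "\<forall>v\<in>space vel. \<bar>(bs ! i) v\<bar> \<le> m" unfolding bounded_iff by auto
    then show ?thesis by (intro exI[of _ "max m 0"]) (auto simp: le_max_iff_disj)
  qed
  then obtain m where m: "\<And>i. i < length bs \<Longrightarrow> m i \<ge> 0" "\<And>i v. i < length bs \<Longrightarrow> v \<in> space vel \<Longrightarrow> \<bar>(bs ! i) v\<bar> \<le> m i"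
    by metis
  show ?thesis
  proof (rule that)
    \<comment> \<open>The 1 is for \<open>h\<close> itself. Each basis function is paid for twice,
      in the moment over a cell of mass 1 and as a factor.\<close>
    show "0 \<le> 1 + (\<Sum>i<length bs. m i * m i)" using m(1) by (intro add_nonneg_nonneg sum_nonneg mult_nonneg_nonneg) auto
    fix h :: density and a z
    assume h: "continuous_on UNIV h" "\<And>z. z \<in> space phase \<Longrightarrow> \<bar>h z\<bar> \<le> a" "0 \<le> a" and z: "z \<in> space phase"
    have zz: "fst z \<in> space torus" "snd z \<in> space vel" using z by (auto simp: space_phase)
    have "\<bar>moment h (bs ! i) (fst z) * (bs ! i) (snd z)\<bar> \<le> (a * m i) * m i" if i: "i < length bs" for i
    proof -
      have "\<bar>moment h (bs ! i) (fst z)\<bar> \<le> (LINT v|vel. \<bar>h (fst z, v) * (bs ! i) v\<bar>)"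
        unfolding moment_def by (rule integral_abs_bound)
      also have "\<dots> \<le> (LINT v|vel. a * m i)"
      proof (rule integral_mono)
        show "integrable vel (\<lambda>v. \<bar>h (fst z, v) * (bs ! i) v\<bar>)" using integrable_vel_mult[OF h(1) i] by simp
        fix v assume "v \<in> space vel"
        then show "\<bar>h (fst z, v) * (bs ! i) v\<bar> \<le> a * m i"
          using h(2)[of "(fst z, v)"] h(3) m(2)[OF i] zz unfolding abs_mult by (intro mult_mono) (auto simp: space_phase)
      qed simp
      finally show ?thesis unfolding abs_mult using m(2)[OF i zz(2)] m(1)[OF i] h(3) by (intro mult_mono) auto
    qed
    then have "\<bar>projb bs h z\<bar> \<le> (\<Sum>i<length bs. (a * m i) * m i)"
      unfolding projb_def by (intro order_trans[OF sum_abs] sum_mono) auto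
    then have "\<bar>lopb bs h z\<bar> \<le> a + (\<Sum>i<length bs. (a * m i) * m i)"
      unfolding lopb_def using h(2)[OF z] by linarith
    also have "\<dots> = (1 + (\<Sum>i<length bs. m i * m i)) * a"
      by (simp only: distrib_right mult_1 sum_distrib_right) (simp add: mult_ac)
    finally show "\<bar>lopb bs h z\<bar> \<le> (1 + (\<Sum>i<length bs. m i * m i)) * a" .
  qed
qed

end

section \<open>The Galerkin field and its energy balance\<close>

locale galerkin = fourier_set S + velocity_basis bs for S bs +
  fixes \<epsilon> \<nu> \<kappa> :: real
  assumes pos: "0 < \<epsilon>" "0 < \<nu>" "0 < \<kappa>"
begin

text \<open>The equation divided by \<open>\<epsilon>\<^sup>2\<close> and before the outer
  truncation: the vector field is \<open>tr (rhs p)\<close>. Writing transport with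
  \<open>td\<close> makes it a function without any choice of representative.\<close>

definition rhs :: "density \<Rightarrow> density" where
  "rhs p z = - (1 / \<epsilon>) * (\<Sum>k\<in>UNIV. snd z $ k * td k p z) - (1 / (\<epsilon>\<^sup>2 * \<nu>)) * lopb bs p z
     + (\<kappa> / (\<epsilon> * \<nu>)) * lopb bs (\<lambda>y. (p y)\<^sup>2) z - (\<kappa>\<^sup>2 / \<nu>) * (p z) ^ 3"

text \<open>The \<open>x\<close>-derivative of \<open>rhs p\<close>: differentiation commutes with
  the velocity weights and with \<open>lopb\<close>, and the product rule brings in the 2 and the
  3.\<close>

definition rhs' :: "3 \<Rightarrow> density \<Rightarrow> density" where
  "rhs' j p z = - (1 / \<epsilon>) * (\<Sum>k\<in>UNIV. snd z $ k * td k (td j p) z) - (1 / (\<epsilon>\<^sup>2 * \<nu>)) * lopb bs (td j p) z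
     + (\<kappa> / (\<epsilon> * \<nu>)) * lopb bs (\<lambda>y. 2 * (p y * td j p y)) z - (\<kappa>\<^sup>2 / \<nu>) * (3 * ((p z)\<^sup>2 * td j p z))"

lemma xder_rhs:
  assumes p: "tr p = p" shows "xder j (rhs p) (rhs' j p)"
proof -
  have xp: "xder j p (td j p)" using xder_tr[of j p] by (simp add: p)
  have x2: "xder j (\<lambda>y. (p y)\<^sup>2) (\<lambda>y. 2 * (p y * td j p y))"
    using xder_mult[OF xp xp] by (simp add: power2_eq_square mult.commute[of "td j p _"])
  have x3: "xder j (\<lambda>y. (p y)^3) (\<lambda>y. 3 * ((p y)\<^sup>2 * td j p y))"
  proof -
    have e: "td j p y * (p y)\<^sup>2 + p y * (2 * (p y * td j p y)) = 3 * ((p y)\<^sup>2 * td j p y)" for y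
      by (simp add: power2_eq_square)
    show ?thesis using xder_mult[OF xp x2] unfolding e by (simp add: power2_eq_square power3_eq_cube mult.assoc)
  qed
  have xt: "xder j (\<lambda>z. snd z $ k * td k p z) (\<lambda>z. snd z $ k * td k (td j p) z)" for k
    using xder_v[OF xder_td[of j k p], of "\<lambda>v. v $ k"] by (simp add: td_td_commute[of j k] continuous_intros)
  show ?thesis
    unfolding rhs_def[abs_def] rhs'_def[abs_def]
    by (intro xder_add xder_diff xder_cmult xder_sum xt xder_lopb xp x2 x3)
qed

lemma ip_young:
  assumes "sqint L" "sqint w"
  shows "2 * c * ip w L \<le> ip L L + c\<^sup>2 * ip w w"
proof -
  have "0 \<le> ip (\<lambda>z. L z - c * w z) (\<lambda>z. L z - c * w z)" by (rule ip_nonneg)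
  also have "\<dots> = ip L L - 2 * c * ip w L + c\<^sup>2 * ip w w"
    using assms by (simp add: ip_diff_left ip_diff_right ip_cmult_left ip_cmult_right sqint_diff sqint_cmult
        ip_commute[of L w] power2_eq_square right_diff_distrib)
  finally show ?thesis by simp
qed

lemma continuous_tr_eq: "tr p = p \<Longrightarrow> continuous_on T p"
  using continuous_tr[of T p] by simp

lemma ip_transport_sum:
  assumes "tr q = q"
  shows "ip q (\<lambda>z. \<Sum>k\<in>UNIV. snd z $ k * td k q z) = 0"
proof -
  have x: "xder k q (td k q)" for k using xder_tr[of k q] by (simp add: assms)
  have c: "continuous_on UNIV (\<lambda>z::(real^3)\<times>(real^3). snd z $ k * td k q z)" for k
    by (intro continuous_intros continuous_td)
  have "ip q (\<lambda>z. \<Sum>k\<in>UNIV. snd z $ k * td k q z) = (\<Sum>k\<in>UNIV. ip q (\<lambda>z. snd z $ k * td k q z))"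
    by (rule ip_sum_right) (auto intro!: sqint_continuous c continuous_tr_eq assms)
  then show ?thesis using ip_transport_eq_0[OF x, of "\<lambda>v. v $ k" for k] by (simp add: continuous_intros)
qed

text \<open>One computation for both energy levels: \<open>w\<close> and \<open>u\<close> are the
  square and the cube of \<open>p\<close> for \<open>q = p\<close>, and their
  \<open>x\<close>-derivatives for \<open>q = td j p\<close>. Self-adjointness moves
  \<open>lopb\<close> from \<open>w\<close> to \<open>q\<close>, so the quadratic term is measured
  against the dissipation.\<close>

lemma ip_rhs_form:
  assumes T: "continuous_on UNIV T" "ip q T = 0" and c: "continuous_on UNIV q" "continuous_on UNIV w" "continuous_on UNIV u"
  shows "ip q (\<lambda>z. - (1 / \<epsilon>) * T z - (1 / (\<epsilon>\<^sup>2 * \<nu>)) * lopb bs q z + (\<kappa> / (\<epsilon> * \<nu>)) * lopb bs w z - (\<kappa>\<^sup>2 / \<nu>) * u z)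
    = (- ip (lopb bs q) (lopb bs q) + \<epsilon> * \<kappa> * ip w (lopb bs q) - (\<epsilon> * \<kappa>)\<^sup>2 * ip q u) / (\<epsilon>\<^sup>2 * \<nu>)"
proof -
  note s = sqint_continuous[OF c(1)] sqint_continuous[OF c(2)] sqint_continuous[OF c(3)] sqint_continuous[OF T(1)]
    sqint_continuous[OF continuous_lopb[OF c(1)]] sqint_continuous[OF continuous_lopb[OF c(2)]]
  have "ip q (\<lambda>z. - (1 / \<epsilon>) * T z - (1 / (\<epsilon>\<^sup>2 * \<nu>)) * lopb bs q z + (\<kappa> / (\<epsilon> * \<nu>)) * lopb bs w z - (\<kappa>\<^sup>2 / \<nu>) * u z)
    = - (1 / \<epsilon>) * ip q T - (1 / (\<epsilon>\<^sup>2 * \<nu>)) * ip q (lopb bs q) + (\<kappa> / (\<epsilon> * \<nu>)) * ip q (lopb bs w) - (\<kappa>\<^sup>2 / \<nu>) * ip q u"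
    by (simp only: ip_add_right ip_diff_right ip_cmult_right s sqint_add sqint_diff sqint_cmult)
  also have "ip q (lopb bs w) = ip w (lopb bs q)" by (rule ip_lopb(2)[OF c(1,2)])
  also have "ip q (lopb bs q) = ip (lopb bs q) (lopb bs q)" by (rule ip_lopb(1)[OF c(1,1)])
  finally have E: "ip q (\<lambda>z. - (1 / \<epsilon>) * T z - (1 / (\<epsilon>\<^sup>2 * \<nu>)) * lopb bs q z + (\<kappa> / (\<epsilon> * \<nu>)) * lopb bs w z - (\<kappa>\<^sup>2 / \<nu>) * u z)
    = - (1 / \<epsilon>) * ip q T - (1 / (\<epsilon>\<^sup>2 * \<nu>)) * ip (lopb bs q) (lopb bs q) + (\<kappa> / (\<epsilon> * \<nu>)) * ip w (lopb bs q) - (\<kappa>\<^sup>2 / \<nu>) * ip q u" .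
  show ?thesis unfolding E using T(2) pos by (simp add: field_simps power2_eq_square)
qed

lemma continuous_transport_sum: "continuous_on UNIV (\<lambda>z. \<Sum>k\<in>UNIV. snd z $ k * td k q z)"
  by (intro continuous_intros continuous_td)

lemma energy_L2:
  assumes p: "tr p = p"
  shows "ip p (rhs p) \<le> - (1 / (2 * \<epsilon>\<^sup>2 * \<nu>)) * ip (lopb bs p) (lopb bs p)"
proof -
  have c: "continuous_on UNIV p" "continuous_on UNIV (\<lambda>y. (p y)\<^sup>2)" "continuous_on UNIV (\<lambda>y. (p y)^3)"
    using continuous_tr_eq[OF p] by (auto intro!: continuous_intros)
  let ?L = "lopb bs p" and ?w = "\<lambda>y. (p y)\<^sup>2"
  have "ip p (\<lambda>y. (p y)^3) = ip ?w ?w" by (simp add: ip_def power2_eq_square power3_eq_cube mult.assoc)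
  then have "ip p (rhs p) = (- ip ?L ?L + \<epsilon> * \<kappa> * ip ?w ?L - (\<epsilon> * \<kappa>)\<^sup>2 * ip ?w ?w) / (\<epsilon>\<^sup>2 * \<nu>)"
    unfolding rhs_def[abs_def]
    using ip_rhs_form[OF continuous_transport_sum ip_transport_sum[OF p] c] by simp
  also have "\<dots> \<le> (- ip ?L ?L / 2) / (\<epsilon>\<^sup>2 * \<nu>)"
  proof (rule divide_right_mono)
    \<comment> \<open>Half of this inequality uses up half of the dissipation and half of the cubic
      term; the remaining cubic half has the good sign.\<close>
    have "2 * (\<epsilon> * \<kappa>) * ip ?w ?L \<le> ip ?L ?L + (\<epsilon> * \<kappa>)\<^sup>2 * ip ?w ?w"
      by (intro ip_young sqint_continuous continuous_lopb c)
    moreover have "0 \<le> (\<epsilon> * \<kappa>)\<^sup>2 * ip ?w ?w" using ip_nonneg by simp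
    ultimately show "- ip ?L ?L + \<epsilon> * \<kappa> * ip ?w ?L - (\<epsilon> * \<kappa>)\<^sup>2 * ip ?w ?w \<le> - ip ?L ?L / 2"
      by linarith
  qed (use pos in simp)
  finally show ?thesis by (simp add: mult.assoc)
qed

text \<open>Integrating by parts twice moves the derivative of the test function onto \<^term>\<open>rhs p\<close>, so no
  commutator of the truncation with \<open>\<partial>\<^sub>j\<close> is needed.\<close>

lemma energy_derivative:
  assumes p: "tr p = p"
  shows "ip (td j p) (td j (tr (rhs p))) \<le> - (1 / (2 * \<epsilon>\<^sup>2 * \<nu>)) * ip (lopb bs (td j p)) (lopb bs (td j p))"
proof -
  let ?q = "td j p"
  have c: "continuous_on UNIV ?q" "continuous_on UNIV (\<lambda>y. 2 * (p y * ?q y))" "continuous_on UNIV (\<lambda>y. 3 * ((p y)\<^sup>2 * ?q y))"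
    "continuous_on UNIV (\<lambda>y. p y * ?q y)"
    using continuous_tr_eq[OF p] continuous_td[of UNIV j p] by (auto intro!: continuous_intros)
  let ?L = "lopb bs ?q" and ?w = "\<lambda>y. p y * ?q y"
  have sr: "sqint (rhs p)" using xder_continuous(1)[OF xder_rhs[OF p]] by (rule sqint_continuous)
  have "ip ?q (td j (tr (rhs p))) = - ip (td j ?q) (tr (rhs p))"
    using xder_ip[OF xder_td[of j j p] xder_tr[of j "tr (rhs p)"]] by (simp add: tr_tr)
  also have "ip (td j ?q) (tr (rhs p)) = ip (tr (td j ?q)) (rhs p)"
    by (rule tr_selfadjoint[symmetric]) (intro sqint_td sr)+
  also have "\<dots> = ip (td j ?q) (rhs p)" by (simp add: tr_td)
  also have "- \<dots> = ip ?q (rhs' j p)" using xder_ip[OF xder_td[of j j p] xder_rhs[OF p, of j]] by simp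
  also have "\<dots> = (- ip ?L ?L + \<epsilon> * \<kappa> * ip (\<lambda>y. 2 * ?w y) ?L - (\<epsilon> * \<kappa>)\<^sup>2 * ip ?q (\<lambda>y. 3 * ((p y)\<^sup>2 * ?q y))) / (\<epsilon>\<^sup>2 * \<nu>)"
    unfolding rhs'_def[abs_def]
    using ip_rhs_form[OF continuous_transport_sum ip_transport_sum[OF tr_td] c(1-3)] by simp
  also have "ip ?q (\<lambda>y. 3 * ((p y)\<^sup>2 * ?q y)) = 3 * ip ?w ?w"
  proof -
    have "ip ?q (\<lambda>y. (p y)\<^sup>2 * ?q y) = ip ?w ?w" by (simp add: ip_def power2_eq_square mult_ac)
    then show ?thesis by (simp add: ip_cmult_right)
  qed
  also have "ip (\<lambda>y. 2 * ?w y) ?L = 2 * ip ?w ?L" by (rule ip_cmult_left)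
  also have "(- ip ?L ?L + \<epsilon> * \<kappa> * (2 * ip ?w ?L) - (\<epsilon> * \<kappa>)\<^sup>2 * (3 * ip ?w ?w)) / (\<epsilon>\<^sup>2 * \<nu>) \<le> (- ip ?L ?L / 2) / (\<epsilon>\<^sup>2 * \<nu>)"
  proof (rule divide_right_mono)
    \<comment> \<open>The doubled constant answers the factor 2 from the differentiated square. Half
      of the inequality costs twice \<open>(\<epsilon> * \<kappa>)\<^sup>2 * ip ?w ?w\<close>, of
      which the differentiated cube supplies three.\<close>
    have "2 * (2 * (\<epsilon> * \<kappa>)) * ip ?w ?L \<le> ip ?L ?L + (2 * (\<epsilon> * \<kappa>))\<^sup>2 * ip ?w ?w"
      by (intro ip_young sqint_continuous continuous_lopb c)
    then have "4 * (\<epsilon> * \<kappa> * ip ?w ?L) \<le> ip ?L ?L + 4 * ((\<epsilon> * \<kappa>)\<^sup>2 * ip ?w ?w)"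
      by (simp add: power_mult_distrib)
    moreover have "0 \<le> (\<epsilon> * \<kappa>)\<^sup>2 * ip ?w ?w" using ip_nonneg by simp
    moreover have "\<epsilon> * \<kappa> * (2 * ip ?w ?L) = 2 * (\<epsilon> * \<kappa> * ip ?w ?L)" "(\<epsilon> * \<kappa>)\<^sup>2 * (3 * ip ?w ?w) = 3 * ((\<epsilon> * \<kappa>)\<^sup>2 * ip ?w ?w)" by simp_all
    ultimately show "- ip ?L ?L + \<epsilon> * \<kappa> * (2 * ip ?w ?L) - (\<epsilon> * \<kappa>)\<^sup>2 * (3 * ip ?w ?w) \<le> - ip ?L ?L / 2"
      by linarith
  qed (use pos in simp)
  finally show ?thesis by (simp add: mult.assoc)
qed

end

section \<open>The Galerkin system\<close>

text \<open>The ambient Banach space for the differential equation. The finite-dimensional space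
  itself appears only as the range of \<open>Lb\<close>.\<close>

type_synonym bdensity = "((real^3) \<times> (real^3)) \<Rightarrow>\<^sub>C real"

instance bcontfun :: (metric_space, banach) banach ..

lemmas bcontfun_rep_eq = plus_bcontfun.rep_eq minus_bcontfun.rep_eq scaleR_bcontfun.rep_eq zero_bcontfun.rep_eq

lemma continuous_bdensity: "continuous_on T (apply_bcontfun (c :: bdensity))" by simp

lemma sqint_bdensity: "sqint (apply_bcontfun (c :: bdensity))"
  by (intro sqint_continuous continuous_bdensity)

lemma abs_bdensity_le: "\<bar>apply_bcontfun (c :: bdensity) z\<bar> \<le> norm c"
  using norm_bounded[of c z] by simp

lemma abs_velocity_le_1: "z \<in> space phase \<Longrightarrow> \<bar>snd z $ k\<bar> \<le> 1"
  by (cases z) (auto simp: space_phase space_vel mem_box_cart abs_le_iff dest!: spec[of _ k])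

lemma abs_ip_bdensity_le: "\<bar>ip (apply_bcontfun (c :: bdensity)) (apply_bcontfun d)\<bar> \<le> norm c * norm d"
  by (rule fourier_set.ip_bound_sup[OF fourier_set_freqs]) (auto intro: abs_bdensity_le)

abbreviation ipb :: "bdensity \<Rightarrow> bdensity \<Rightarrow> real" where
  "ipb c d \<equiv> ip (apply_bcontfun c) (apply_bcontfun d)"

lemma bounded_bilinear_ip: "bounded_bilinear ipb"
proof
  show "\<exists>K. \<forall>a b. norm (ipb a b) \<le> norm a * norm b * K"
    using abs_ip_bdensity_le by (intro exI[of _ 1]) simp
qed (simp_all add: bcontfun_rep_eq ip_add_left ip_add_right ip_cmult_left ip_cmult_right sqint_bdensity)

context galerkin
begin

lemma tr_bcontfun: "sqint h \<Longrightarrow> tr h \<in> bcontfun"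
  by (rule bcontfun_normI[OF continuous_tr, where b="Sc * sqrt (ip h h)"]) (simp add: tr_bound_L2)

lemma td_bcontfun: "sqint h \<Longrightarrow> td j h \<in> bcontfun"
  by (rule bcontfun_normI[OF continuous_td, where b="Dc * sqrt (ip h h)"]) (simp add: tr_td_bound(2) ip_trig_L2)

definition Lb :: "bdensity \<Rightarrow> bdensity" where "Lb c = Bcontfun (tr c)"
definition Db :: "3 \<Rightarrow> bdensity \<Rightarrow> bdensity" where "Db j c = Bcontfun (td j c)"
text \<open>Passing to bounded functions has to wait for the truncation: \<open>rhs c\<close> need
  not be bounded because of the factor \<open>v\<close>.\<close>

definition Fb :: "bdensity \<Rightarrow> bdensity" where "Fb c = Bcontfun (tr (rhs c))"

lemma continuous_rhs: "continuous_on UNIV h \<Longrightarrow> continuous_on UNIV (rhs h)"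
  unfolding rhs_def[abs_def] by (intro continuous_intros continuous_lopb continuous_td; simp)

lemma apply_Lb: "apply_bcontfun (Lb c) = tr c"
  and apply_Db: "apply_bcontfun (Db j c) = td j c"
  and apply_Fb: "apply_bcontfun (Fb c) = tr (rhs c)"
  unfolding Lb_def Db_def Fb_def
  by (simp_all add: Bcontfun_inverse tr_bcontfun td_bcontfun sqint_bdensity sqint_continuous continuous_rhs)

lemma bounded_linear_Lb: "bounded_linear Lb"
proof (rule bounded_linear_intro)
  show "norm (Lb c) \<le> norm c * Sc" for c
    by (rule norm_bound) (simp add: apply_Lb mult.commute[of _ Sc] tr_bound_sup abs_bdensity_le)
qed (auto intro!: bcontfun_eqI simp: apply_Lb bcontfun_rep_eq tr_add tr_cmult sqint_bdensity)

lemma bounded_linear_Db: "bounded_linear (Db j)"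
proof (rule bounded_linear_intro)
  show "norm (Db j c) \<le> norm c * Dc" for c
    by (rule norm_bound) (simp add: apply_Db mult.commute[of _ Dc] td_bound_sup abs_bdensity_le)
qed (auto intro!: bcontfun_eqI simp: apply_Db bcontfun_rep_eq td_add td_cmult sqint_bdensity)

lemma Lb_eq_iff: "Lb c = c \<longleftrightarrow> tr c = apply_bcontfun c"
  by (metis apply_Lb apply_bcontfun_inverse)

lemma rhs_lipschitz:
  obtains Lr where "\<And>x y r. norm x \<le> r \<Longrightarrow> norm y \<le> r \<Longrightarrow> norm (Fb x - Fb y) \<le> Lr r * norm (x - y)"
proof -
  obtain M where M: "M \<ge> 0" "\<And>h a z. continuous_on UNIV h \<Longrightarrow> (\<And>z. z \<in> space phase \<Longrightarrow> \<bar>h z\<bar> \<le> a) \<Longrightarrow> 0 \<le> a \<Longrightarrow>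
    z \<in> space phase \<Longrightarrow> \<bar>lopb bs h z\<bar> \<le> M * a" using lopb_bound by blast
  \<comment> \<open>Term by term: three transport components, the projection bound \<open>M\<close>,
    and the factors \<open>2 * r\<close> and \<open>3 * r\<^sup>2\<close> from factoring differences
    of squares and of cubes.\<close>
  define K where "K r = (1 / \<epsilon>) * (3 * Dc) + (1 / (\<epsilon>\<^sup>2 * \<nu>)) * M + (\<kappa> / (\<epsilon> * \<nu>)) * (M * (2 * r)) + (\<kappa>\<^sup>2 / \<nu>) * (3 * r\<^sup>2)" for r
  show ?thesis
  proof (rule that[of "\<lambda>r. Sc * K r"])
    fix x y :: bdensity and r :: real
    assume r: "norm x \<le> r" "norm y \<le> r"
    then have r0: "0 \<le> r" using norm_ge_zero order_trans by blast
    define d where "d = norm (x - y)"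
    have d0: "0 \<le> d" by (simp add: d_def)
    have dz: "\<bar>apply_bcontfun x z - apply_bcontfun y z\<bar> \<le> d" for z
      using abs_bdensity_le[of "x - y" z] by (simp add: d_def bcontfun_rep_eq)
    have xr: "\<bar>apply_bcontfun x z\<bar> \<le> r" "\<bar>apply_bcontfun y z\<bar> \<le> r" for z
      using abs_bdensity_le[of x z] abs_bdensity_le[of y z] r by linarith+
    have c2: "continuous_on UNIV (\<lambda>z. (apply_bcontfun x z)\<^sup>2 - (apply_bcontfun y z)\<^sup>2)"
       "continuous_on UNIV (\<lambda>z. (apply_bcontfun x z)\<^sup>2)" "continuous_on UNIV (\<lambda>z. (apply_bcontfun y z)\<^sup>2)"
       "continuous_on UNIV (\<lambda>z. apply_bcontfun x z - apply_bcontfun y z)"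
      by (intro continuous_intros continuous_bdensity)+
    have d2: "\<bar>(apply_bcontfun x z)\<^sup>2 - (apply_bcontfun y z)\<^sup>2\<bar> \<le> 2 * r * d" for z
    proof -
      have "(apply_bcontfun x z)\<^sup>2 - (apply_bcontfun y z)\<^sup>2 = (apply_bcontfun x z + apply_bcontfun y z) * (apply_bcontfun x z - apply_bcontfun y z)"
        by (simp add: power2_eq_square algebra_simps)
      moreover have "\<bar>apply_bcontfun x z + apply_bcontfun y z\<bar> \<le> 2 * r" using xr[of z] by linarith
      ultimately show ?thesis unfolding abs_mult using dz[of z] r0 by (simp add: abs_mult mult_mono)
    qed
    have d3: "\<bar>(apply_bcontfun x z)^3 - (apply_bcontfun y z)^3\<bar> \<le> 3 * r\<^sup>2 * d" for z
    proof -
      let ?a = "apply_bcontfun x z" and ?b = "apply_bcontfun y z"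
      have e: "?a^3 - ?b^3 = (?a * ?a + ?a * ?b + ?b * ?b) * (?a - ?b)"
        by (simp add: power3_eq_cube algebra_simps)
      have "\<bar>?a * ?a\<bar> \<le> r * r" "\<bar>?a * ?b\<bar> \<le> r * r" "\<bar>?b * ?b\<bar> \<le> r * r"
        unfolding abs_mult using xr r0 by (intro mult_mono; simp)+
      then have "\<bar>?a * ?a + ?a * ?b + ?b * ?b\<bar> \<le> r * r + r * r + r * r" by linarith
      then have "\<bar>?a * ?a + ?a * ?b + ?b * ?b\<bar> \<le> 3 * r\<^sup>2" by (simp add: power2_eq_square)
      then show ?thesis unfolding e abs_mult using dz[of z] r0 by (intro mult_mono) auto
    qed
    have bound: "\<bar>rhs x z - rhs y z\<bar> \<le> K r * d" if z: "z \<in> space phase" for z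
    proof -
      have e: "rhs x z - rhs y z = - (1 / \<epsilon>) * (\<Sum>k\<in>UNIV. snd z $ k * td k (\<lambda>z. apply_bcontfun x z - apply_bcontfun y z) z)
          - (1 / (\<epsilon>\<^sup>2 * \<nu>)) * lopb bs (\<lambda>z. apply_bcontfun x z - apply_bcontfun y z) z
          + (\<kappa> / (\<epsilon> * \<nu>)) * lopb bs (\<lambda>z. (apply_bcontfun x z)\<^sup>2 - (apply_bcontfun y z)\<^sup>2) z
          - (\<kappa>\<^sup>2 / \<nu>) * ((apply_bcontfun x z)^3 - (apply_bcontfun y z)^3)"
        by (simp add: rhs_def td_diff sqint_bdensity lopb_diff c2 right_diff_distrib sum_subtractf)
      have t1: "\<bar>\<Sum>k\<in>UNIV. snd z $ k * td k (\<lambda>z. apply_bcontfun x z - apply_bcontfun y z) z\<bar> \<le> 3 * Dc * d"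
      proof -
        have "\<bar>snd z $ k * td k (\<lambda>z. apply_bcontfun x z - apply_bcontfun y z) z\<bar> \<le> 1 * (Dc * d)" for k
          unfolding abs_mult using abs_velocity_le_1[OF z] d0
          by (intro mult_mono td_bound_sup c2 dz) auto
        then have "\<bar>\<Sum>k\<in>UNIV. snd z $ k * td k (\<lambda>z. apply_bcontfun x z - apply_bcontfun y z) z\<bar> \<le> (\<Sum>k\<in>(UNIV::3 set). Dc * d)"
          by (intro order_trans[OF sum_abs] sum_mono) simp
        then show ?thesis by simp
      qed
      have t2: "\<bar>lopb bs (\<lambda>z. apply_bcontfun x z - apply_bcontfun y z) z\<bar> \<le> M * d"
        by (rule M(2)[OF c2(4) dz d0 z])
      have t3: "\<bar>lopb bs (\<lambda>z. (apply_bcontfun x z)\<^sup>2 - (apply_bcontfun y z)\<^sup>2) z\<bar> \<le> M * (2 * r * d)"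
        using r0 d0 by (intro M(2)[OF c2(1) d2 _ z]) simp
      have p: "0 \<le> 1 / \<epsilon>" "0 \<le> 1 / (\<epsilon>\<^sup>2 * \<nu>)" "0 \<le> \<kappa> / (\<epsilon> * \<nu>)" "0 \<le> \<kappa>\<^sup>2 / \<nu>" using pos by auto
      have "\<bar>rhs x z - rhs y z\<bar> \<le> (1 / \<epsilon>) * \<bar>\<Sum>k\<in>UNIV. snd z $ k * td k (\<lambda>z. apply_bcontfun x z - apply_bcontfun y z) z\<bar>
          + (1 / (\<epsilon>\<^sup>2 * \<nu>)) * \<bar>lopb bs (\<lambda>z. apply_bcontfun x z - apply_bcontfun y z) z\<bar>
          + (\<kappa> / (\<epsilon> * \<nu>)) * \<bar>lopb bs (\<lambda>z. (apply_bcontfun x z)\<^sup>2 - (apply_bcontfun y z)\<^sup>2) z\<bar>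
          + (\<kappa>\<^sup>2 / \<nu>) * \<bar>(apply_bcontfun x z)^3 - (apply_bcontfun y z)^3\<bar>"
      proof -
        have "\<bar>- a * A - b * B + c * C - e * E\<bar> \<le> a * \<bar>A\<bar> + b * \<bar>B\<bar> + c * \<bar>C\<bar> + e * \<bar>E\<bar>"
          if "0 \<le> a" "0 \<le> b" "0 \<le> c" "0 \<le> e" for a b c e A B C E :: real
        proof -
          have "\<bar>a * A\<bar> = a * \<bar>A\<bar>" "\<bar>b * B\<bar> = b * \<bar>B\<bar>" "\<bar>c * C\<bar> = c * \<bar>C\<bar>" "\<bar>e * E\<bar> = e * \<bar>E\<bar>" using that by (simp_all add: abs_mult)
          then show ?thesis by linarith
        qed
        from this[OF p] show ?thesis unfolding e .
      qed
      also have "\<dots> \<le> (1 / \<epsilon>) * (3 * Dc * d) + (1 / (\<epsilon>\<^sup>2 * \<nu>)) * (M * d) + (\<kappa> / (\<epsilon> * \<nu>)) * (M * (2 * r * d)) + (\<kappa>\<^sup>2 / \<nu>) * (3 * r\<^sup>2 * d)"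
        using p t1 t2 t3 d3 by (intro add_mono mult_left_mono) auto
      also have "\<dots> = K r * d" by (simp add: K_def algebra_simps)
      finally show ?thesis .
    qed
    have K0: "0 \<le> K r" unfolding K_def using pos M(1) r0 Dc_nonneg by (intro add_nonneg_nonneg mult_nonneg_nonneg) auto
    show "norm (Fb x - Fb y) \<le> Sc * K r * norm (x - y)"
    proof (rule norm_bound)
      fix z
      have s: "sqint (rhs x)" "sqint (rhs y)" by (intro sqint_continuous continuous_rhs continuous_bdensity)+
      have "apply_bcontfun (Fb x - Fb y) z = tr (\<lambda>z. rhs x z - rhs y z) z"
        by (simp add: bcontfun_rep_eq apply_Fb tr_diff s)
      also have "\<bar>\<dots>\<bar> \<le> Sc * (K r * d)"
        using K0 d0 bound by (intro tr_bound_sup continuous_intros continuous_rhs continuous_bdensity) auto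
      finally show "norm (apply_bcontfun (Fb x - Fb y) z) \<le> Sc * K r * norm (x - y)" by (simp add: d_def mult.assoc)
    qed
  qed
qed

text \<open>The interpretation below needs a term for the Lipschitz constants, while
  \<open>rhs_lipschitz\<close> gives only their existence.\<close>

definition lip_const :: "real \<Rightarrow> real" where
  "lip_const = (SOME L. \<forall>x y r. norm x \<le> r \<longrightarrow> norm y \<le> r \<longrightarrow> norm (Fb x - Fb y) \<le> L r * norm (x - y))"

sublocale ode: dissipative_ode ipb Lb Fb Sc lip_const
proof (rule dissipative_ode.intro)
  fix x y :: bdensity and r
  show "bounded_bilinear ipb" by (rule bounded_bilinear_ip)
  show "ipb x y = ipb y x" by (rule ip_commute)
  show "0 \<le> ipb x x" by (rule ip_nonneg)
  show "\<bar>ipb x y\<bar> \<le> norm x * norm y" by (rule abs_ip_bdensity_le)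
  show "bounded_linear Lb" by (rule bounded_linear_Lb)
  show "Lb (Lb x) = Lb x" by (rule bcontfun_eqI) (simp add: apply_Lb tr_tr)
  show "ip (Lb x) (Lb x) \<le> ip x x" by (simp add: apply_Lb tr_bessel sqint_bdensity)
  show "0 \<le> Sc" by (rule Sc_nonneg)
  show "norm (Lb x) \<le> Sc * sqrt (ip (Lb x) (Lb x))"
    by (rule norm_bound) (use tr_bound_L2[OF sqint_tr, of "apply_bcontfun x"] in \<open>simp add: apply_Lb tr_tr\<close>)
  show "Lb (Fb x) = Fb x" by (rule bcontfun_eqI) (simp add: apply_Lb apply_Fb tr_tr)
  \<comment> \<open>The outer truncation moves onto \<open>x\<close>, where it is the identity; the
    energy inequality for the untruncated field then suffices.\<close>
  show "ip x (Fb x) \<le> 0" if "Lb x = x"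
  proof -
    have p: "tr x = apply_bcontfun x" using that by (simp add: Lb_eq_iff)
    have "ip x (Fb x) = ip x (rhs x)"
      using tr_selfadjoint[OF sqint_bdensity[of x], of "rhs x"] by (simp add: apply_Fb p sqint_continuous continuous_rhs)
    also have "\<dots> \<le> - (1 / (2 * \<epsilon>\<^sup>2 * \<nu>)) * ip (lopb bs x) (lopb bs x)" by (rule energy_L2[OF p])
    also have "\<dots> \<le> 0" using pos ip_nonneg[of "lopb bs x"] by simp
    finally show ?thesis .
  qed
  show "norm (Fb x - Fb y) \<le> lip_const r * norm (x - y)" if "norm x \<le> r" "norm y \<le> r"
  proof -
    obtain L where "\<And>x y r. norm x \<le> r \<Longrightarrow> norm y \<le> r \<Longrightarrow> norm (Fb x - Fb y) \<le> L r * norm (x - y)"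
      using rhs_lipschitz by blast
    then have "\<forall>x y r. norm x \<le> r \<longrightarrow> norm y \<le> r \<longrightarrow> norm (Fb x - Fb y) \<le> lip_const r * norm (x - y)"
      unfolding lip_const_def by (intro someI[of "\<lambda>L. \<forall>x y r. norm x \<le> r \<longrightarrow> norm y \<le> r \<longrightarrow> norm (Fb x - Fb y) \<le> L r * norm (x - y)" L]) blast
    then show ?thesis using that by blast
  qed
qed

section \<open>Solutions of the Galerkin system and their energy\<close>

definition solution :: "(real \<Rightarrow> bdensity) \<Rightarrow> bool" where
  "solution u \<longleftrightarrow> Lb (u 0) = u 0 \<and> (\<forall>t\<ge>0. (u has_vector_derivative Fb (u t)) (at t within {0..}))"

lemma solution_exists:
  assumes "Lb x0 = x0" obtains u where "solution u" "u 0 = x0"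
proof -
  show ?thesis using ode.existence[OF assms] that assms unfolding solution_def by metis
qed

lemma solution_unique:
  assumes "solution u" "solution w" "w 0 = u 0" "t \<ge> 0" shows "w t = u t"
proof -
  show ?thesis using ode.uniqueness[of u w t] assms unfolding solution_def by blast
qed

lemma solution_tr:
  assumes "solution u" "t \<ge> 0" shows "tr (u t) = apply_bcontfun (u t)"
proof -
  show ?thesis using ode.range_solution[of u u t] assms unfolding solution_def Lb_eq_iff by blast
qed

lemma xder_tr_eq: "tr p = p \<Longrightarrow> xder j p (td j p)"
  using xder_tr[of j p] by simp

lemma X_norm_tr: "tr p = p \<Longrightarrow> (X_norm p)\<^sup>2 = ip p p + (\<Sum>j\<in>UNIV. ip (td j p) (td j p))"
  by (intro X_norm_xder xder_tr_eq)

lemma X_norm_lopb: "tr p = p \<Longrightarrow> (X_norm (lopb bs p))\<^sup>2 = ip (lopb bs p) (lopb bs p) + (\<Sum>j\<in>UNIV. ip (lopb bs (td j p)) (lopb bs (td j p)))"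
  by (intro X_norm_xder xder_lopb xder_tr_eq)

lemma X_norm_nonneg: "0 \<le> X_norm h"
  unfolding X_norm_def by (intro real_sqrt_ge_zero add_nonneg_nonneg sum_nonneg) simp_all

text \<open>The function contributes 1 and each of its three derivatives \<open>Dc\<^sup>2\<close>;
  \<open>phase\<close> has mass 1.\<close>

definition Xc :: real where "Xc = sqrt (1 + 3 * Dc\<^sup>2)"

lemma X_norm_le_norm:
  fixes c :: bdensity
  assumes "tr c = apply_bcontfun c" shows "X_norm c \<le> Xc * norm c"
proof (rule power2_le_imp_le)
  have "(X_norm c)\<^sup>2 = ip c c + (\<Sum>j\<in>UNIV. ip (td j c) (td j c))" by (rule X_norm_tr[OF assms])
  also have "\<dots> \<le> norm c * norm c + (\<Sum>j\<in>(UNIV::3 set). (Dc * norm c) * (Dc * norm c))"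
  proof (intro add_mono sum_mono)
    show "ip c c \<le> norm c * norm c" using abs_ip_bdensity_le[of c c] by linarith
    fix j :: 3
    have "\<bar>ip (td j c) (td j c)\<bar> \<le> (Dc * norm c) * (Dc * norm c)"
      using Dc_nonneg by (intro ip_bound_sup continuous_td td_bound_sup continuous_bdensity abs_bdensity_le) auto
    then show "ip (td j c) (td j c) \<le> (Dc * norm c) * (Dc * norm c)" by linarith
  qed
  also have "\<dots> = (Xc * norm c)\<^sup>2"
    by (simp add: Xc_def power_mult_distrib power2_eq_square algebra_simps)
  finally show "(X_norm c)\<^sup>2 \<le> (Xc * norm c)\<^sup>2" .
  show "0 \<le> Xc * norm c" by (simp add: Xc_def)
qed

text \<open>Makes the dissipation continuous in time, so that its time integral can be
  differentiated.\<close>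

lemma bounded_bilinear_lopb:
  "bounded_bilinear (\<lambda>c d. ip (lopb bs (apply_bcontfun (c :: bdensity))) (lopb bs (apply_bcontfun (d :: bdensity))))"
proof
  obtain M where M: "M \<ge> 0" "\<And>h a z. continuous_on UNIV h \<Longrightarrow> (\<And>z. z \<in> space phase \<Longrightarrow> \<bar>h z\<bar> \<le> a) \<Longrightarrow> 0 \<le> a \<Longrightarrow>
    z \<in> space phase \<Longrightarrow> \<bar>lopb bs h z\<bar> \<le> M * a" using lopb_bound by blast
  have s: "sqint (lopb bs c)" for c :: bdensity by (intro sqint_continuous continuous_lopb continuous_bdensity)
  have add: "lopb bs (apply_bcontfun (a + b)) = (\<lambda>z. lopb bs a z + lopb bs b z)" for a b :: bdensity
    by (rule ext) (simp only: plus_bcontfun.rep_eq lopb_add continuous_bdensity)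
  have scale: "lopb bs (apply_bcontfun (r *\<^sub>R b)) = (\<lambda>z. r * lopb bs b z)" for r and b :: bdensity
    by (rule ext) (simp only: scaleR_bcontfun.rep_eq real_scaleR_def lopb_cmult)
  fix a a' b b' :: bdensity and r :: real
  show "ip (lopb bs (a + a')) (lopb bs b) = ip (lopb bs a) (lopb bs b) + ip (lopb bs a') (lopb bs b)"
    "ip (lopb bs a) (lopb bs (b + b')) = ip (lopb bs a) (lopb bs b) + ip (lopb bs a) (lopb bs b')"
    "ip (lopb bs (r *\<^sub>R a)) (lopb bs b) = r *\<^sub>R ip (lopb bs a) (lopb bs b)"
    "ip (lopb bs a) (lopb bs (r *\<^sub>R b)) = r *\<^sub>R ip (lopb bs a) (lopb bs b)"
    by (simp_all only: add scale ip_add_left ip_add_right ip_cmult_left ip_cmult_right s real_scaleR_def)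
  show "\<exists>K. \<forall>a b. norm (ip (lopb bs (apply_bcontfun (a :: bdensity))) (lopb bs (apply_bcontfun (b :: bdensity)))) \<le> norm a * norm b * K"
  proof (intro exI[of _ "M * M"] allI)
    fix a b :: bdensity
    have "\<bar>ip (lopb bs a) (lopb bs b)\<bar> \<le> (M * norm a) * (M * norm b)"
      using M(1) by (intro ip_bound_sup continuous_lopb continuous_bdensity M(2) abs_bdensity_le) auto
    then show "norm (ip (lopb bs a) (lopb bs b)) \<le> norm a * norm b * (M * M)" by (simp add: mult_ac)
  qed
qed

text \<open>The squared dissipation as a continuous quadratic form. \<open>lopb\<close> commutes
  with \<open>x\<close>-derivatives, which is why \<open>Db j\<close> may stand inside.\<close>

definition diss :: "bdensity \<Rightarrow> real" where
  "diss c = ip (lopb bs c) (lopb bs c) + (\<Sum>j\<in>UNIV. ip (lopb bs (Db j c)) (lopb bs (Db j c)))"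

lemma diss_nonneg: "0 \<le> diss c"
  unfolding diss_def by (intro add_nonneg_nonneg sum_nonneg ip_nonneg)

lemma solution_continuous: "solution u \<Longrightarrow> continuous_on {0..} u"
  unfolding solution_def continuous_on_eq_continuous_within using has_vector_derivative_continuous by fastforce

lemma continuous_diss: "solution u \<Longrightarrow> continuous_on {0..} (\<lambda>t. diss (u t))"
  unfolding diss_def
  by (intro continuous_intros bounded_bilinear.continuous_on[OF bounded_bilinear_lopb] bounded_linear.continuous_on[OF bounded_linear_Db] solution_continuous)

text \<open>Energy plus the dissipation accumulated so far has a derivative that is at most 0: the 2
  from differentiating squares cancels the half of the dissipation that Young's inequality
  leaves.\<close>

lemma energy_estimate:
  assumes u: "solution u" and t: "t \<ge> 0"
  shows "(X_norm (u t))\<^sup>2 + 1 / (\<epsilon>\<^sup>2 * \<nu>) * integral {0..t} (\<lambda>s. diss (u s)) \<le> (X_norm (u 0))\<^sup>2"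
proof -
  let ?E = "\<lambda>t. ip (u t) (u t) + (\<Sum>j\<in>UNIV. ip (Db j (u t)) (Db j (u t)))"
  have E: "(X_norm (u t))\<^sup>2 = ?E t" if "t \<ge> 0" for t
    using X_norm_tr[OF solution_tr[OF u that]] by (simp add: apply_Db)
  let ?E' = "\<lambda>t. 2 * ip (u t) (Fb (u t)) + (\<Sum>j\<in>UNIV. 2 * ip (Db j (u t)) (Db j (Fb (u t))))"
  let ?c = "1 / (\<epsilon>\<^sup>2 * \<nu>)"
  have "?E t + ?c * integral {0..t} (\<lambda>s. diss (u s)) \<le> ?E 0 + ?c * integral {0..0} (\<lambda>s. diss (u s))"
  proof (rule nonincreasing_on_halfline[where g="\<lambda>t. ?E t + ?c * integral {0..t} (\<lambda>s. diss (u s))" and g'="\<lambda>t. ?E' t + ?c * diss (u t)"])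
    fix t :: real assume t: "t \<ge> 0"
    have du: "(u has_vector_derivative Fb (u t)) (at t within {0..})" using u t by (simp add: solution_def)
    have dE: "(?E has_real_derivative ?E' t) (at t within {0..})"
      by (intro DERIV_add DERIV_sum ode.has_derivative_B du bounded_linear.has_vector_derivative[OF bounded_linear_Db])
    have "((\<lambda>t. integral {0..t} (\<lambda>s. diss (u s))) has_real_derivative diss (u t)) (at t within {0..t+1})"
      using t by (intro integral_has_real_derivative continuous_on_subset[OF continuous_diss[OF u]]) auto
    moreover have "at t within {0..t+1} = at t within {0..}"
      by (rule at_within_nhd[of _ "{t-1<..<t+1}"]) (use t in auto)
    ultimately have "((\<lambda>t. integral {0..t} (\<lambda>s. diss (u s))) has_real_derivative diss (u t)) (at t within {0..})" by simp
    then show "((\<lambda>t. ?E t + ?c * integral {0..t} (\<lambda>s. diss (u s))) has_real_derivative ?E' t + ?c * diss (u t)) (at t within {0..})"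
      by (intro DERIV_add[OF dE] DERIV_cmult)
    have p: "tr (u t) = apply_bcontfun (u t)" by (rule solution_tr[OF u t])
    have half: "2 * a \<le> - c * D" if "a \<le> - (c / 2) * D" for a c D :: real
    proof -
      have "2 * a \<le> 2 * (- (c / 2) * D)" using that by simp
      then show ?thesis by simp
    qed
    have c2: "1 / (2 * \<epsilon>\<^sup>2 * \<nu>) = ?c / 2" by simp
    have "ip (u t) (Fb (u t)) = ip (u t) (rhs (u t))"
      using tr_selfadjoint[OF sqint_bdensity[of "u t"], of "rhs (u t)"] by (simp add: apply_Fb p sqint_continuous continuous_rhs)
    also have "\<dots> \<le> - (?c / 2) * ip (lopb bs (u t)) (lopb bs (u t))" using energy_L2[OF p] unfolding c2 .
    finally have 1: "2 * ip (u t) (Fb (u t)) \<le> - ?c * ip (lopb bs (u t)) (lopb bs (u t))" by (rule half)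
    have 2: "2 * ip (Db j (u t)) (Db j (Fb (u t))) \<le> - ?c * ip (lopb bs (Db j (u t))) (lopb bs (Db j (u t)))" for j
      unfolding apply_Db apply_Fb by (rule half) (use energy_derivative[OF p, of j] in \<open>simp only: c2\<close>)
    have "?E' t \<le> - ?c * ip (lopb bs (u t)) (lopb bs (u t)) + (\<Sum>j\<in>UNIV. - ?c * ip (lopb bs (Db j (u t))) (lopb bs (Db j (u t))))"
      by (intro add_mono sum_mono 1 2)
    also have "\<dots> = - ?c * diss (u t)" by (simp add: diss_def distrib_left sum_distrib_left sum_negf)
    finally show "?E' t + ?c * diss (u t) \<le> 0" by simp
  qed (use t in auto)
  then show ?thesis using t by (simp add: E)
qed

lemma diss_X_norm: "solution u \<Longrightarrow> t \<ge> 0 \<Longrightarrow> diss (u t) = (X_norm (lopb bs (u t)))\<^sup>2"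
  by (simp add: diss_def X_norm_lopb[OF solution_tr] apply_Db)

end

section \<open>Difference quotients, half-line integrals and simple functions in time\<close>

lemma has_vector_derivative_iff_quotient:
  "(f has_vector_derivative v) (at t within T) \<longleftrightarrow>
    ((\<lambda>s. norm ((1 / (s - t)) *\<^sub>R (f s - f t) - v)) \<longlongrightarrow> 0) (at t within T)"
proof -
  have "norm (f s - f t - (s - t) *\<^sub>R v) / norm (s - t) = norm ((1 / (s - t)) *\<^sub>R (f s - f t) - v)" if "s \<noteq> t" for s
  proof -
    have "(1 / (s - t)) *\<^sub>R (f s - f t) - v = (1 / (s - t)) *\<^sub>R (f s - f t - (s - t) *\<^sub>R v)"
      using that by (simp add: scaleR_diff_right)
    then show ?thesis by (simp add: divide_inverse mult.commute)
  qed
  then have "((\<lambda>s. norm (f s - f t - (s - t) *\<^sub>R v) / norm (s - t)) \<longlongrightarrow> 0) (at t within T) \<longleftrightarrow>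
      ((\<lambda>s. norm ((1 / (s - t)) *\<^sub>R (f s - f t) - v)) \<longlongrightarrow> 0) (at t within T)"
    by (intro filterlim_cong refl) (auto simp: eventually_at_filter)
  then show ?thesis
    by (simp add: has_vector_derivative_def has_derivative_iff_norm bounded_linear_scaleR_left)
qed

text \<open>Monotone convergence along the intervals from 0 to \<open>n\<close>, whose integrals
  increase and are bounded by \<open>C\<close>.\<close>

lemma set_integrable_halfline:
  fixes \<phi> :: "real \<Rightarrow> real"
  assumes c: "continuous_on {0..} \<phi>" and pos: "\<And>s. s \<ge> 0 \<Longrightarrow> 0 \<le> \<phi> s"
    and bd: "\<And>t. t \<ge> 0 \<Longrightarrow> integral {0..t} \<phi> \<le> C"
  shows "set_integrable lborel {0..} \<phi>" "(LINT s:{0..}|lborel. \<phi> s) \<le> C"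
    and "t \<ge> 0 \<Longrightarrow> (LINT s:{0..t}|lborel. \<phi> s) = integral {0..t} \<phi>"
proof -
  have si: "set_integrable lborel {0..t} \<phi>" for t
    by (intro borel_integrable_atLeastAtMost' continuous_on_subset[OF c]) auto
  have eq: "(LINT s:{0..t}|lborel. \<phi> s) = integral {0..t} \<phi>" for t
    by (rule set_borel_integral_eq_integral(2)[OF si])
  then show "t \<ge> 0 \<Longrightarrow> (LINT s:{0..t}|lborel. \<phi> s) = integral {0..t} \<phi>" by simp
  define g where "g n s = indicator {0..real n} s *\<^sub>R \<phi> s" for n :: nat and s
  have gi: "integrable lborel (g n)" for n using si[of n] by (simp add: set_integrable_def g_def[abs_def])
  have gint: "integral\<^sup>L lborel (g n) = integral {0..real n} \<phi>" for n
    using eq[of n] by (simp add: set_lebesgue_integral_def g_def[abs_def])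
  have mono: "mono (\<lambda>n. g n s)" for s
    using pos[of s] by (auto simp: mono_def g_def split: split_indicator)
  have imono: "incseq (\<lambda>n. integral\<^sup>L lborel (g n))"
    using mono gi by (intro monoI integral_mono) (auto simp: mono_def)
  have bd': "integral\<^sup>L lborel (g n) \<le> C" for n using bd[of n] by (simp add: gint)
  obtain L where L: "(\<lambda>n. integral\<^sup>L lborel (g n)) \<longlonglongrightarrow> L" "\<And>n. integral\<^sup>L lborel (g n) \<le> L"
    using incseq_convergent[OF imono] bd' by blast
  have lim: "(\<lambda>n. g n s) \<longlonglongrightarrow> indicator {0..} s *\<^sub>R \<phi> s" for s
  proof -
    obtain N where N: "s \<le> real N" using real_arch_simple by blast
    have "g n s = indicator {0..} s *\<^sub>R \<phi> s" if "n \<ge> N" for n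
      using that N by (auto simp: g_def split: split_indicator)
    then show ?thesis by (auto intro!: tendsto_eventually eventually_sequentiallyI)
  qed
  have m: "(\<lambda>s. indicator {0..} s *\<^sub>R \<phi> s) \<in> borel_measurable lborel"
    using borel_measurable_continuous_on_indicator[OF _ c] by simp
  show "set_integrable lborel {0..} \<phi>"
    unfolding set_integrable_def using mono lim by (intro integrable_monotone_convergence[OF gi _ _ L(1) m]) auto
  have "(LINT s:{0..}|lborel. \<phi> s) = L"
    unfolding set_lebesgue_integral_def using mono lim by (intro integral_monotone_convergence[OF gi _ _ L(1) m]) auto
  also have "L \<le> C" using LIMSEQ_le_const2[OF L(1)] bd' by blast
  finally show "(LINT s:{0..}|lborel. \<phi> s) \<le> C" .
qed

text \<open>Source of the simple functions for Bochner measurability. Capping at \<open>n\<close>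
  makes the range on the half line finite, rounding down keeps times nonnegative, and
  \<open>Suc n\<close> avoids a zero denominator.\<close>

definition grid :: "nat \<Rightarrow> real \<Rightarrow> real" where
  "grid n t = real_of_int \<lfloor>real (Suc n) * min (real n) t\<rfloor> / real (Suc n)"

lemma grid_nonneg: "0 \<le> t \<Longrightarrow> 0 \<le> grid n t"
  by (auto simp: grid_def)

lemma grid_close:
  assumes "t \<le> real n" shows "\<bar>grid n t - t\<bar> \<le> inverse (real (Suc n))"
proof -
  have "\<bar>real_of_int \<lfloor>real (Suc n) * t\<rfloor> - real (Suc n) * t\<bar> \<le> 1" by linarith
  then have "\<bar>real_of_int \<lfloor>real (Suc n) * t\<rfloor> - real (Suc n) * t\<bar> / real (Suc n) \<le> 1 / real (Suc n)"
    by (intro divide_right_mono) auto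
  moreover have "grid n t - t = (real_of_int \<lfloor>real (Suc n) * t\<rfloor> - real (Suc n) * t) / real (Suc n)"
    using assms by (simp add: grid_def min_absorb2 field_simps)
  ultimately show ?thesis by (simp add: inverse_eq_divide)
qed

lemma grid_tendsto: "(\<lambda>n. grid n t) \<longlonglongrightarrow> t"
proof (rule LIM_zero_cancel, rule Lim_null_comparison[OF _ LIMSEQ_inverse_real_of_nat])
  obtain N where N: "t \<le> real N" using real_arch_simple by blast
  show "\<forall>\<^sub>F n in sequentially. norm (grid n t - t) \<le> inverse (real (Suc n))"
  proof (rule eventually_sequentiallyI[of N])
    fix n assume "N \<le> n"
    then have "t \<le> real n" using N by linarith
    then show "norm (grid n t - t) \<le> inverse (real (Suc n))" unfolding real_norm_def by (rule grid_close)
  qed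
qed

lemma simple_function_grid: "simple_function (restrict_space lborel {0..}) (grid n)"
proof (rule simple_function_borel_measurable)
  show "grid n \<in> borel_measurable (restrict_space lborel {0..})"
    unfolding grid_def[abs_def] by (intro measurable_restrict_space1) simp
  have "grid n ` {0..} \<subseteq> (\<lambda>k::int. real_of_int k / real (Suc n)) ` {0..int (Suc n) * int n}"
  proof (rule image_subsetI)
    fix t :: real assume t: "t \<in> {0..}"
    have "real (Suc n) * min (real n) t \<le> real (Suc n) * real n" by (intro mult_left_mono) auto
    then have "\<lfloor>real (Suc n) * min (real n) t\<rfloor> \<le> int (Suc n) * int n"
      by (metis floor_mono floor_of_nat of_nat_mult)
    then have "\<lfloor>real (Suc n) * min (real n) t\<rfloor> \<in> {0..int (Suc n) * int n}" using t by auto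
    then show "grid n t \<in> (\<lambda>k::int. real_of_int k / real (Suc n)) ` {0..int (Suc n) * int n}"
      unfolding grid_def by (rule imageI)
  qed
  then show "finite (grid n ` space (restrict_space lborel {0..}))"
    by (simp add: space_restrict_space finite_subset)
qed

section \<open>Comparison of the Galerkin system with the stated equation\<close>

context galerkin
begin

lemma tr_H1: "tr p = p \<Longrightarrow> p \<in> H1"
  by (rule H1_xder[OF xder_tr_eq])

text \<open>Difference quotients of a solution lie in the range of the truncation, where the sup
  norm dominates \<open>X_norm\<close>; the derivative therefore exists in the stronger-looking
  sense as well.\<close>

lemma solution_has_time_deriv:
  assumes u: "solution u" and t: "t \<ge> 0" and F: "\<And>s. s \<ge> 0 \<Longrightarrow> F s = apply_bcontfun (u s)"
  shows "has_time_deriv F (tr (rhs (u t))) t"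
  unfolding has_time_deriv_def
proof (intro conjI allI impI)
  show "F s \<in> H1" if "0 \<le> s" for s using F[OF that] solution_tr[OF u that] by (simp add: tr_H1)
  show "tr (rhs (u t)) \<in> H1" by (intro tr_H1 tr_tr)
  define c where "c s = (1 / (s - t)) *\<^sub>R (u s - u t) - Fb (u t)" for s
  have c: "(\<lambda>z. (F s z - F t z) / (s - t) - tr (rhs (u t)) z) = apply_bcontfun (c s)" if "s \<ge> 0" for s
    using F[OF that] F[OF t] by (simp add: c_def bcontfun_rep_eq apply_Fb fun_eq_iff)
  have trc: "tr (c s) = apply_bcontfun (c s)" if "s \<ge> 0" for s
  proof -
    interpret Lb: bounded_linear Lb by (rule bounded_linear_Lb)
    have "Lb (u s) = u s" "Lb (u t) = u t" "Lb (Fb (u t)) = Fb (u t)"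
      using solution_tr[OF u that] solution_tr[OF u t] by (simp_all add: Lb_eq_iff apply_Fb tr_tr)
    then have "Lb (c s) = c s" by (simp add: c_def Lb.diff Lb.scaleR)
    then show ?thesis by (simp add: Lb_eq_iff)
  qed
  have "((\<lambda>s. norm (c s)) \<longlongrightarrow> 0) (at t within {0..})"
    using u t unfolding solution_def has_vector_derivative_iff_quotient c_def by simp
  then have "((\<lambda>s. Xc * norm (c s)) \<longlongrightarrow> 0) (at t within {0..})" by (rule tendsto_mult_right_zero)
  then show "((\<lambda>s. X_norm (\<lambda>z. (F s z - F t z) / (s - t) - tr (rhs (u t)) z)) \<longlongrightarrow> 0) (at t within {0..})"
    by (rule Lim_null_comparison[rotated])
       (auto simp: eventually_at_filter c X_norm_nonneg intro!: always_eventually X_norm_le_norm trc)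
qed

lemma transport_AE:
  assumes p: "tr p = p" shows "AE z in phase. transport p z = (\<Sum>k\<in>UNIV. snd z $ k * td k p z)"
proof -
  have "AE z in phase. \<forall>k\<in>UNIV. dx k p z = td k p z"
    using dx_xder(2)[OF xder_tr_eq[OF p]] by (subst AE_finite_all) auto
  then show ?thesis by eventually_elim (auto simp: transport_def case_prod_beta')
qed

lemma measurable_transport:
  assumes p: "tr p = p" shows "transport p \<in> borel_measurable phase"
proof -
  have "(\<lambda>z. snd z $ k) \<in> borel_measurable phase" for k
    by (intro measurable_phase_borel borel_measurable_continuous_onI continuous_intros)
  then show ?thesis
    unfolding transport_def case_prod_beta' prod.collapse
    using dx_xder(1)[OF xder_tr_eq[OF p]] by (intro borel_measurable_sum borel_measurable_times) (auto simp: L2_def)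
qed

lemma measurable_transport_sum: "(\<lambda>z. \<Sum>k\<in>UNIV. snd z $ k * td k p z) \<in> borel_measurable phase"
  by (intro measurable_phase_borel borel_measurable_continuous_onI continuous_transport_sum)

lemma integrable_transport:
  assumes p: "tr p = p" shows "integrable phase (transport p)"
  using integrable_cong_AE[OF measurable_transport[OF p] measurable_transport_sum transport_AE[OF p]]
    integrable_phase_continuous[OF continuous_transport_sum] by blast

text \<open>\<open>dx\<close> picks some representative, but \<open>tr\<close> reads its argument
  only through integrals, so the classical derivative may be substituted with equality at every
  point.\<close>

lemma tr_transport:
  assumes p: "tr p = p" shows "tr (transport p) = tr (\<lambda>z. \<Sum>k\<in>UNIV. snd z $ k * td k p z)"
  by (intro tr_cong_AE transport_AE measurable_transport measurable_transport_sum p)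

text \<open>Linearity of \<open>tr\<close> and division by \<open>\<epsilon>\<^sup>2\<close>. As an
  equivalence at a single point it serves existence and uniqueness alike.\<close>

lemma equation_iff:
  assumes p: "tr p = p"
  shows "\<epsilon>\<^sup>2 * g + \<epsilon> * tr (transport p) z = - (1 / \<nu>) * tr (lopb bs p) z
      + (\<epsilon> * \<kappa> / \<nu>) * tr (lopb bs (\<lambda>y. (p y)\<^sup>2)) z - (\<epsilon>\<^sup>2 * \<kappa>\<^sup>2 / \<nu>) * tr (\<lambda>y. (p y) ^ 3) z
    \<longleftrightarrow> g = tr (rhs p) z"
proof -
  have c: "continuous_on UNIV p" "continuous_on UNIV (\<lambda>y. (p y)\<^sup>2)" "continuous_on UNIV (\<lambda>y. (p y) ^ 3)"
    using continuous_tr_eq[OF p] by (auto intro!: continuous_intros)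
  note s = sqint_continuous[OF continuous_transport_sum] sqint_continuous[OF continuous_lopb[OF c(1)]]
    sqint_continuous[OF continuous_lopb[OF c(2)]] sqint_continuous[OF c(3)]
  define A where "A = tr (\<lambda>z. \<Sum>k\<in>UNIV. snd z $ k * td k p z) z"
  define B where "B = tr (lopb bs p) z"
  define C where "C = tr (lopb bs (\<lambda>y. (p y)\<^sup>2)) z"
  define E where "E = tr (\<lambda>y. (p y) ^ 3) z"
  have "tr (rhs p) z = - (1 / \<epsilon>) * A - (1 / (\<epsilon>\<^sup>2 * \<nu>)) * B + (\<kappa> / (\<epsilon> * \<nu>)) * C - (\<kappa>\<^sup>2 / \<nu>) * E"
    unfolding rhs_def[abs_def] A_def B_def C_def E_def
    by (simp only: tr_add tr_diff tr_cmult s sqint_add sqint_diff sqint_cmult)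
  then have "\<epsilon>\<^sup>2 * tr (rhs p) z = - \<epsilon> * A - (1 / \<nu>) * B + (\<epsilon> * \<kappa> / \<nu>) * C - (\<epsilon>\<^sup>2 * \<kappa>\<^sup>2 / \<nu>) * E"
    using pos by (simp add: field_simps power2_eq_square)
  then have "\<epsilon>\<^sup>2 * g + \<epsilon> * A = - (1 / \<nu>) * B + (\<epsilon> * \<kappa> / \<nu>) * C - (\<epsilon>\<^sup>2 * \<kappa>\<^sup>2 / \<nu>) * E \<longleftrightarrow> \<epsilon>\<^sup>2 * g = \<epsilon>\<^sup>2 * tr (rhs p) z"
    by linarith
  also have "\<dots> \<longleftrightarrow> g = tr (rhs p) z" using pos by simp
  finally show ?thesis unfolding tr_transport[OF p] A_def B_def C_def E_def .
qed

lemma sqrt_ip_le_X_norm: "sqrt (LINT z|phase. (h z)\<^sup>2) \<le> X_norm h"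
  unfolding X_norm_def by (intro real_sqrt_le_mono) (simp add: sum_nonneg)

text \<open>The bridge for uniqueness. A competitor is differentiable only in \<open>X_norm\<close>,
  with a derivative known almost everywhere. \<open>X_norm\<close> dominates the \<open>L2\<close>
  norm, which on the range dominates the sup norm, so the truncated competitor solves the same
  differential equation.\<close>

lemma time_deriv_solution:
  assumes g0: "\<And>s. s \<ge> 0 \<Longrightarrow> sqint (g s)"
    and d: "\<And>t. t \<ge> 0 \<Longrightarrow> \<exists>G. has_time_deriv (\<lambda>s. tr (g s)) G t \<and> (AE z in phase. G z = tr (rhs (tr (g t))) z)"
  shows "solution (\<lambda>t. Bcontfun (tr (g t)))"
  unfolding solution_def
proof (intro conjI allI impI)
  define P where "P t = Bcontfun (tr (g t))" for t
  have P: "apply_bcontfun (P t) = tr (g t)" if "t \<ge> 0" for t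
    unfolding P_def by (rule Bcontfun_inverse[OF tr_bcontfun[OF g0[OF that]]])
  have LP: "Lb (P t) = P t" if "t \<ge> 0" for t by (simp add: Lb_eq_iff P[OF that] tr_tr)
  show "Lb (Bcontfun (tr (g 0))) = Bcontfun (tr (g 0))" using LP[of 0] by (simp add: P_def)
  fix t :: real assume t: "0 \<le> t"
  obtain G where G: "has_time_deriv (\<lambda>s. tr (g s)) G t" and GA: "AE z in phase. G z = tr (rhs (tr (g t))) z"
    using d[OF t] by blast
  have Gm: "G \<in> borel_measurable phase" using G by (auto simp: has_time_deriv_def H1_def L2_def)
  define c where "c s = (1 / (s - t)) *\<^sub>R (P s - P t) - Fb (P t)" for s
  have bound: "norm (norm (c s)) \<le> Sc * X_norm (\<lambda>z. (tr (g s) z - tr (g t) z) / (s - t) - G z)" if s: "s \<ge> 0" for s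
  proof -
    have cz: "apply_bcontfun (c s) z = (tr (g s) z - tr (g t) z) / (s - t) - tr (rhs (tr (g t))) z" for z
      by (simp add: c_def bcontfun_rep_eq P s t apply_Fb)
    interpret Lb: bounded_linear Lb by (rule bounded_linear_Lb)
    have "Lb (Fb (P t)) = Fb (P t)" by (simp add: Lb_eq_iff apply_Fb tr_tr)
    then have "Lb (c s) = c s" using LP[OF s] LP[OF t] by (simp add: c_def Lb.diff Lb.scaleR)
    then have trc: "tr (c s) = apply_bcontfun (c s)" by (simp add: Lb_eq_iff)
    have "norm (c s) \<le> Sc * sqrt (ip (c s) (c s))"
      by (rule norm_bound) (use tr_bound_L2[OF sqint_bdensity[of "c s"]] trc in simp)
    \<comment> \<open>\<open>G\<close> may differ from the field on a null set, which the integral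
      does not see.\<close>
    also have "ip (c s) (c s) = (LINT z|phase. ((tr (g s) z - tr (g t) z) / (s - t) - G z)\<^sup>2)"
      unfolding ip_def power2_eq_square[symmetric]
    proof (rule integral_cong_AE)
      show "(\<lambda>z. (apply_bcontfun (c s) z)\<^sup>2) \<in> borel_measurable phase"
        using sqint_bdensity[of "c s"] by (auto simp: sqint_def)
      show "(\<lambda>z. ((tr (g s) z - tr (g t) z) / (s - t) - G z)\<^sup>2) \<in> borel_measurable phase"
        using sqint_tr[of "g s"] sqint_tr[of "g t"] Gm by (auto simp: sqint_def)
      show "AE z in phase. (apply_bcontfun (c s) z)\<^sup>2 = ((tr (g s) z - tr (g t) z) / (s - t) - G z)\<^sup>2"
        using GA by eventually_elim (simp add: cz)
    qed
    also have "sqrt \<dots> \<le> X_norm (\<lambda>z. (tr (g s) z - tr (g t) z) / (s - t) - G z)" by (rule sqrt_ip_le_X_norm)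
    finally show ?thesis using Sc_nonneg by (simp add: mult_left_mono)
  qed
  have "((\<lambda>s. X_norm (\<lambda>z. (tr (g s) z - tr (g t) z) / (s - t) - G z)) \<longlongrightarrow> 0) (at t within {0..})"
    using G by (simp only: has_time_deriv_def)
  then have "((\<lambda>s. Sc * X_norm (\<lambda>z. (tr (g s) z - tr (g t) z) / (s - t) - G z)) \<longlongrightarrow> 0) (at t within {0..})"
    by (rule tendsto_mult_right_zero)
  moreover have "\<forall>\<^sub>F s in at t within {0..}. norm (norm (c s)) \<le> Sc * X_norm (\<lambda>z. (tr (g s) z - tr (g t) z) / (s - t) - G z)"
    unfolding eventually_at_filter by (rule always_eventually) (use bound in simp)
  ultimately have "((\<lambda>s. norm (c s)) \<longlongrightarrow> 0) (at t within {0..})"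
    by (rule Lim_null_comparison[rotated])
  then show "((\<lambda>t. Bcontfun (tr (g t))) has_vector_derivative Fb (Bcontfun (tr (g t)))) (at t within {0..})"
    unfolding has_vector_derivative_iff_quotient c_def P_def .
qed

lemma solution_Linf_H1:
  assumes u: "solution u" and C: "\<And>t. t \<ge> 0 \<Longrightarrow> X_norm (u t) \<le> C"
  shows "Linf_H1 (\<lambda>t. apply_bcontfun (u t))"
proof -
  have H: "apply_bcontfun (u t) \<in> H1" if "t \<ge> 0" for t using solution_tr[OF u that] by (rule tr_H1)
  define s where "s n t = apply_bcontfun (u (grid n t))" for n t
  have "(\<lambda>n. X_norm (\<lambda>z. apply_bcontfun (u t) z - s n t z)) \<longlonglongrightarrow> 0" if t: "t \<ge> 0" for t
  proof -
    have tr: "tr (u t - u (grid n t)) = apply_bcontfun (u t - u (grid n t))" for n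
    proof -
      interpret Lb: bounded_linear Lb by (rule bounded_linear_Lb)
      have "Lb (u t - u (grid n t)) = u t - u (grid n t)"
        using solution_tr[OF u t] solution_tr[OF u grid_nonneg[OF t, of n]] by (simp add: Lb.diff Lb_eq_iff[symmetric])
      then show ?thesis by (simp add: Lb_eq_iff)
    qed
    have "(\<lambda>n. u (grid n t)) \<longlonglongrightarrow> u t"
      using solution_continuous[OF u] grid_tendsto grid_nonneg[OF t] t
      by (intro continuous_on_tendsto_compose[of "{0..}" u]) auto
    then have "(\<lambda>n. Xc * norm (u t - u (grid n t))) \<longlonglongrightarrow> Xc * norm (u t - u t)"
      by (intro tendsto_intros)
    then have "(\<lambda>n. Xc * norm (u t - u (grid n t))) \<longlonglongrightarrow> 0" by simp
    then show ?thesis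
      by (rule Lim_null_comparison[rotated])
         (use X_norm_le_norm[OF tr] in \<open>auto simp: s_def X_norm_nonneg minus_bcontfun.rep_eq intro!: always_eventually\<close>)
  qed
  moreover have "simple_function (restrict_space lborel {0..}) (s n)" for n
    unfolding s_def by (rule simple_function_compose1[OF simple_function_grid])
  moreover have "s n t \<in> H1" if "t \<ge> 0" for n t unfolding s_def by (rule H[OF grid_nonneg[OF that]])
  ultimately show ?thesis
    unfolding Linf_H1_def using H C
    by (intro conjI exI[of _ s] exI[of _ C] allI impI AE_I2) (auto simp: space_restrict_space)
qed

text \<open>Bessel's inequality for \<open>h\<close> and for each \<open>dx j h\<close>, because
  \<open>td j h\<close> is the truncation of \<open>dx j h\<close>. It replaces the truncated datum
  by the original one in the estimate.\<close>

lemma X_norm_tr_le: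
  assumes h: "h \<in> H1" shows "(X_norm (tr h))\<^sup>2 \<le> (X_norm h)\<^sup>2"
proof -
  have hL: "h \<in> L2" using h by (simp add: H1_def)
  have "(X_norm (tr h))\<^sup>2 = ip (tr h) (tr h) + (\<Sum>j\<in>UNIV. ip (td j h) (td j h))"
    by (simp add: X_norm_tr tr_tr td_tr)
  also have "\<dots> \<le> ip h h + (\<Sum>j\<in>UNIV. ip (dx j h) (dx j h))"
  proof (intro add_mono sum_mono)
    show "ip (tr h) (tr h) \<le> ip h h" by (intro tr_bessel L2_sqint hL)
    fix j show "ip (td j h) (td j h) \<le> ip (dx j h) (dx j h)"
      unfolding td_weak_deriv[OF hL dx_H1[OF h]] by (intro tr_bessel L2_sqint dx_H1 h)
  qed
  also have "\<dots> = (X_norm h)\<^sup>2"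
    unfolding X_norm_def ip_def power2_eq_square[symmetric]
    by (subst real_sqrt_pow2) (auto intro!: add_nonneg_nonneg sum_nonneg)
  finally show ?thesis .
qed

end

section \<open>The collision invariants and the final assembly\<close>

lemma continuous_trunc1: "continuous_on T (trunc1 R g)"
  unfolding trunc1_def[abs_def] by (intro continuous_intros)

abbreviation collision_invariants :: "real \<Rightarrow> real \<Rightarrow> real \<Rightarrow> real \<Rightarrow> real \<Rightarrow> (real^3 \<Rightarrow> real) list" where
  "collision_invariants \<epsilon> \<gamma> c0 c1 c2 \<equiv> [e0, e1 \<epsilon> \<gamma> c1 1, e1 \<epsilon> \<gamma> c1 2, e1 \<epsilon> \<gamma> c1 3, e2 \<epsilon> \<gamma> c0 c2]"

lemma Lop_lopb: "Lop \<epsilon> \<gamma> c0 c1 c2 h = lopb (collision_invariants \<epsilon> \<gamma> c0 c1 c2) h"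
proof
  fix z :: "(real^3) \<times> (real^3)"
  have "{..<5::nat} = {0, 1, 2, 3, 4}" by auto
  then show "Lop \<epsilon> \<gamma> c0 c1 c2 h z = lopb (collision_invariants \<epsilon> \<gamma> c0 c1 c2) h z"
    by (cases z) (simp add: Lop_def lopb_def Proj_def projb_def sum_3)
qed

lemma velocity_basis_collision_invariants:
  assumes "normalizing_consts \<epsilon> \<gamma> c0 c1 c2"
  shows "velocity_basis (collision_invariants \<epsilon> \<gamma> c0 c1 c2)"
proof
  show "orthonormal_v (collision_invariants \<epsilon> \<gamma> c0 c1 c2)" using assms by (simp add: normalizing_consts_def)
  have t: "continuous_on UNIV (\<lambda>v::real^3. trunc1 R g (v $ i))" for R g i
    by (rule continuous_on_compose2[OF continuous_trunc1[of UNIV]]) (auto intro!: continuous_intros)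
  have "\<forall>e\<in>set (collision_invariants \<epsilon> \<gamma> c0 c1 c2). continuous_on UNIV e"
    by (auto simp: e0_def[abs_def] e1_def[abs_def] e2_def[abs_def] e2i_def[abs_def] intro!: continuous_intros t)
  then show "continuous_on UNIV (collision_invariants \<epsilon> \<gamma> c0 c1 c2 ! i)" if "i < length (collision_invariants \<epsilon> \<gamma> c0 c1 c2)" for i
    using that nth_mem by blast
qed

text \<open>For a competitor, \<open>Lam\<close> and \<open>tr\<close> are known to agree only at
  times \<open>s \<ge> 0\<close>, where it lies in \<open>H1\<close>; the derivative looks at no
  other times.\<close>

lemma has_time_deriv_cong:
  assumes d: "has_time_deriv F G t" and t: "0 \<le> t" and eq: "\<And>s. 0 \<le> s \<Longrightarrow> F' s = F s"
  shows "has_time_deriv F' G t"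
  unfolding has_time_deriv_def
proof (intro conjI allI impI)
  show "F' s \<in> H1" if "0 \<le> s" for s using d eq that by (simp add: has_time_deriv_def)
  show "G \<in> H1" using d by (simp add: has_time_deriv_def)
  show "((\<lambda>s. X_norm (\<lambda>z. (F' s z - F' t z) / (s - t) - G z)) \<longlongrightarrow> 0) (at t within {0..})"
  proof (rule Lim_transform_eventually)
    show "((\<lambda>s. X_norm (\<lambda>z. (F s z - F t z) / (s - t) - G z)) \<longlongrightarrow> 0) (at t within {0..})"
      using d by (simp add: has_time_deriv_def)
    show "\<forall>\<^sub>F s in at t within {0..}. X_norm (\<lambda>z. (F s z - F t z) / (s - t) - G z) = X_norm (\<lambda>z. (F' s z - F' t z) / (s - t) - G z)"
      using eq t by (auto simp: eventually_at_filter intro!: always_eventually)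
  qed
qed

text \<open>The estimate is read time by time, with dissipation up to \<open>t\<close>, and is
  complemented by the bound on the whole dissipation integral. For a datum that is already truncated
  the supremum is at least the initial energy, so adding the whole integral to it would force that
  integral to vanish. Integrability is asserted because a divergent integral would have the value 0
  by convention.\<close>

theorem lemma1:
  fixes \<epsilon> \<gamma> \<nu> \<kappa> c0 c1 c2 :: real and f0 :: density
  assumes "0 < \<epsilon>" "\<epsilon> < 1" "0 < \<gamma>" "0 < \<nu>" "0 < \<kappa>"
    and "normalizing_consts \<epsilon> \<gamma> c0 c1 c2"
    and "f0 \<in> H1"
  shows "\<exists>f. global_solution \<epsilon> \<gamma> c0 c1 c2 \<nu> \<kappa> f0 f \<and>
      set_integrable lborel {0..} (\<lambda>s. (dissipation \<epsilon> \<gamma> c0 c1 c2 (f s))\<^sup>2) \<and>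
      (\<forall>t\<ge>0. (energy (f t))\<^sup>2
          + 1 / (\<epsilon>\<^sup>2 * \<nu>) * (LINT s:{0..t}|lborel. (dissipation \<epsilon> \<gamma> c0 c1 c2 (f s))\<^sup>2)
          \<le> (energy f0)\<^sup>2) \<and>
      1 / (\<epsilon>\<^sup>2 * \<nu>) * (LINT s:{0..}|lborel. (dissipation \<epsilon> \<gamma> c0 c1 c2 (f s))\<^sup>2)
          \<le> (energy f0)\<^sup>2 \<and>
      (\<forall>g. global_solution \<epsilon> \<gamma> c0 c1 c2 \<nu> \<kappa> f0 g \<longrightarrow>
          (\<forall>t\<ge>0. AE z in phase. g t z = f t z))"
proof -
  let ?S = "freqs (\<epsilon> powr - \<gamma>)" and ?bs = "collision_invariants \<epsilon> \<gamma> c0 c1 c2" and ?c = "1 / (\<epsilon>\<^sup>2 * \<nu>)"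
  interpret galerkin ?S ?bs \<epsilon> \<nu> \<kappa>
    using assms by (intro galerkin.intro fourier_set_freqs velocity_basis_collision_invariants galerkin_axioms.intro) auto
  have Lam_eq: "Lam \<epsilon> \<gamma> h = tr h" if "sqint h" for h
    using that by (intro Lam_truncation sqint_integrable) (auto simp: sqint_def)
  have H1_sqint: "h \<in> H1 \<Longrightarrow> sqint h" for h by (simp add: H1_def L2_sqint)
  have eqn: "\<epsilon>\<^sup>2 * g + \<epsilon> * Lam \<epsilon> \<gamma> (transport p) z = - (1 / \<nu>) * Lam \<epsilon> \<gamma> (Lop \<epsilon> \<gamma> c0 c1 c2 p) z
          + (\<epsilon> * \<kappa> / \<nu>) * Lam \<epsilon> \<gamma> (Lop \<epsilon> \<gamma> c0 c1 c2 (\<lambda>y. (p y)\<^sup>2)) z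
          - (\<epsilon>\<^sup>2 * \<kappa>\<^sup>2 / \<nu>) * Lam \<epsilon> \<gamma> (\<lambda>y. (p y) ^ 3) z \<longleftrightarrow> g = tr (rhs p) z"
    if p: "tr p = p" for p g z
  proof -
    have c: "continuous_on UNIV p" "continuous_on UNIV (\<lambda>y. (p y)\<^sup>2)" "continuous_on UNIV (\<lambda>y. (p y) ^ 3)"
      using continuous_tr_eq[OF p] by (auto intro!: continuous_intros)
    \<comment> \<open>Containing the arbitrary representatives of \<open>dx\<close>,
      \<open>transport p\<close> need not be continuous; measurability and integrability are what
      the kernel formula requires.\<close>
    have "Lam \<epsilon> \<gamma> (transport p) = tr (transport p)"
      by (intro Lam_truncation measurable_transport integrable_transport p)
    then show ?thesis
      unfolding Lop_lopb
      by (simp only: Lam_eq[OF sqint_continuous[OF continuous_lopb]] Lam_eq[OF sqint_continuous] c equation_iff[OF p])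
  qed
  have cpos: "?c > 0" using assms by simp
  have f0: "sqint f0" by (rule H1_sqint[OF assms(7)])
  define x0 where "x0 = Bcontfun (tr f0)"
  have x0: "apply_bcontfun x0 = tr f0" unfolding x0_def by (rule Bcontfun_inverse[OF tr_bcontfun[OF f0]])
  then have "Lb x0 = x0" by (simp add: Lb_eq_iff tr_tr)
  then obtain u where u: "solution u" "u 0 = x0" using solution_exists by blast
  define f where "f t = apply_bcontfun (u t)" for t
  have trf: "tr (f t) = f t" if "t \<ge> 0" for t unfolding f_def by (rule solution_tr[OF u(1) that])
  have fH1: "f t \<in> H1" if "t \<ge> 0" for t using trf[OF that] by (rule tr_H1)
  have Lamf: "Lam \<epsilon> \<gamma> (f t) = f t" if "t \<ge> 0" for t
    using Lam_eq[OF H1_sqint[OF fH1[OF that]]] trf[OF that] by simp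
  have X0: "(X_norm (u 0))\<^sup>2 \<le> (energy f0)\<^sup>2"
    unfolding energy_def u(2) x0 by (rule X_norm_tr_le[OF assms(7)])
  have est: "(energy (f t))\<^sup>2 + ?c * integral {0..t} (\<lambda>s. diss (u s)) \<le> (energy f0)\<^sup>2" if "t \<ge> 0" for t
    using energy_estimate[OF u(1) that] X0 unfolding f_def energy_def by linarith
  have int_nonneg: "0 \<le> integral {0..t} (\<lambda>s. diss (u s))" if "t \<ge> 0" for t
    by (intro integral_nonneg integrable_continuous_real continuous_on_subset[OF continuous_diss[OF u(1)]]) (auto simp: diss_nonneg)
  have dsp: "(dissipation \<epsilon> \<gamma> c0 c1 c2 (f s))\<^sup>2 = diss (u s)" if "s \<ge> 0" for s
    unfolding dissipation_def Lop_lopb f_def by (rule diss_X_norm[OF u(1) that, symmetric])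
  have cont: "continuous_on {0..} (\<lambda>s. (dissipation \<epsilon> \<gamma> c0 c1 c2 (f s))\<^sup>2)"
    using continuous_diss[OF u(1)] by (rule continuous_on_eq) (simp add: dsp)
  have int_eq: "integral {0..t} (\<lambda>s. (dissipation \<epsilon> \<gamma> c0 c1 c2 (f s))\<^sup>2) = integral {0..t} (\<lambda>s. diss (u s))" for t
    by (rule integral_cong) (simp add: dsp)
  have bd: "integral {0..t} (\<lambda>s. (dissipation \<epsilon> \<gamma> c0 c1 c2 (f s))\<^sup>2) \<le> (energy f0)\<^sup>2 / ?c" if "t \<ge> 0" for t
  proof -
    have "?c * integral {0..t} (\<lambda>s. diss (u s)) \<le> (energy f0)\<^sup>2" using est[OF that] zero_le_power2[of "energy (f t)"] by linarith
    then show ?thesis unfolding int_eq using cpos by (simp only: pos_le_divide_eq mult.commute)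
  qed
  note half = set_integrable_halfline[OF cont _ bd]
  have sol: "global_solution \<epsilon> \<gamma> c0 c1 c2 \<nu> \<kappa> f0 f"
    unfolding global_solution_def
  proof (intro conjI allI impI)
    show "Linf_H1 f"
      unfolding f_def
    proof (rule solution_Linf_H1[OF u(1)])
      fix t :: real assume t: "t \<ge> 0"
      have "(X_norm (f t))\<^sup>2 \<le> (energy f0)\<^sup>2"
        using est[OF t] mult_nonneg_nonneg[OF less_imp_le[OF cpos] int_nonneg[OF t]] unfolding energy_def by linarith
      then show "X_norm (apply_bcontfun (u t)) \<le> \<bar>energy f0\<bar>"
        unfolding f_def by (metis abs_le_square_iff abs_ge_self order_trans)
    qed
    show "f t \<in> H1" if "0 \<le> t" for t by (rule fH1[OF that])
    show "AE z in phase. f t z = Lam \<epsilon> \<gamma> (f t) z" if "0 \<le> t" for t by (simp add: Lamf that)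
    show "AE z in phase. f 0 z = Lam \<epsilon> \<gamma> f0 z" by (simp add: f_def u(2) x0 Lam_eq[OF f0])
    show "solves_equation \<epsilon> \<gamma> c0 c1 c2 \<nu> \<kappa> f"
      unfolding solves_equation_def
    proof (intro allI impI exI conjI)
      fix t :: real assume t: "0 \<le> t"
      show "has_time_deriv (\<lambda>s. Lam \<epsilon> \<gamma> (f s)) (tr (rhs (f t))) t"
        unfolding f_def by (rule solution_has_time_deriv[OF u(1) t]) (use Lamf in \<open>simp add: f_def\<close>)
      show "AE z in phase. \<epsilon>\<^sup>2 * tr (rhs (f t)) z + \<epsilon> * Lam \<epsilon> \<gamma> (transport (Lam \<epsilon> \<gamma> (f t))) z =
          - (1 / \<nu>) * Lam \<epsilon> \<gamma> (Lop \<epsilon> \<gamma> c0 c1 c2 (Lam \<epsilon> \<gamma> (f t))) z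
          + (\<epsilon> * \<kappa> / \<nu>) * Lam \<epsilon> \<gamma> (Lop \<epsilon> \<gamma> c0 c1 c2 (\<lambda>y. (Lam \<epsilon> \<gamma> (f t) y)\<^sup>2)) z
          - (\<epsilon>\<^sup>2 * \<kappa>\<^sup>2 / \<nu>) * Lam \<epsilon> \<gamma> (\<lambda>y. (Lam \<epsilon> \<gamma> (f t) y) ^ 3) z"
        unfolding Lamf[OF t] eqn[OF trf[OF t]] by simp
    qed
  qed
  have uniq: "AE z in phase. g t z = f t z"
    if g: "global_solution \<epsilon> \<gamma> c0 c1 c2 \<nu> \<kappa> f0 g" and t: "0 \<le> t" for g t
  proof -
    have gs: "sqint (g s)" if "0 \<le> s" for s
      using g that by (intro H1_sqint) (simp add: global_solution_def)
    have gL: "tr (g s) = Lam \<epsilon> \<gamma> (g s)" if "0 \<le> s" for s by (rule Lam_eq[OF gs[OF that], symmetric])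
    have P: "solution (\<lambda>t. Bcontfun (tr (g t)))"
    proof (rule time_deriv_solution[OF gs])
      fix t :: real assume t: "0 \<le> t"
      from g t obtain G where G: "has_time_deriv (\<lambda>s. Lam \<epsilon> \<gamma> (g s)) G t"
        and AE: "AE z in phase. \<epsilon>\<^sup>2 * G z + \<epsilon> * Lam \<epsilon> \<gamma> (transport (Lam \<epsilon> \<gamma> (g t))) z =
          - (1 / \<nu>) * Lam \<epsilon> \<gamma> (Lop \<epsilon> \<gamma> c0 c1 c2 (Lam \<epsilon> \<gamma> (g t))) z
          + (\<epsilon> * \<kappa> / \<nu>) * Lam \<epsilon> \<gamma> (Lop \<epsilon> \<gamma> c0 c1 c2 (\<lambda>y. (Lam \<epsilon> \<gamma> (g t) y)\<^sup>2)) z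
          - (\<epsilon>\<^sup>2 * \<kappa>\<^sup>2 / \<nu>) * Lam \<epsilon> \<gamma> (\<lambda>y. (Lam \<epsilon> \<gamma> (g t) y) ^ 3) z"
        unfolding global_solution_def solves_equation_def by blast
      have "AE z in phase. G z = tr (rhs (tr (g t))) z"
        using AE unfolding gL[OF t, symmetric] eqn[OF tr_tr] .
      moreover have "has_time_deriv (\<lambda>s. tr (g s)) G t"
        by (rule has_time_deriv_cong[OF G t gL])
      ultimately show "\<exists>G. has_time_deriv (\<lambda>s. tr (g s)) G t \<and> (AE z in phase. G z = tr (rhs (tr (g t))) z)"
        by blast
    qed
    have "AE z in phase. g 0 z = tr f0 z"
      using g unfolding global_solution_def Lam_eq[OF f0] by blast
    \<comment> \<open>Truncation turns almost everywhere equality of the initial values into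
      equality of functions, as an ODE initial value requires.\<close>
    then have "tr (g 0) = tr (tr f0)"
      using gs[of 0] sqint_tr by (intro tr_cong_AE) (auto simp: sqint_def)
    then have "Bcontfun (tr (g 0)) = u 0" by (simp add: tr_tr u(2) x0_def)
    then have "Bcontfun (tr (g t)) = u t" by (rule solution_unique[OF u(1) P _ t])
    then have "tr (g t) = f t"
      unfolding f_def using Bcontfun_inverse[OF tr_bcontfun[OF gs[OF t]]] by metis
    \<comment> \<open>So far only the truncation of \<open>g\<close> is identified; this part of the
      solution concept returns from it to \<open>g\<close>, at the price of a null set.\<close>
    moreover have "AE z in phase. g t z = Lam \<epsilon> \<gamma> (g t) z"
      using g t by (simp add: global_solution_def)
    ultimately show ?thesis by (simp only: gL[OF t, symmetric])
  qed
  show ?thesis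
  proof (intro exI[of _ f] conjI allI impI)
    show "global_solution \<epsilon> \<gamma> c0 c1 c2 \<nu> \<kappa> f0 f" by (rule sol)
    show "set_integrable lborel {0..} (\<lambda>s. (dissipation \<epsilon> \<gamma> c0 c1 c2 (f s))\<^sup>2)" by (rule half(1)) simp
    show "(energy (f t))\<^sup>2 + ?c * (LINT s:{0..t}|lborel. (dissipation \<epsilon> \<gamma> c0 c1 c2 (f s))\<^sup>2) \<le> (energy f0)\<^sup>2"
      if "0 \<le> t" for t
      using est[OF that] half(3)[OF _ _ that] by (simp add: int_eq)
    have "(LINT s:{0..}|lborel. (dissipation \<epsilon> \<gamma> c0 c1 c2 (f s))\<^sup>2) \<le> (energy f0)\<^sup>2 / ?c" by (rule half(2)) simp
    then show "?c * (LINT s:{0..}|lborel. (dissipation \<epsilon> \<gamma> c0 c1 c2 (f s))\<^sup>2) \<le> (energy f0)\<^sup>2"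
      using cpos by (simp only: pos_le_divide_eq mult.commute)
    show "AE z in phase. g t z = f t z"
      if "global_solution \<epsilon> \<gamma> c0 c1 c2 \<nu> \<kappa> f0 g" "0 \<le> t" for g t by (rule uniq[OF that])
  qed
qed

end
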